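(* Let $f$, $\beta\in(0,1/2)$, and the objects in the context be given, let $\kappa=\sqrt{1-2\beta}$, $d_\pm=\tilde f_1(\pm\kappa)$, $\Gamma=\frac{\gamma^2(0,\beta)}{\kappa}(|d_+|^2+|d_-|^2)$ and $W(z)=\frac{i}{z-i\Gamma/2}$. Assume $\Gamma\neq0$. Let $\delta_0(\varepsilon)>0$ satisfy $\varepsilon\delta_0(\varepsilon)^2\to0$ as $\varepsilon\to0$, let $\delta\in(-\delta_0(\varepsilon),\delta_0(\varepsilon))$, set $\nu=\operatorname{Re}\nu_0(\varepsilon,\beta)+\delta$ (assumed $>0$) and $\mu=\varepsilon\nu$. Then, as $\varepsilon\to0$, $$\mathcal R=W\Big(\frac\delta\varepsilon\Big)\Big(\frac{\gamma^2(0,\beta)}{\kappa}\overline{d_+}\,d_-+\delta\,\overline{\tilde f_0(2\kappa)}\frac{\gamma(0,\beta)}{\kappa}+O(\varepsilon+\varepsilon\delta^2)\Big),$$ $$\mathcal T=W\Big(\frac\delta\varepsilon\Big)\Big(\frac{\delta}{i\varepsilon}+\frac{\gamma^2(0,\beta)}{2\kappa}(|d_+|^2-|d_-|^2)+\delta\,\tilde f_0(0)\frac{\gamma(0,\beta)}{\kappa}+O(\varepsilon+\varepsilon\delta^2)\Big).$$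
   Context: Let $f:\mathbb R^2\to\mathbb R$ be smooth, $2\pi$-periodic in $y$, vanishing for $|x|>R$. Let $0<\beta<1/2$, $\varepsilon>0$ small, $\mu$ small. Notation: $f_j(x)=\int_0^{2\pi}e^{-ijy}f(x,y)dy$, $\tilde f_j(\xi)=\int e^{-i\xi x}f_j(x)dx$; $k_0=(1-2\beta-\mu^2)^{1/2}$; $k_m=((\beta+m)^2-(1-\beta)^2+\mu^2)^{1/2}$ for $m\ne0,-1$; kernels $H_0=\frac{i}{2k_0}e^{ik_0|x|}$, $H_{-1}=\frac1{2\mu}(e^{-\mu|x|}-1)$, $H_m=\frac1{2k_m}e^{-k_m|x|}$; $\gamma(\mu,\beta)=\frac1{4\pi}((1-\beta)^2-\mu^2)$; $(\hat T\mathbf A)_m=2\gamma\sum_n(H_n\ast A_n)f_{m-n}$ on sequences $\mathbf A=(A_n)_{n\in\mathbb Z}$ of continuous functions supported in $[-R,R]$ (with $(H\ast A)(x)=\int H(x-\xi)A(\xi)d\xi$); $(\mathbf g^{(1)})_m=e^{ik_0x}f_m$, $(\mathbf g^{(2)})_m=f_{m+1}$; $\langle h\rangle=\int_{\mathbb R}h\,dx$; $F=\langle((1-\varepsilon\hat T)^{-1}\mathbf g^{(2)})_{-1}\rangle$, $Q=\langle((1-\varepsilon\hat T)^{-1}\mathbf g^{(1)})_{-1}\rangle$, $P^\pm=\langle((1-\varepsilon\hat T)^{-1}\mathbf g^{(1)})_0e^{\pm ik_0x}\rangle$, $R^\pm=\langle((1-\varepsilon\hat T)^{-1}\mathbf g^{(2)})_0e^{\pm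 ik_0x}\rangle$, all functions of $(\varepsilon,\mu,\beta)$ analytic for small $\varepsilon,\mu$. The reflection and transmission coefficients of the scattering problem for $-\nabla^2\Psi=\omega^2(1+\varepsilon f)\Psi$, $\omega^2=(1-\beta)^2-\mu^2$, with $\beta$-quasiperiodicity in $y$ and incident wave $e^{i\beta y+ik_0x}$ are $\mathcal R=\frac{i\varepsilon\gamma}{k_0}\frac{(\mu-\varepsilon\gamma F)P^++\varepsilon\gamma QR^+}{\mu-\varepsilon\gamma F}$, $\mathcal T=1+\frac{i\varepsilon\gamma}{k_0}\frac{(\mu-\varepsilon\gamma F)P^-+\varepsilon\gamma QR^-}{\mu-\varepsilon\gamma F}$. $\nu_0(\varepsilon,\beta)=\mu_0(\varepsilon,\beta)/\varepsilon$, where $\mu_0$ is the root of $\mu-\varepsilon\gamma(\mu,\beta)F(\varepsilon,\mu,\beta)=0$ tending to $0$ as $\varepsilon\to0$ (equivalently $\nu_0$ is the root of $\nu-\gamma(\varepsilon\nu,\beta)F(\varepsilon,\varepsilon\nu,\beta)=0$). *)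

theory Defs
  imports "HOL-Analysis.Analysis"
begin

fun Ck :: "nat \<Rightarrow> ('a::real_normed_vector \<Rightarrow> 'b::real_normed_vector) \<Rightarrow> bool" where
  "Ck 0 g = continuous_on UNIV g"
| "Ck (Suc k) g = (\<exists>g'. (\<forall>x. (g has_derivative g' x) (at x)) \<and> (\<forall>v. Ck k (\<lambda>x. g' x v)))"

definition smooth :: "('a::real_normed_vector \<Rightarrow> 'b::real_normed_vector) \<Rightarrow> bool" where
  "smooth g \<longleftrightarrow> (\<forall>k. Ck k g)"

definition fcoef :: "(real \<times> real \<Rightarrow> real) \<Rightarrow> int \<Rightarrow> real \<Rightarrow> complex" where
  "fcoef f j x = integral {0..2*pi} (\<lambda>y. exp (- \<i> * of_int j * of_real y) * of_real (f (x, y)))"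

definition fhat :: "(real \<times> real \<Rightarrow> real) \<Rightarrow> int \<Rightarrow> real \<Rightarrow> complex" where
  "fhat f j \<xi> = integral UNIV (\<lambda>x. exp (- \<i> * of_real \<xi> * of_real x) * fcoef f j x)"

definition kk0 :: "complex \<Rightarrow> real \<Rightarrow> complex" where
  "kk0 \<mu> \<beta> = csqrt (of_real (1 - 2*\<beta>) - \<mu>^2)"

definition kkm :: "int \<Rightarrow> complex \<Rightarrow> real \<Rightarrow> complex" where
  "kkm m \<mu> \<beta> = csqrt (of_real ((\<beta> + of_int m)^2 - (1 - \<beta>)^2) + \<mu>^2)"

definition gam :: "complex \<Rightarrow> real \<Rightarrow> complex" where
  "gam \<mu> \<beta> = (of_real ((1 - \<beta>)^2) - \<mu>^2) / of_real (4*pi)"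

(* kernels H_m; for m = -1 the value at mu = 0 is the (removable) limit -|x|/2 *)
definition Hker :: "int \<Rightarrow> complex \<Rightarrow> real \<Rightarrow> real \<Rightarrow> complex" where
  "Hker m \<mu> \<beta> x =
     (if m = 0 then \<i> / (2 * kk0 \<mu> \<beta>) * exp (\<i> * kk0 \<mu> \<beta> * of_real \<bar>x\<bar>)
      else if m = -1 then
        (if \<mu> = 0 then - of_real \<bar>x\<bar> / 2 else (exp (- \<mu> * of_real \<bar>x\<bar>) - 1) / (2 * \<mu>))
      else 1 / (2 * kkm m \<mu> \<beta>) * exp (- kkm m \<mu> \<beta> * of_real \<bar>x\<bar>))"

definition conv :: "(real \<Rightarrow> complex) \<Rightarrow> (real \<Rightarrow> complex) \<Rightarrow> real \<Rightarrow> complex" where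
  "conv H A x = integral UNIV (\<lambda>\<xi>. H (x - \<xi>) * A \<xi>)"

definition Top :: "(real \<times> real \<Rightarrow> real) \<Rightarrow> complex \<Rightarrow> real
                     \<Rightarrow> (int \<Rightarrow> real \<Rightarrow> complex) \<Rightarrow> (int \<Rightarrow> real \<Rightarrow> complex)" where
  "Top f \<mu> \<beta> A m x =
     2 * gam \<mu> \<beta> * (\<Sum>\<^sub>\<infinity>n\<in>(UNIV::int set). conv (Hker n \<mu> \<beta>) (A n) x * fcoef f (m - n) x)"

(* (1 - eps T)^{-1} g, given by its Neumann series (valid for small eps, mu) *)
definition Res :: "(real \<times> real \<Rightarrow> real) \<Rightarrow> real \<Rightarrow> complex \<Rightarrow> real
                     \<Rightarrow> (int \<Rightarrow> real \<Rightarrow> complex) \<Rightarrow> (int \<Rightarrow> real \<Rightarrow> complex)" where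
  "Res f \<epsilon> \<mu> \<beta> g m x = (\<Sum>k. of_real \<epsilon> ^ k * ((Top f \<mu> \<beta> ^^ k) g) m x)"

definition g1 :: "(real \<times> real \<Rightarrow> real) \<Rightarrow> complex \<Rightarrow> real \<Rightarrow> int \<Rightarrow> real \<Rightarrow> complex" where
  "g1 f \<mu> \<beta> m x = exp (\<i> * kk0 \<mu> \<beta> * of_real x) * fcoef f m x"

definition g2 :: "(real \<times> real \<Rightarrow> real) \<Rightarrow> int \<Rightarrow> real \<Rightarrow> complex" where
  "g2 f m x = fcoef f (m + 1) x"

definition avg :: "(real \<Rightarrow> complex) \<Rightarrow> complex" where
  "avg h = integral UNIV h"

definition FF :: "(real \<times> real \<Rightarrow> real) \<Rightarrow> real \<Rightarrow> complex \<Rightarrow> real \<Rightarrow> complex" where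
  "FF f \<epsilon> \<mu> \<beta> = avg (Res f \<epsilon> \<mu> \<beta> (g2 f) (-1))"

definition QQ :: "(real \<times> real \<Rightarrow> real) \<Rightarrow> real \<Rightarrow> complex \<Rightarrow> real \<Rightarrow> complex" where
  "QQ f \<epsilon> \<mu> \<beta> = avg (Res f \<epsilon> \<mu> \<beta> (g1 f \<mu> \<beta>) (-1))"

definition PP :: "real \<Rightarrow> (real \<times> real \<Rightarrow> real) \<Rightarrow> real \<Rightarrow> complex \<Rightarrow> real \<Rightarrow> complex" where
  "PP s f \<epsilon> \<mu> \<beta> =
     avg (\<lambda>x. Res f \<epsilon> \<mu> \<beta> (g1 f \<mu> \<beta>) 0 x * exp (of_real s * \<i> * kk0 \<mu> \<beta> * of_real x))"

definition RR :: "real \<Rightarrow> (real \<times> real \<Rightarrow> real) \<Rightarrow> real \<Rightarrow> complex \<Rightarrow> real \<Rightarrow> complex" where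
  "RR s f \<epsilon> \<mu> \<beta> =
     avg (\<lambda>x. Res f \<epsilon> \<mu> \<beta> (g2 f) 0 x * exp (of_real s * \<i> * kk0 \<mu> \<beta> * of_real x))"

definition scat :: "real \<Rightarrow> (real \<times> real \<Rightarrow> real) \<Rightarrow> real \<Rightarrow> complex \<Rightarrow> real \<Rightarrow> complex" where
  "scat s f \<epsilon> \<mu> \<beta> =
     \<i> * of_real \<epsilon> * gam \<mu> \<beta> / kk0 \<mu> \<beta> *
     (((\<mu> - of_real \<epsilon> * gam \<mu> \<beta> * FF f \<epsilon> \<mu> \<beta>) * PP s f \<epsilon> \<mu> \<beta>
        + of_real \<epsilon> * gam \<mu> \<beta> * QQ f \<epsilon> \<mu> \<beta> * RR s f \<epsilon> \<mu> \<beta>)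
      / (\<mu> - of_real \<epsilon> * gam \<mu> \<beta> * FF f \<epsilon> \<mu> \<beta>))"

definition Refl :: "(real \<times> real \<Rightarrow> real) \<Rightarrow> real \<Rightarrow> complex \<Rightarrow> real \<Rightarrow> complex" where
  "Refl f \<epsilon> \<mu> \<beta> = scat 1 f \<epsilon> \<mu> \<beta>"

definition Trans :: "(real \<times> real \<Rightarrow> real) \<Rightarrow> real \<Rightarrow> complex \<Rightarrow> real \<Rightarrow> complex" where
  "Trans f \<epsilon> \<mu> \<beta> = 1 + scat (-1) f \<epsilon> \<mu> \<beta>"

definition Wfun :: "real \<Rightarrow> real \<Rightarrow> complex" where
  "Wfun \<Gamma> z = \<i> / (of_real z - \<i> * of_real \<Gamma> / 2)"

end

theory Submission
  imports Defs "HOL-Library.Landau_Symbols"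
begin

text \<open>
  The Neumann series for \<open>(1 - \<epsilon> T)\<^sup>-\<^sup>1\<close> is controlled in the supremum norm on sequences of continuous
  functions supported in \<open>[-R, R]\<close>: the Fourier coefficients of \<open>f\<close> are summable uniformly in \<open>x\<close>, and
  the kernels are bounded and Lipschitz in \<open>\<mu>\<close> uniformly in the index. Hence \<open>P\<close>, \<open>Q\<close> and \<open>R\<close> equal their
  values at \<open>\<epsilon> = \<mu> = 0\<close> up to \<open>O(\<epsilon> + |\<mu>|)\<close>. In the first-order coefficient of \<open>F\<close> only the propagating mode
  \<open>n = 0\<close> has a non-Hermitian kernel, which gives \<open>Im \<nu>\<^sub>0 = \<epsilon> \<Gamma> / 2 + O(\<epsilon>\<^sup>2)\<close>. As \<open>\<gamma> F\<close> is Lipschitz in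
  \<open>\<mu> = \<epsilon> \<nu>\<close>, the denominator \<open>\<mu> - \<epsilon> \<gamma> F\<close> is \<open>\<epsilon> (\<delta> - i \<epsilon> \<Gamma> / 2) (1 + O(\<epsilon>))\<close>, and \<open>W\<close> is
  \<open>i \<epsilon>\<close> divided by \<open>\<delta> - i \<epsilon> \<Gamma> / 2\<close>.
\<close>

text \<open>The obstacle is uniformity in \<delta>. The window contains values of \<delta> far
  smaller than \<epsilon>, where the denominator is only of order \<epsilon>^2, so its error must be
  relative, not additive. Two facts give this. The denominator vanishes exactly at the complex root
  \<epsilon> \<nu>0, so subtracting the root equation leaves \<epsilon> (\<nu> - \<nu>0) with an
  error O(\<epsilon>) relative to it. And w = \<delta> - i \<epsilon> \<Gamma> / 2 satisfies |w|
  \<ge> \<epsilon> \<Gamma> / 2, so the error O(\<epsilon>^2) in Im \<nu>0 is O(\<epsilon>) |w|;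
  this is where \<Gamma> \<noteq> 0 enters. At the other end \<delta> may be unbounded. From
  \<epsilon> \<delta>0^2 < 1 follows (\<epsilon> \<delta>)^2 \<le> \<epsilon>, so \<mu> stays small
  and the coefficients carry errors O(\<epsilon> (1 + |\<delta>|)). Multiplied by \<delta> in the
  term w P, these produce the error \<epsilon> \<delta>^2. The leading 1 of the transmission
  coefficient is W times \<delta> / (i \<epsilon>) - \<Gamma> / 2; the summand - \<Gamma> / 2 turns
  the contribution of |d_+|^2 into half the difference of |d_+|^2 and |d_-|^2.\<close>

definition bdd_seq :: "real \<Rightarrow> real \<Rightarrow> (int \<Rightarrow> real \<Rightarrow> complex) \<Rightarrow> bool" where
  "bdd_seq R M A \<longleftrightarrow> (\<forall>m. continuous_on UNIV (A m)) \<and> (\<forall>m x. cmod (A m x) \<le> M) \<and>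
     (\<forall>m x. \<bar>x\<bar> > R \<longrightarrow> A m x = 0)"

lemma bdd_seqI:
  assumes "\<And>m. continuous_on UNIV (A m)" "\<And>m x. cmod (A m x) \<le> M" "\<And>m x. \<bar>x\<bar> > R \<Longrightarrow> A m x = 0"
  shows "bdd_seq R M A"
  using assms by (auto simp: bdd_seq_def)

lemma bdd_seqD:
  assumes "bdd_seq R M A"
  shows "continuous_on S (A m)" "cmod (A m x) \<le> M" "\<bar>x\<bar> > R \<Longrightarrow> A m x = 0" "0 \<le> M"
  using assms norm_ge_zero[of "A m x"] unfolding bdd_seq_def
  by (meson continuous_on_subset subset_UNIV order_trans norm_ge_zero)+

section \<open>Integrals of functions supported in [-R, R]\<close>

lemma integral_UNIV_eq_interval:
  fixes h :: "real \<Rightarrow> complex"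
  assumes "\<And>x. \<bar>x\<bar> > R \<Longrightarrow> h x = 0"
  shows "integral UNIV h = integral {-R..R} h"
proof -
  have "h = (\<lambda>x. if x \<in> {-R..R} then h x else 0)"
    using assms by (auto simp: fun_eq_iff abs_le_iff)
  thus ?thesis
    using integral_restrict_UNIV[of "{-R..R}" h] by simp
qed

lemma norm_integral_le:
  fixes h :: "real \<Rightarrow> complex"
  assumes "0 \<le> R" "continuous_on {-R..R} h" "\<And>x. \<bar>x\<bar> \<le> R \<Longrightarrow> cmod (h x) \<le> B"
  shows "cmod (integral {-R..R} h) \<le> 2 * R * B"
proof -
  have "cmod (integral {-R..R} h) \<le> B * (R - (-R))"
    by (rule integral_bound) (use assms in auto)
  thus ?thesis by (simp add: algebra_simps)
qed

lemma norm_integral_diff_le: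
  fixes h g :: "real \<Rightarrow> complex"
  assumes "0 \<le> R" "continuous_on {-R..R} h" "continuous_on {-R..R} g"
    and "\<And>x. \<bar>x\<bar> \<le> R \<Longrightarrow> cmod (h x - g x) \<le> B"
  shows "cmod (integral {-R..R} h - integral {-R..R} g) \<le> 2 * R * B"
proof -
  have "integral {-R..R} h - integral {-R..R} g = integral {-R..R} (\<lambda>x. h x - g x)"
    by (rule integral_diff [symmetric]) (auto intro!: integrable_continuous_real assms)
  thus ?thesis
    using norm_integral_le[of R "\<lambda>x. h x - g x" B] assms by (auto intro: continuous_intros)
qed

subsection \<open>Fourier coefficients\<close>

lemma summable_inverse_square_int: "(\<lambda>j::int. 1 / (1 + (real_of_int j)\<^sup>2)) summable_on UNIV"
proof -
  let ?w = "\<lambda>j::int. 1 / (1 + (real_of_int j)\<^sup>2)"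
  have 1: "summable (\<lambda>n::nat. norm (1 / (1 + (real n)\<^sup>2)))"
  proof (rule summable_comparison_test'[where N = 1])
    show "summable (\<lambda>n. inverse (real n ^ 2))"
      by (rule inverse_power_summable) simp
    show "norm (norm (1 / (1 + (real n)\<^sup>2))) \<le> inverse (real n ^ 2)" if "n \<ge> 1" for n
      using that by (simp add: inverse_eq_divide frac_le)
  qed
  hence 2: "(\<lambda>n::nat. 1 / (1 + (real n)\<^sup>2)) summable_on UNIV"
    by (rule norm_summable_imp_summable_on)
  have "?w summable_on range int"
    using 2 by (subst summable_on_reindex) (auto simp: o_def)
  moreover have "?w summable_on range (\<lambda>n. - int n)"
    using 2 by (subst summable_on_reindex) (auto simp: o_def inj_on_def)
  ultimately have "?w summable_on (range int \<union> range (\<lambda>n. - int n))"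
    by (rule summable_on_union)
  moreover have "range int \<union> range (\<lambda>n. - int n) = UNIV"
  proof -
    have "m \<in> range int \<union> range (\<lambda>n. - int n)" for m
      by (cases m rule: int_cases2) auto
    thus ?thesis by auto
  qed
  ultimately show ?thesis by simp
qed

lemma exp_imag_periodic: "exp (- \<i> * of_int j * of_real (2 * pi)) = 1"
proof -
  have "exp (- \<i> * of_int j * of_real (2 * pi)) = exp (of_int (-j) * (of_real (2 * pi) * \<i>))"
    by (rule arg_cong[where f = exp]) (simp add: algebra_simps)
  also have "\<dots> = 1"
    unfolding exp_eq_1 by (auto intro!: exI[of _ "-j"])
  finally show ?thesis .
qed

text \<open>The radius is taken strictly positive so that constants proportional to R are positive.
  A support bound may always be enlarged, and the final theorem uses
  \<open>\<bar>Rs\<bar> + 1\<close>.\<close>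

locale grating =
  fixes f :: "real \<times> real \<Rightarrow> real" and R \<beta> :: real
  assumes smooth: "smooth f"
    and per: "\<And>x y. f (x, y + 2 * pi) = f (x, y)"
    and supp: "\<And>x y. \<bar>x\<bar> > R \<Longrightarrow> f (x, y) = 0"
    and \<beta>: "0 < \<beta>" "\<beta> < 1 / 2"
    and R: "R > 0"
begin

lemma continuous_f: "continuous_on UNIV f"
  using smooth unfolding smooth_def by (metis Ck.simps(1))

lemma continuous_fcoef: "continuous_on S (fcoef f j)"
proof -
  have "continuous_on UNIV (\<lambda>x. integral (cbox 0 (2 * pi))
          (\<lambda>y. exp (- \<i> * of_int j * of_real y) * of_real (f (x, y))))"
    by (rule integral_continuous_on_param)
       (auto simp: case_prod_unfold intro!: continuous_intros continuous_on_subset[OF continuous_f])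
  thus ?thesis
    unfolding fcoef_def [abs_def] by (auto intro: continuous_on_subset)
qed

lemma fcoef_supp: "\<bar>x\<bar> > R \<Longrightarrow> fcoef f j x = 0"
  unfolding fcoef_def by (simp add: supp)

text \<open>Reality of f: it makes the infinite matrix with entries f_{m-n} Hermitian, which is what
  forces the imaginary part of the first-order coefficient to come from a complex kernel
  alone.\<close>

lemma fcoef_uminus: "fcoef f (- j) x = cnj (fcoef f j x)"
  unfolding fcoef_def integral_cnj by (simp add: exp_cnj)

text \<open>\<open>Ck\<close> describes higher derivatives through total derivatives evaluated on
  fixed vectors; evaluation on (0, 1) gives the partial derivative in y. Two derivatives are enough
  for summable Fourier coefficients.\<close>

lemma obtain_y_derivatives:
  obtains f1 f2 :: "real \<times> real \<Rightarrow> real"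
  where "\<And>x y. ((\<lambda>y. f (x, y)) has_real_derivative f1 (x, y)) (at y)"
    and "\<And>x y. ((\<lambda>y. f1 (x, y)) has_real_derivative f2 (x, y)) (at y)"
    and "continuous_on UNIV f1" "continuous_on UNIV f2"
proof -
  have section_deriv: "((\<lambda>y. g (x, y)) has_real_derivative g' (x, y) (0, 1)) (at y)"
    if g: "\<forall>p. (g has_derivative g' p) (at p)" for g :: "real \<times> real \<Rightarrow> real" and g' x y
  proof -
    have l: "linear (g' (x, y))"
      using g has_derivative_linear by blast
    have "((\<lambda>y. (x, y)) has_derivative (\<lambda>h. (0, h))) (at y)"
      by (auto intro!: derivative_eq_intros)
    moreover have "(g has_derivative g' (x, y)) (at (x, y))"
      using g by blast
    ultimately have "((\<lambda>y. g (x, y)) has_derivative (\<lambda>h. g' (x, y) (0, h))) (at y)"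
      using has_derivative_compose by blast
    moreover have "(\<lambda>h. g' (x, y) (0, h)) = (*) (g' (x, y) (0, 1))"
    proof
      fix h :: real
      show "g' (x, y) (0, h) = g' (x, y) (0, 1) * h"
        using linear_cmul[OF l, of h "(0, 1)"] by simp
    qed
    ultimately show ?thesis
      by (simp add: has_field_derivative_def)
  qed
  have "Ck (Suc (Suc 0)) f"
    using smooth unfolding smooth_def by blast
  then obtain f' where f': "\<forall>p. (f has_derivative f' p) (at p)" and "\<forall>v. Ck (Suc 0) (\<lambda>p. f' p v)"
    by (metis Ck.simps(2))
  then obtain f'' where f'': "\<forall>p. ((\<lambda>p. f' p (0, 1)) has_derivative f'' p) (at p)"
    and c: "continuous_on UNIV (\<lambda>p. f'' p (0, 1))"
    by (metis Ck.simps)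
  show ?thesis
  proof (rule that)
    show "((\<lambda>y. f (x, y)) has_real_derivative f' (x, y) (0, 1)) (at y)" for x y
      using section_deriv[OF f'] .
    show "((\<lambda>y. f' (x, y) (0, 1)) has_real_derivative f'' (x, y) (0, 1)) (at y)" for x y
      using section_deriv[OF f''] .
    show "continuous_on UNIV (\<lambda>p. f' p (0, 1))"
      using f'' by (meson differentiable_imp_continuous_on differentiable_on_def
          differentiable_at_withinI differentiable_def)
  qed (use c in auto)
qed

text \<open>Two integrations by parts in y; periodicity of f and of its y-derivative removes the
  boundary terms, and compactness of [-R, R] x [0, 2 pi] makes the bound uniform in x. The weight 1
  + j^2 includes j = 0 without a separate case later.\<close>

lemma fcoef_decay: "\<exists>C>0. \<forall>j x. cmod (fcoef f j x) \<le> C / (1 + (real_of_int j)\<^sup>2)"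
proof -
  obtain f1 f2 where d1: "\<And>x y. ((\<lambda>y. f (x, y)) has_real_derivative f1 (x, y)) (at y)"
    and d2: "\<And>x y. ((\<lambda>y. f1 (x, y)) has_real_derivative f2 (x, y)) (at y)"
    and c1: "continuous_on UNIV f1" and c2: "continuous_on UNIV f2"
    using obtain_y_derivatives by blast
  have bound: "\<exists>B. \<forall>p \<in> cbox (-R, 0) (R, 2 * pi). \<bar>g p\<bar> \<le> B"
    if "continuous_on UNIV g" for g :: "real \<times> real \<Rightarrow> real"
  proof -
    have "compact (g ` cbox (-R, 0) (R, 2 * pi))"
      using that by (intro compact_continuous_image compact_cbox) (auto intro: continuous_on_subset)
    hence "bounded (g ` cbox (-R, 0) (R, 2 * pi))"
      by (rule compact_imp_bounded)
    thus ?thesis unfolding bounded_iff by auto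
  qed
  obtain B0 where B0: "\<forall>p \<in> cbox (-R, 0) (R, 2 * pi). \<bar>f p\<bar> \<le> B0"
    using bound[OF continuous_f] by blast
  obtain B2 where B2: "\<forall>p \<in> cbox (-R, 0) (R, 2 * pi). \<bar>f2 p\<bar> \<le> B2"
    using bound[OF c2] by blast
  \<comment> \<open>The entry 1 keeps the final constant positive even if f vanishes.\<close>
  define B where "B = Max {B0, B2, 1}"
  have B: "B0 \<le> B" "B2 \<le> B" "B \<ge> 1"
    unfolding B_def by auto
  have per1: "f1 (x, 2 * pi) = f1 (x, 0)" for x
  proof -
    have "((\<lambda>y. f (x, y + 2 * pi)) has_real_derivative f1 (x, 0 + 2 * pi)) (at 0)"
      using d1[of x "0 + 2 * pi"] DERIV_shift[of "\<lambda>y. f (x, y)" _ 0 "2 * pi"] by blast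
    thus ?thesis using d1[of x 0] DERIV_unique by (simp add: per) blast
  qed
  have cf: "continuous_on UNIV (\<lambda>y. f (x, y))" "continuous_on UNIV (\<lambda>y. f2 (x, y))" for x
    by (auto intro!: continuous_on_compose2[OF continuous_f] continuous_on_compose2[OF c2] continuous_intros)
  have main: "cmod (fcoef f j x) \<le> 4 * pi * B / (1 + (real_of_int j)\<^sup>2)" if x: "\<bar>x\<bar> \<le> R" for j x
  proof -
    have box: "(x, y) \<in> cbox (-R, 0) (R, 2 * pi)" if "y \<in> {0..2 * pi}" for y
      using x that by (auto simp: abs_le_iff)
    let ?e = "\<lambda>y::real. exp (- \<i> * of_int j * of_real y)"
    have ne: "norm (?e y) = 1" for y
      using norm_exp_i_times[of "- of_int j * y"] by (simp add: mult.assoc)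
    show ?thesis
    proof (cases "j = 0")
      case True
      have "cmod (fcoef f j x) \<le> B * (2 * pi - 0)"
        unfolding fcoef_def
      proof (rule integral_bound)
        show "cmod (?e y * complex_of_real (f (x, y))) \<le> B" if "y \<in> {0..2 * pi}" for y
          using bspec[OF B0 box[OF that]] B by (simp add: norm_mult ne)
      qed (auto intro!: continuous_intros continuous_on_subset[OF cf(1)])
      also have "\<dots> \<le> 4 * pi * B / (1 + (real_of_int j)\<^sup>2)"
        using True B by simp
      finally show ?thesis .
    next
      case False
      define c where "c = - \<i> * of_int j"
      have c0: "c \<noteq> 0" and nc: "cmod c ^ 2 = (real_of_int j)\<^sup>2"
        using False by (auto simp: c_def norm_mult)
      let ?G = "\<lambda>g y. complex_of_real (g (x, y))"
      have de: "((\<lambda>y. exp (c * of_real y)) has_vector_derivative c * exp (c * of_real y)) (at y within S)" for y S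
        by (rule has_vector_derivative_real_field) (auto intro!: derivative_eq_intros)
      have dG: "((\<lambda>y. ?G f y) has_vector_derivative ?G f1 y) (at y within S)"
           "((\<lambda>y. ?G f1 y) has_vector_derivative ?G f2 y) (at y within S)" for y S
        using d1[of x y] d2[of x y]
        by (auto intro: has_vector_derivative_of_real has_field_derivative_at_within)
      \<comment> \<open>Both integrations by parts are done at once: e^{cy} (f / c - f1 / c^2) is an
        explicit antiderivative of e^{cy} (f - f2 / c^2), because the f1 terms cancel. Its endpoint
        values agree by periodicity.\<close>
      have "((\<lambda>y. exp (c * of_real y) * (?G f y - ?G f2 y / c\<^sup>2)) has_integral
              (exp (c * of_real (2 * pi)) * (?G f (2 * pi) / c - ?G f1 (2 * pi) / c\<^sup>2)
                - exp (c * of_real 0) * (?G f 0 / c - ?G f1 0 / c\<^sup>2))) {0..2 * pi}"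
      proof (rule fundamental_theorem_of_calculus)
        show "((\<lambda>y. exp (c * of_real y) * (?G f y / c - ?G f1 y / c\<^sup>2)) has_vector_derivative
            exp (c * of_real y) * (?G f y - ?G f2 y / c\<^sup>2)) (at y within {0..2 * pi})" for y
        proof -
          have "((\<lambda>y. exp (c * of_real y) * (?G f y / c - ?G f1 y / c\<^sup>2)) has_vector_derivative
              exp (c * of_real y) * (?G f1 y / c - ?G f2 y / c\<^sup>2)
              + c * exp (c * of_real y) * (?G f y / c - ?G f1 y / c\<^sup>2)) (at y within {0..2 * pi})"
            by (intro has_vector_derivative_mult has_vector_derivative_diff has_vector_derivative_divide de dG)
          moreover have "exp (c * of_real y) * (?G f1 y / c - ?G f2 y / c\<^sup>2)
              + c * exp (c * of_real y) * (?G f y / c - ?G f1 y / c\<^sup>2)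
              = exp (c * of_real y) * (?G f y - ?G f2 y / c\<^sup>2)"
            using c0 by (simp add: field_simps power2_eq_square)
          ultimately show ?thesis by simp
        qed
      qed simp
      moreover have "exp (c * of_real (2 * pi)) = 1"
        using exp_imag_periodic[of j] by (simp add: c_def)
      moreover have "f (x, 2 * pi) = f (x, 0)"
        using per[of x 0] by simp
      ultimately have "((\<lambda>y. exp (c * of_real y) * (?G f y - ?G f2 y / c\<^sup>2)) has_integral 0) {0..2 * pi}"
        using per1[of x] by simp
      hence 0: "integral {0..2 * pi} (\<lambda>y. exp (c * of_real y) * ?G f y - exp (c * of_real y) * ?G f2 y / c\<^sup>2) = 0"
        by (simp add: integral_unique algebra_simps)
      have "integral {0..2 * pi} (\<lambda>y. exp (c * of_real y) * ?G f y)
         = integral {0..2 * pi} (\<lambda>y. exp (c * of_real y) * ?G f2 y / c\<^sup>2)"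
        using 0 by (subst (asm) integral_diff)
           (use c0 in \<open>auto intro!: integrable_continuous_real continuous_intros continuous_on_subset[OF cf(1)]
                continuous_on_subset[OF cf(2)]\<close>)
      moreover have "cmod (integral {0..2 * pi} (\<lambda>y. exp (c * of_real y) * ?G f2 y / c\<^sup>2)) \<le> (B / (real_of_int j)\<^sup>2) * (2 * pi - 0)"
      proof (rule integral_bound)
        show "cmod (exp (c * of_real y) * ?G f2 y / c\<^sup>2) \<le> B / (real_of_int j)\<^sup>2" if "y \<in> {0..2 * pi}" for y
        proof -
          have "\<bar>f2 (x, y)\<bar> \<le> B"
            using bspec[OF B2 box[OF that]] B by simp
          moreover have "cmod (exp (c * of_real y)) = 1"
            using ne[of y] by (simp add: c_def)
          ultimately show ?thesis
            by (simp only: norm_mult norm_divide norm_power nc norm_of_real) (simp add: divide_right_mono)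
        qed
      qed (use c0 in \<open>auto intro!: continuous_intros continuous_on_subset[OF cf(2)]\<close>)
      ultimately have 1: "cmod (fcoef f j x) \<le> B / (real_of_int j)\<^sup>2 * (2 * pi)"
        by (simp add: fcoef_def c_def)
      have "1 \<le> (real_of_int j)\<^sup>2"
        using False by (metis of_int_1_le_iff of_int_power zero_less_power2 int_one_le_iff_zero_less)
      \<comment> \<open>The factor 4 pi instead of 2 pi pays for 1 + j^2 \<le> 2 j^2, valid for
        nonzero integers j.\<close>
      hence "B / (real_of_int j)\<^sup>2 * (2 * pi) \<le> 4 * pi * B / (1 + (real_of_int j)\<^sup>2)"
        using B by (simp add: divide_simps)
      thus ?thesis using 1 by simp
    qed
  qed
  show ?thesis
  proof (intro exI[of _ "4 * pi * B"] conjI allI)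
    show "cmod (fcoef f j x) \<le> 4 * pi * B / (1 + (real_of_int j)\<^sup>2)" for j x
      using main[of x j] fcoef_supp[of x j] B by (cases "\<bar>x\<bar> \<le> R") auto
  qed (use B in auto)
qed

end

subsection \<open>Kernels\<close>

lemma Re_csqrt_ge:
  assumes "0 \<le> a" "a \<le> Re z"
  shows "sqrt a \<le> Re (csqrt z)"
  using assms complex_Re_le_cmod[of z] by simp

text \<open>Multiply the difference of the roots by their sum: the product is z - w, and the sum has
  real part at least 2 sqrt a.\<close>

lemma norm_csqrt_diff_le:
  assumes "0 < a" "a \<le> Re z" "a \<le> Re w"
  shows "cmod (csqrt z - csqrt w) \<le> cmod (z - w) / (2 * sqrt a)"
proof -
  have z: "sqrt a \<le> Re (csqrt z)" "sqrt a \<le> Re (csqrt w)"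
    using assms by (auto intro!: Re_csqrt_ge simp del: csqrt.simps)
  have s: "2 * sqrt a \<le> cmod (csqrt z + csqrt w)"
    using z complex_Re_le_cmod[of "csqrt z + csqrt w"] by (simp del: csqrt.simps)
  have "(csqrt z - csqrt w) * (csqrt z + csqrt w) = (csqrt z)\<^sup>2 - (csqrt w)\<^sup>2"
    by (simp only: power2_eq_square algebra_simps)
  hence "cmod (csqrt z - csqrt w) * cmod (csqrt z + csqrt w) = cmod (z - w)"
    by (metis norm_mult power2_csqrt)
  moreover have "cmod (csqrt z - csqrt w) * (2 * sqrt a) \<le> cmod (csqrt z - csqrt w) * cmod (csqrt z + csqrt w)"
    using s by (intro mult_left_mono) auto
  ultimately show ?thesis
    using assms by (simp add: pos_le_divide_eq)
qed

text \<open>The mean value inequality on the convex half-plane Re z \<le> M, where |exp| is at most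
  exp M.\<close>

lemma norm_exp_diff_le:
  assumes "Re p \<le> M" "Re q \<le> M"
  shows "cmod (exp p - exp q) \<le> exp M * cmod (p - q)"
proof (rule field_differentiable_bound[where S = "{z. Re z \<le> M}" and f' = exp])
  show "convex {z. Re z \<le> M}"
    by (rule convex_halfspace_Re_le)
qed (use assms in \<open>auto intro!: derivative_eq_intros\<close>)

text \<open>One form for the propagating kernel, with p = i k |x|, and the evanescent ones, with p =
  - k |x|. The two terms of the constant come from varying the exponent and from varying the factor
  1 / k.\<close>

lemma exp_kernel_lipschitz:
  assumes "0 < c" "c \<le> cmod k" "c \<le> cmod l" "Re p \<le> M" "Re q \<le> M" "cmod (p - q) \<le> N * cmod (k - l)"
  shows "cmod (exp p / (2 * k) - exp q / (2 * l)) \<le> exp M * (N / (2 * c) + 1 / (2 * c\<^sup>2)) * cmod (k - l)"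
proof -
  have nz: "k \<noteq> 0" "l \<noteq> 0"
    using assms by auto
  have "exp p / (2 * k) - exp q / (2 * l) = (exp p - exp q) / (2 * k) + exp q * (l - k) / (2 * k * l)"
    using nz by (simp add: field_simps)
  moreover have "cmod ((exp p - exp q) / (2 * k)) \<le> exp M * (N * cmod (k - l)) / (2 * c)"
  proof -
    have *: "cmod (exp p - exp q) \<le> exp M * (N * cmod (k - l))"
      using norm_exp_diff_le[OF assms(4,5)] assms(6) by (meson exp_ge_zero mult_left_mono order_trans)
    show ?thesis
      using assms(1,2) * order_trans[OF norm_ge_zero *] by (auto simp: norm_divide norm_mult intro!: frac_le)
  qed
  moreover have "cmod (exp q * (l - k) / (2 * k * l)) \<le> exp M * cmod (k - l) / (2 * c\<^sup>2)"
  proof -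
    have "c\<^sup>2 \<le> cmod k * cmod l"
      unfolding power2_eq_square using assms by (intro mult_mono) auto
    thus ?thesis
      using assms(1,5) by (auto simp: norm_divide norm_mult norm_minus_commute mult.assoc
          intro!: frac_le mult_right_mono)
  qed
  ultimately have "cmod (exp p / (2 * k) - exp q / (2 * l))
      \<le> exp M * (N * cmod (k - l)) / (2 * c) + exp M * cmod (k - l) / (2 * c\<^sup>2)"
    by (metis norm_triangle_mono)
  also have "\<dots> = exp M * (N / (2 * c) + 1 / (2 * c\<^sup>2)) * cmod (k - l)"
    by (simp add: algebra_simps)
  finally show ?thesis .
qed

text \<open>This serves the kernel of index -1, whose singularity at \<mu> = 0 is removable.
  Estimating the quotient directly would lose a factor 1 / \<mu>; but as a function of t it vanishes
  at 0 and has derivative - e^{- \<mu> t}, which is regular in \<mu>, so the bound is integrated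
  from the derivative.\<close>

lemma exp_primitive_lipschitz:
  fixes \<mu> \<nu> :: complex and t T :: real
  defines "\<psi> \<equiv> \<lambda>\<mu> t. if \<mu> = 0 then - complex_of_real t else (exp (- \<mu> * of_real t) - 1) / \<mu>"
  assumes "cmod \<mu> \<le> 1" "cmod \<nu> \<le> 1" "0 \<le> t" "t \<le> T"
  shows "cmod (\<psi> \<mu> t - \<psi> \<nu> t) \<le> T * (exp T * (T * cmod (\<mu> - \<nu>)))"
proof -
  have d: "((\<lambda>t. \<psi> \<mu> t) has_vector_derivative - exp (- \<mu> * of_real t)) (at t within S)" for \<mu> t S
  proof (cases "\<mu> = 0")
    case True
    thus ?thesis unfolding \<psi>_def
      by (auto intro!: derivative_eq_intros)
  next
    case False
    have "((\<lambda>t. (exp (- \<mu> * of_real t) - 1) / \<mu>) has_vector_derivative - exp (- \<mu> * of_real t)) (at t within S)"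
      by (rule has_vector_derivative_real_field) (use False in \<open>auto intro!: derivative_eq_intros\<close>)
    thus ?thesis unfolding \<psi>_def using False by simp
  qed
  let ?d = "\<lambda>t::real. - exp (- \<mu> * of_real t) - (- exp (- \<nu> * of_real t))"
  \<comment> \<open>Linearization at t = 0, where both the difference and its derivative - 1 + 1
    vanish, so the left-hand side is just the difference at t.\<close>
  have "norm ((\<psi> \<mu> t - \<psi> \<nu> t) - (\<psi> \<mu> 0 - \<psi> \<nu> 0) - (t - 0) *\<^sub>R ?d 0)
      \<le> norm (t - 0) * (exp T * (T * cmod (\<mu> - \<nu>)))"
  proof (rule vector_differentiable_bound_linearization[where S = "{0..T}" and f' = ?d and ?x0.0 = 0
        and f = "\<lambda>t. \<psi> \<mu> t - \<psi> \<nu> t"])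
    show "((\<lambda>t. \<psi> \<mu> t - \<psi> \<nu> t) has_vector_derivative ?d s) (at s within {0..T})" for s
      by (intro has_vector_derivative_diff d)
    show "closed_segment 0 t \<subseteq> {0..T}"
      using assms by (auto simp: closed_segment_eq_real_ivl)
    show "norm (?d s - ?d 0) \<le> exp T * (T * cmod (\<mu> - \<nu>))" if s: "s \<in> {0..T}" for s
    proof -
      have re: "Re (- \<zeta> * of_real s) \<le> T" if "cmod \<zeta> \<le> 1" for \<zeta>
      proof -
        have "Re (- \<zeta> * of_real s) \<le> cmod (- \<zeta> * of_real s)"
          by (rule complex_Re_le_cmod)
        also have "\<dots> = cmod \<zeta> * s"
          using s by (simp add: norm_mult)
        also have "\<dots> \<le> 1 * T"
          using s that by (intro mult_mono) auto
        finally show ?thesis by simp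
      qed
      have "norm (?d s - ?d 0) = cmod (exp (- \<mu> * of_real s) - exp (- \<nu> * of_real s))"
        by (simp add: norm_minus_commute)
      also have "\<dots> \<le> exp T * cmod (- \<mu> * of_real s - - \<nu> * of_real s)"
        by (intro norm_exp_diff_le re assms)
      also have "cmod (- \<mu> * of_real s - - \<nu> * of_real s) = s * cmod (\<mu> - \<nu>)"
      proof -
        have "- \<mu> * of_real s - - \<nu> * of_real s = of_real s * (\<nu> - \<mu>)"
          by (simp add: algebra_simps)
        thus ?thesis using s by (simp add: norm_mult norm_minus_commute)
      qed
      also have "exp T * (s * cmod (\<mu> - \<nu>)) \<le> exp T * (T * cmod (\<mu> - \<nu>))"
        using s by (intro mult_left_mono mult_right_mono) auto
      finally show ?thesis .
    qed
  qed (use assms in auto)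
  moreover have "\<psi> \<mu> 0 = 0" for \<mu>
    by (simp add: \<psi>_def)
  ultimately have "cmod (\<psi> \<mu> t - \<psi> \<nu> t) \<le> t * (exp T * (T * cmod (\<mu> - \<nu>)))"
    using assms by simp
  also have "\<dots> \<le> T * (exp T * (T * cmod (\<mu> - \<nu>)))"
    using assms by (intro mult_right_mono) auto
  finally show ?thesis .
qed

context grating
begin

text \<open>For \<open>|\<mu>| \<le> r\<close> the arguments of all the square roots \<open>k\<^sub>0\<close>, \<open>k\<^sub>m\<close> have real part at least \<open>c0\<close>, so that
  they stay away from the branch cut of \<open>csqrt\<close>.\<close>

definition r :: real where "r = min \<beta> (min 1 ((1 - 2 * \<beta>) / 2))"

lemma r: "0 < r" "r \<le> 1" "r \<le> \<beta>" "r \<le> (1 - 2 * \<beta>) / 2" "r\<^sup>2 \<le> r"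
proof -
  have "0 < r \<and> r \<le> 1 \<and> r \<le> \<beta> \<and> r \<le> (1 - 2 * \<beta>) / 2"
    unfolding r_def using \<beta> by (auto simp: min_def)
  thus "0 < r" "r \<le> 1" "r \<le> \<beta>" "r \<le> (1 - 2 * \<beta>) / 2"
    by blast+
  thus "r\<^sup>2 \<le> r"
    by (simp add: power2_eq_square mult_left_le)
qed

lemma cmod_square_le:
  assumes "cmod \<mu> \<le> r"
  shows "cmod (\<mu>\<^sup>2) \<le> r"
proof -
  have "cmod (\<mu>\<^sup>2) \<le> r\<^sup>2"
    using assms by (simp add: norm_power power_mono)
  thus ?thesis using r by simp
qed

lemma cmod_square_diff_le:
  assumes "cmod \<mu> \<le> r" "cmod \<nu> \<le> r"
  shows "cmod (\<mu>\<^sup>2 - \<nu>\<^sup>2) \<le> 2 * cmod (\<mu> - \<nu>)"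
proof -
  have "cmod (\<mu>\<^sup>2 - \<nu>\<^sup>2) = cmod (\<mu> + \<nu>) * cmod (\<mu> - \<nu>)"
    by (simp add: power2_eq_square square_diff_square_factored norm_mult)
  also have "cmod (\<mu> + \<nu>) \<le> 2"
    using norm_triangle_ineq[of \<mu> \<nu>] assms r by simp
  finally show ?thesis by (simp add: mult_right_mono)
qed

definition c0 :: real where "c0 = min \<beta> ((1 - 2 * \<beta>) / 2)"

lemma c0: "0 < c0" "c0 \<le> \<beta>" "c0 \<le> (1 - 2 * \<beta>) / 2"
proof -
  have "0 < c0 \<and> c0 \<le> \<beta> \<and> c0 \<le> (1 - 2 * \<beta>) / 2"
    unfolding c0_def using \<beta> by (auto simp: min_def)
  thus "0 < c0" "c0 \<le> \<beta>" "c0 \<le> (1 - 2 * \<beta>) / 2"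
    by blast+
qed

lemma Re_kk0_arg:
  assumes "cmod \<mu> \<le> r"
  shows "c0 \<le> Re (of_real (1 - 2 * \<beta>) - \<mu>\<^sup>2)"
  using cmod_square_le[OF assms] complex_Re_le_cmod[of "\<mu>\<^sup>2"] r c0 by simp

text \<open>The extremal modes are m = 1 and m = -2, with (\<beta> + m)^2 - (1 - \<beta>)^2 equal to
  4 \<beta> and 3 - 2 \<beta>; both are at least 2 \<beta>, and subtracting |\<mu>^2| \<le> r \<le>
  \<beta> leaves \<beta>. At \<mu> = 0 the two excluded modes would put the argument on the branch
  cut (m = 0) or at the branch point (m = -1).\<close>

lemma Re_kkm_arg:
  assumes "cmod \<mu> \<le> r" "m \<noteq> 0" "m \<noteq> -1"
  shows "c0 \<le> Re (of_real ((\<beta> + of_int m)^2 - (1 - \<beta>)^2) + \<mu>\<^sup>2)"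
proof -
  have "2 * \<beta> \<le> (\<beta> + of_int m)^2 - (1 - \<beta>)^2"
  proof (cases "m \<ge> 1")
    case True
    hence "(\<beta> + 1)^2 \<le> (\<beta> + of_int m)^2"
      using \<beta> by (intro power_mono) auto
    thus ?thesis using \<beta> by (simp add: power2_eq_square algebra_simps)
  next
    case False
    hence "real_of_int m \<le> -2"
      using assms by linarith
    hence "(2 - \<beta>)^2 \<le> (- \<beta> - of_int m)^2"
      using \<beta> by (intro power_mono) auto
    also have "(- \<beta> - of_int m)^2 = (\<beta> + of_int m)^2"
      by (simp add: power2_eq_square algebra_simps)
    finally show ?thesis using \<beta> by (simp add: power2_eq_square algebra_simps)
  qed
  moreover have "- Re (\<mu>\<^sup>2) \<le> r"
    using cmod_square_le[OF assms(1)] abs_Re_le_cmod[of "\<mu>\<^sup>2"] by linarith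
  ultimately show ?thesis
    using r c0 by simp
qed

section \<open>Bounds and Lipschitz dependence of the wave numbers\<close>

lemma kk0_bounds:
  assumes "cmod \<mu> \<le> r"
  shows "sqrt c0 \<le> cmod (kk0 \<mu> \<beta>)" "cmod (kk0 \<mu> \<beta>) \<le> 2"
proof -
  show "sqrt c0 \<le> cmod (kk0 \<mu> \<beta>)"
    using Re_csqrt_ge[OF _ Re_kk0_arg[OF assms]] c0 complex_Re_le_cmod unfolding kk0_def
    by (meson less_imp_le order_trans)
  have "cmod (of_real (1 - 2 * \<beta>) - \<mu>\<^sup>2) \<le> cmod (of_real (1 - 2 * \<beta>)) + cmod (\<mu>\<^sup>2)"
    by (rule norm_triangle_ineq4)
  also have "\<dots> \<le> 2\<^sup>2"
    using cmod_square_le[OF assms] r \<beta> by (simp only: norm_of_real) simp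
  finally show "cmod (kk0 \<mu> \<beta>) \<le> 2"
    unfolding kk0_def norm_csqrt by (rule real_le_lsqrt[rotated -1]) auto
qed

lemma kk0_lipschitz:
  assumes "cmod \<mu> \<le> r" "cmod \<nu> \<le> r"
  shows "cmod (kk0 \<mu> \<beta> - kk0 \<nu> \<beta>) \<le> cmod (\<mu> - \<nu>) / sqrt c0"
proof -
  have "cmod (kk0 \<mu> \<beta> - kk0 \<nu> \<beta>) \<le> cmod (\<nu>\<^sup>2 - \<mu>\<^sup>2) / (2 * sqrt c0)"
    using norm_csqrt_diff_le[OF c0(1) Re_kk0_arg[OF assms(1)] Re_kk0_arg[OF assms(2)]]
    by (simp add: kk0_def)
  also have "\<dots> \<le> 2 * cmod (\<mu> - \<nu>) / (2 * sqrt c0)"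
    using cmod_square_diff_le[OF assms(2,1)] c0 by (intro divide_right_mono) (auto simp: norm_minus_commute)
  finally show ?thesis by simp
qed

lemma Re_kkm_ge:
  assumes "cmod \<mu> \<le> r" "m \<noteq> 0" "m \<noteq> -1"
  shows "sqrt c0 \<le> Re (kkm m \<mu> \<beta>)"
  using Re_csqrt_ge[OF _ Re_kkm_arg[OF assms]] c0 unfolding kkm_def by (meson less_imp_le)

lemma kkm_lipschitz:
  assumes "cmod \<mu> \<le> r" "cmod \<nu> \<le> r" "m \<noteq> 0" "m \<noteq> -1"
  shows "cmod (kkm m \<mu> \<beta> - kkm m \<nu> \<beta>) \<le> cmod (\<mu> - \<nu>) / sqrt c0"
proof -
  have "cmod (kkm m \<mu> \<beta> - kkm m \<nu> \<beta>) \<le> cmod (\<mu>\<^sup>2 - \<nu>\<^sup>2) / (2 * sqrt c0)"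
    using norm_csqrt_diff_le[OF c0(1) Re_kkm_arg[OF assms(1,3,4)] Re_kkm_arg[OF assms(2,3,4)]]
    by (simp add: kkm_def)
  also have "\<dots> \<le> 2 * cmod (\<mu> - \<nu>) / (2 * sqrt c0)"
    using cmod_square_diff_le[OF assms(1,2)] c0 by (intro divide_right_mono) auto
  finally show ?thesis by simp
qed

section \<open>Continuity of the kernels and uniform bounds over all modes\<close>

lemma continuous_Hker: "continuous_on S (Hker m \<mu> \<beta>)"
proof -
  have *: "continuous_on S (\<lambda>x. a * exp (b * complex_of_real \<bar>x\<bar>))" for a b
    by (intro continuous_intros)
  consider "m = 0" | "m = -1" "\<mu> = 0" | "m = -1" "\<mu> \<noteq> 0" | "m \<noteq> 0" "m \<noteq> -1"
    by blast
  thus ?thesis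
  proof cases
    case 1
    thus ?thesis
      unfolding Hker_def [abs_def]
      using *[of "\<i> / (2 * kk0 \<mu> \<beta>)" "\<i> * kk0 \<mu> \<beta>"] by (simp only: simp_thms if_True)
  next
    case 4
    thus ?thesis
      unfolding Hker_def [abs_def]
      using *[of "1 / (2 * kkm m \<mu> \<beta>)" "- kkm m \<mu> \<beta>"] by (simp only: simp_thms if_False)
  next
    case 3
    thus ?thesis unfolding Hker_def [abs_def] by (auto intro!: continuous_intros)
  qed (auto simp: Hker_def [abs_def] intro!: continuous_intros)
qed

lemma Hker_minus: "Hker m \<mu> \<beta> (- x) = Hker m \<mu> \<beta> x"
  by (simp add: Hker_def)

text \<open>The range |x| \<le> 2 R is that of x - \<xi> for two points of the support. One constant
  serves all modes because the lower bounds and the Lipschitz constants of the wave numbers do not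
  depend on m.\<close>

lemma Hker_lipschitz:
  "\<exists>L>0. \<forall>\<mu> \<nu> m x. cmod \<mu> \<le> r \<longrightarrow> cmod \<nu> \<le> r \<longrightarrow> \<bar>x\<bar> \<le> 2 * R \<longrightarrow>
     cmod (Hker m \<mu> \<beta> x - Hker m \<nu> \<beta> x) \<le> L * cmod (\<mu> - \<nu>)"
proof -
  \<comment> \<open>For complex \<mu> the exponentials may grow; 4 R bounds the real part of every
    exponent, since |k_0| \<le> 2 and |x| \<le> 2 R, while the evanescent exponents have nonpositive
    real part. The final division by sqrt c0 is the Lipschitz constant of the wave numbers. B
    belongs to the mode -1.\<close>
  define A where "A = exp (4 * R) * (2 * R / (2 * sqrt c0) + 1 / (2 * (sqrt c0)\<^sup>2)) / sqrt c0"
  define B where "B = 2 * R * (exp (2 * R) * (2 * R))"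
  have A: "A > 0" and B: "B > 0"
    unfolding A_def B_def using R c0 by (auto intro!: divide_pos_pos mult_pos_pos add_pos_pos)
  have kernel: "cmod (exp p / (2 * k) - exp q / (2 * l)) \<le> A * cmod (\<mu> - \<nu>)"
    if "sqrt c0 \<le> cmod k" "sqrt c0 \<le> cmod l" "Re p \<le> 4 * R" "Re q \<le> 4 * R"
       "cmod (p - q) \<le> 2 * R * cmod (k - l)" "cmod (k - l) \<le> cmod (\<mu> - \<nu>) / sqrt c0" for p q k l \<mu> \<nu>
  proof -
    have "cmod (exp p / (2 * k) - exp q / (2 * l))
        \<le> exp (4 * R) * (2 * R / (2 * sqrt c0) + 1 / (2 * (sqrt c0)\<^sup>2)) * cmod (k - l)"
      using that c0 by (intro exp_kernel_lipschitz) auto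
    also have "\<dots> \<le> exp (4 * R) * (2 * R / (2 * sqrt c0) + 1 / (2 * (sqrt c0)\<^sup>2)) * (cmod (\<mu> - \<nu>) / sqrt c0)"
      using that R c0 by (intro mult_left_mono) auto
    finally show ?thesis by (simp add: A_def)
  qed
  have "cmod (Hker m \<mu> \<beta> x - Hker m \<nu> \<beta> x) \<le> (A + B) * cmod (\<mu> - \<nu>)"
    if \<mu>: "cmod \<mu> \<le> r" and \<nu>: "cmod \<nu> \<le> r" and x: "\<bar>x\<bar> \<le> 2 * R" for \<mu> \<nu> m x
  proof -
    consider (0) "m = 0" | (1) "m = -1" | (2) "m \<noteq> 0" "m \<noteq> -1"
      by blast
    hence "cmod (Hker m \<mu> \<beta> x - Hker m \<nu> \<beta> x) \<le> A * cmod (\<mu> - \<nu>)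
         \<or> cmod (Hker m \<mu> \<beta> x - Hker m \<nu> \<beta> x) \<le> B * cmod (\<mu> - \<nu>)"
    proof cases
      case 0
      let ?p = "\<lambda>\<mu>. \<i> * kk0 \<mu> \<beta> * of_real \<bar>x\<bar>"
      have re: "Re (?p \<mu>) \<le> 4 * R" if "cmod \<mu> \<le> r" for \<mu>
      proof -
        have "Re (?p \<mu>) \<le> cmod (?p \<mu>)"
          by (rule complex_Re_le_cmod)
        also have "\<dots> = cmod (kk0 \<mu> \<beta>) * \<bar>x\<bar>"
          by (simp add: norm_mult)
        also have "\<dots> \<le> 2 * (2 * R)"
          using kk0_bounds[OF that] x by (intro mult_mono) auto
        finally show ?thesis by simp
      qed
      have "?p \<mu> - ?p \<nu> = \<i> * (kk0 \<mu> \<beta> - kk0 \<nu> \<beta>) * of_real \<bar>x\<bar>"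
        by (simp add: algebra_simps)
      hence "cmod (?p \<mu> - ?p \<nu>) = \<bar>x\<bar> * cmod (kk0 \<mu> \<beta> - kk0 \<nu> \<beta>)"
        by (simp add: norm_mult)
      also have "\<dots> \<le> 2 * R * cmod (kk0 \<mu> \<beta> - kk0 \<nu> \<beta>)"
        using x by (intro mult_right_mono) auto
      finally have "cmod (exp (?p \<mu>) / (2 * kk0 \<mu> \<beta>) - exp (?p \<nu>) / (2 * kk0 \<nu> \<beta>)) \<le> A * cmod (\<mu> - \<nu>)"
        using kk0_bounds \<mu> \<nu> re kk0_lipschitz by (intro kernel) auto
      moreover have "Hker m \<mu> \<beta> x - Hker m \<nu> \<beta> x
          = \<i> * (exp (?p \<mu>) / (2 * kk0 \<mu> \<beta>) - exp (?p \<nu>) / (2 * kk0 \<nu> \<beta>))"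
        using 0 by (simp add: Hker_def right_diff_distrib)
      ultimately show ?thesis by (simp add: norm_mult)
    next
      case 1
      let ?\<psi> = "\<lambda>\<mu> t. if \<mu> = 0 then - complex_of_real t else (exp (- \<mu> * of_real t) - 1) / \<mu>"
      have H: "Hker m \<mu> \<beta> x = ?\<psi> \<mu> \<bar>x\<bar> / 2" for \<mu>
        using 1 by (cases "\<mu> = 0") (simp_all add: Hker_def field_simps)
      have "cmod (Hker m \<mu> \<beta> x - Hker m \<nu> \<beta> x) = cmod (?\<psi> \<mu> \<bar>x\<bar> - ?\<psi> \<nu> \<bar>x\<bar>) / 2"
        unfolding H by (simp only: diff_divide_distrib [symmetric] norm_divide norm_numeral)
      also have "\<dots> \<le> cmod (?\<psi> \<mu> \<bar>x\<bar> - ?\<psi> \<nu> \<bar>x\<bar>)"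
        by simp
      also have "\<dots> \<le> 2 * R * (exp (2 * R) * (2 * R * cmod (\<mu> - \<nu>)))"
        using \<mu> \<nu> r x by (intro exp_primitive_lipschitz) auto
      also have "\<dots> = B * cmod (\<mu> - \<nu>)"
        by (simp add: B_def)
      finally show ?thesis ..
    next
      case 2
      let ?p = "\<lambda>\<mu>. - kkm m \<mu> \<beta> * of_real \<bar>x\<bar>"
      have re: "Re (?p \<mu>) \<le> 4 * R" "sqrt c0 \<le> cmod (kkm m \<mu> \<beta>)" if "cmod \<mu> \<le> r" for \<mu>
      proof -
        have c: "0 \<le> sqrt c0" "sqrt c0 \<le> Re (kkm m \<mu> \<beta>)"
          using Re_kkm_ge[OF that 2] c0 by auto
        hence "0 \<le> Re (kkm m \<mu> \<beta>) * \<bar>x\<bar>"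
          by (intro mult_nonneg_nonneg) linarith+
        hence "- (Re (kkm m \<mu> \<beta>) * \<bar>x\<bar>) \<le> 4 * R"
          using R by linarith
        with c show "Re (?p \<mu>) \<le> 4 * R" "sqrt c0 \<le> cmod (kkm m \<mu> \<beta>)"
          using complex_Re_le_cmod[of "kkm m \<mu> \<beta>"] by auto
      qed
      have "?p \<mu> - ?p \<nu> = - (kkm m \<mu> \<beta> - kkm m \<nu> \<beta>) * of_real \<bar>x\<bar>"
        by (simp add: algebra_simps)
      hence "cmod (?p \<mu> - ?p \<nu>) = \<bar>x\<bar> * cmod (kkm m \<mu> \<beta> - kkm m \<nu> \<beta>)"
        by (simp add: norm_mult norm_minus_commute)
      also have "\<dots> \<le> 2 * R * cmod (kkm m \<mu> \<beta> - kkm m \<nu> \<beta>)"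
        using x by (intro mult_right_mono) auto
      finally have "cmod (exp (?p \<mu>) / (2 * kkm m \<mu> \<beta>) - exp (?p \<nu>) / (2 * kkm m \<nu> \<beta>)) \<le> A * cmod (\<mu> - \<nu>)"
        using \<mu> \<nu> re kkm_lipschitz 2 by (intro kernel) auto
      thus ?thesis
        using 2 by (simp add: Hker_def)
    qed
    moreover have "A * cmod (\<mu> - \<nu>) \<ge> 0" "B * cmod (\<mu> - \<nu>) \<ge> 0"
      using A B by auto
    ultimately show ?thesis
      by (auto simp: distrib_right)
  qed
  thus ?thesis
    using A B by (intro exI[of _ "A + B"]) auto
qed

text \<open>It suffices to bound the kernels at \<mu> = 0, where none of them grows exponentially;
  the Lipschitz estimate carries the bound over to |\<mu>| \<le> r.\<close>

lemma Hker_0_bound: "\<exists>K>0. \<forall>m x. \<bar>x\<bar> \<le> 2 * R \<longrightarrow> cmod (Hker m 0 \<beta> x) \<le> K"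
proof -
  have "cmod (Hker m 0 \<beta> x) \<le> R + 1 / sqrt c0" if x: "\<bar>x\<bar> \<le> 2 * R" for m x
  proof -
    have r0: "cmod 0 \<le> r"
      using r by simp
    consider (0) "m = 0" | (1) "m = -1" | (2) "m \<noteq> 0" "m \<noteq> -1"
      by blast
    thus ?thesis
    proof cases
      case 0
      have "kk0 0 \<beta> = of_real (sqrt (1 - 2 * \<beta>))"
        using \<beta> by (subst of_real_sqrt) (auto simp: kk0_def)
      hence 1: "cmod (exp (\<i> * kk0 0 \<beta> * of_real \<bar>x\<bar>)) = 1"
        by (simp add: norm_exp_eq_Re)
      have "cmod (1 / (2 * kk0 0 \<beta>)) \<le> 1 / sqrt c0"
      proof -
        have "sqrt c0 \<le> 2 * cmod (kk0 0 \<beta>)"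
          using kk0_bounds(1)[OF r0] norm_ge_zero[of "kk0 0 \<beta>"] by linarith
        thus ?thesis
          using c0 by (auto simp: norm_divide norm_mult simp del: norm_ge_zero intro!: frac_le)
      qed
      moreover have "cmod (Hker m 0 \<beta> x) = cmod (1 / (2 * kk0 0 \<beta>))"
      proof -
        have "Hker m 0 \<beta> x = \<i> * (1 / (2 * kk0 0 \<beta>)) * exp (\<i> * kk0 0 \<beta> * of_real \<bar>x\<bar>)"
          using 0 by (simp add: Hker_def)
        thus ?thesis
          by (simp only: norm_mult norm_ii 1 mult_1_left mult_1_right)
      qed
      ultimately show ?thesis
        using R by simp
    next
      case 1
      have "cmod (Hker m 0 \<beta> x) = \<bar>x\<bar> / 2"
        using 1 by (simp add: Hker_def norm_divide)
      moreover have "0 \<le> 1 / sqrt c0"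
        using c0 by simp
      ultimately show ?thesis
        using x by linarith
    next
      case 2
      have k: "0 < sqrt c0" "sqrt c0 \<le> Re (kkm m 0 \<beta>)"
        using Re_kkm_ge[OF r0 2] c0 by auto
      hence "0 \<le> Re (kkm m 0 \<beta>) * \<bar>x\<bar>"
        by (intro mult_nonneg_nonneg) linarith+
      hence "Re (- kkm m 0 \<beta> * of_real \<bar>x\<bar>) \<le> 0"
        by simp
      hence 1: "cmod (exp (- kkm m 0 \<beta> * of_real \<bar>x\<bar>)) \<le> 1"
        unfolding norm_exp_eq_Re by simp
      have 2: "cmod (1 / (2 * kkm m 0 \<beta>)) \<le> 1 / sqrt c0"
      proof -
        have "sqrt c0 \<le> 2 * cmod (kkm m 0 \<beta>)"
          using k complex_Re_le_cmod[of "kkm m 0 \<beta>"] norm_ge_zero[of "kkm m 0 \<beta>"] by linarith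
        thus ?thesis
          using c0 by (auto simp: norm_divide norm_mult simp del: norm_ge_zero intro!: frac_le)
      qed
      have "cmod (1 / (2 * kkm m 0 \<beta>)) * cmod (exp (- kkm m 0 \<beta> * of_real \<bar>x\<bar>)) \<le> 1 / sqrt c0 * 1"
        using 1 2 c0 by (intro mult_mono) auto
      thus ?thesis
        using \<open>m \<noteq> 0\<close> \<open>m \<noteq> -1\<close> R by (simp add: Hker_def norm_mult norm_divide)
    qed
  qed
  thus ?thesis
    using R c0 by (intro exI[of _ "R + 1 / sqrt c0"]) (auto intro!: add_pos_pos)
qed


subsection \<open>The operator and its resolvent\<close>

lemma Hker_bounds:
  obtains K where "K > 0" "\<And>\<mu> m x. cmod \<mu> \<le> r \<Longrightarrow> \<bar>x\<bar> \<le> 2 * R \<Longrightarrow> cmod (Hker m \<mu> \<beta> x) \<le> K"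
    "\<And>\<mu> \<nu> m x. cmod \<mu> \<le> r \<Longrightarrow> cmod \<nu> \<le> r \<Longrightarrow> \<bar>x\<bar> \<le> 2 * R \<Longrightarrow>
       cmod (Hker m \<mu> \<beta> x - Hker m \<nu> \<beta> x) \<le> K * cmod (\<mu> - \<nu>)"
proof -
  obtain L where L: "L > 0" "\<forall>\<mu> \<nu> m x. cmod \<mu> \<le> r \<longrightarrow> cmod \<nu> \<le> r \<longrightarrow> \<bar>x\<bar> \<le> 2 * R \<longrightarrow>
     cmod (Hker m \<mu> \<beta> x - Hker m \<nu> \<beta> x) \<le> L * cmod (\<mu> - \<nu>)"
    using Hker_lipschitz by blast
  obtain K where K: "K > 0" "\<forall>m x. \<bar>x\<bar> \<le> 2 * R \<longrightarrow> cmod (Hker m 0 \<beta> x) \<le> K"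
    using Hker_0_bound by blast
  show ?thesis
  proof (rule that[of "K + L"])
    show "cmod (Hker m \<mu> \<beta> x) \<le> K + L" if "cmod \<mu> \<le> r" "\<bar>x\<bar> \<le> 2 * R" for \<mu> m x
    proof -
      have "cmod (Hker m \<mu> \<beta> x - Hker m 0 \<beta> x) \<le> L * cmod (\<mu> - 0)"
        using L(2) that r by (metis norm_zero less_imp_le)
      also have "\<dots> \<le> L * 1"
        using L(1) that r by (intro mult_left_mono) auto
      finally show ?thesis
        using K(2)[rule_format, OF that(2), of m] norm_triangle_sub[of "Hker m \<mu> \<beta> x" "Hker m 0 \<beta> x"]
        by linarith
    qed
    show "cmod (Hker m \<mu> \<beta> x - Hker m \<nu> \<beta> x) \<le> (K + L) * cmod (\<mu> - \<nu>)"
      if "cmod \<mu> \<le> r" "cmod \<nu> \<le> r" "\<bar>x\<bar> \<le> 2 * R" for \<mu> \<nu> m x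
    proof -
      have "cmod (Hker m \<mu> \<beta> x - Hker m \<nu> \<beta> x) \<le> L * cmod (\<mu> - \<nu>)"
        using L(2) that by blast
      also have "\<dots> \<le> (K + L) * cmod (\<mu> - \<nu>)"
        using K(1) by (intro mult_right_mono) auto
      finally show ?thesis .
    qed
  qed (use K L in auto)
qed

section \<open>Convolution with the kernels\<close>

lemma conv_eq:
  assumes "bdd_seq R M A"
  shows "conv H (A n) x = integral {-R..R} (\<lambda>\<xi>. H (x - \<xi>) * A n \<xi>)"
  unfolding conv_def by (rule integral_UNIV_eq_interval) (simp add: bdd_seqD[OF assms])

lemma continuous_conv:
  assumes "bdd_seq R M A"
  shows "continuous_on S (conv (Hker n \<mu> \<beta>) (A n))"
proof -
  have "continuous_on UNIV (\<lambda>x. integral (cbox (-R) R) (\<lambda>\<xi>. Hker n \<mu> \<beta> (x - \<xi>) * A n \<xi>))"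
    by (rule integral_continuous_on_param)
       (auto simp: case_prod_unfold intro!: continuous_intros
          continuous_on_compose2[OF continuous_Hker[of UNIV]]
          continuous_on_compose2[OF bdd_seqD(1)[OF assms, of UNIV]])
  thus ?thesis
    unfolding conv_eq[OF assms] by (auto intro: continuous_on_subset)
qed

lemma conv_bounds:
  obtains K where "K > 0"
    "\<And>\<mu> M A n x. cmod \<mu> \<le> r \<Longrightarrow> bdd_seq R M A \<Longrightarrow> \<bar>x\<bar> \<le> R \<Longrightarrow> cmod (conv (Hker n \<mu> \<beta>) (A n) x) \<le> K * M"
    "\<And>\<mu> \<nu> M A B D n x. cmod \<mu> \<le> r \<Longrightarrow> cmod \<nu> \<le> r \<Longrightarrow> bdd_seq R M A \<Longrightarrow> bdd_seq R M B \<Longrightarrow>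
       (\<And>m x. cmod (A m x - B m x) \<le> D) \<Longrightarrow> \<bar>x\<bar> \<le> R \<Longrightarrow>
       cmod (conv (Hker n \<mu> \<beta>) (A n) x - conv (Hker n \<nu> \<beta>) (B n) x) \<le> K * (D + cmod (\<mu> - \<nu>) * M)"
proof -
  obtain K where K: "K > 0" "\<And>\<mu> m x. cmod \<mu> \<le> r \<Longrightarrow> \<bar>x\<bar> \<le> 2 * R \<Longrightarrow> cmod (Hker m \<mu> \<beta> x) \<le> K"
    "\<And>\<mu> \<nu> m x. cmod \<mu> \<le> r \<Longrightarrow> cmod \<nu> \<le> r \<Longrightarrow> \<bar>x\<bar> \<le> 2 * R \<Longrightarrow>
       cmod (Hker m \<mu> \<beta> x - Hker m \<nu> \<beta> x) \<le> K * cmod (\<mu> - \<nu>)"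
    using Hker_bounds by blast
  have cont: "continuous_on {-R..R} (\<lambda>\<xi>. Hker n \<mu> \<beta> (x - \<xi>) * A n \<xi>)" if "bdd_seq R M A" for n \<mu> x A M
    by (auto intro!: continuous_intros continuous_on_compose2[OF continuous_Hker[of UNIV]]
          bdd_seqD(1)[OF that])
  show ?thesis
  proof (rule that[of "2 * R * K"])
    show "2 * R * K > 0" using K R by simp
    show "cmod (conv (Hker n \<mu> \<beta>) (A n) x) \<le> 2 * R * K * M"
      if \<mu>: "cmod \<mu> \<le> r" and A: "bdd_seq R M A" and x: "\<bar>x\<bar> \<le> R" for \<mu> M A n x
    proof -
      have "cmod (integral {-R..R} (\<lambda>\<xi>. Hker n \<mu> \<beta> (x - \<xi>) * A n \<xi>)) \<le> 2 * R * (K * M)"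
      proof (rule norm_integral_le)
        show "cmod (Hker n \<mu> \<beta> (x - \<xi>) * A n \<xi>) \<le> K * M" if "\<bar>\<xi>\<bar> \<le> R" for \<xi>
          unfolding norm_mult using K x that \<mu> bdd_seqD[OF A] by (intro mult_mono) auto
      qed (use R cont[OF A] in auto)
      thus ?thesis using conv_eq[OF A] by (simp add: mult.assoc)
    qed
    show "cmod (conv (Hker n \<mu> \<beta>) (A n) x - conv (Hker n \<nu> \<beta>) (B n) x) \<le> 2 * R * K * (D + cmod (\<mu> - \<nu>) * M)"
      if \<mu>: "cmod \<mu> \<le> r" and \<nu>: "cmod \<nu> \<le> r" and A: "bdd_seq R M A" and B: "bdd_seq R M B"
        and D: "\<And>m x. cmod (A m x - B m x) \<le> D" and x: "\<bar>x\<bar> \<le> R" for \<mu> \<nu> M A B D n x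
    proof -
      have "cmod (integral {-R..R} (\<lambda>\<xi>. Hker n \<mu> \<beta> (x - \<xi>) * A n \<xi>)
          - integral {-R..R} (\<lambda>\<xi>. Hker n \<nu> \<beta> (x - \<xi>) * B n \<xi>)) \<le> 2 * R * (K * (D + cmod (\<mu> - \<nu>) * M))"
      proof (rule norm_integral_diff_le)
        show "cmod (Hker n \<mu> \<beta> (x - \<xi>) * A n \<xi> - Hker n \<nu> \<beta> (x - \<xi>) * B n \<xi>)
                \<le> K * (D + cmod (\<mu> - \<nu>) * M)" if "\<bar>\<xi>\<bar> \<le> R" for \<xi>
        proof -
          have x\<xi>: "\<bar>x - \<xi>\<bar> \<le> 2 * R" using x that by simp
          have "Hker n \<mu> \<beta> (x - \<xi>) * A n \<xi> - Hker n \<nu> \<beta> (x - \<xi>) * B n \<xi>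
              = Hker n \<mu> \<beta> (x - \<xi>) * (A n \<xi> - B n \<xi>) + (Hker n \<mu> \<beta> (x - \<xi>) - Hker n \<nu> \<beta> (x - \<xi>)) * B n \<xi>"
            by (simp add: algebra_simps)
          also have "cmod \<dots> \<le> K * D + K * cmod (\<mu> - \<nu>) * M"
            by (rule norm_triangle_mono; unfold norm_mult; intro mult_mono)
               (use K \<mu> \<nu> x\<xi> D bdd_seqD[OF B] in auto)
          finally show ?thesis by (simp add: algebra_simps)
        qed
      qed (use R cont[OF A] cont[OF B] in auto)
      thus ?thesis using conv_eq[OF A] conv_eq[OF B] by (simp add: mult.assoc)
    qed
  qed
qed

section \<open>The prefactor gamma and sums over rows of Fourier coefficients\<close>

lemma gam_bounds:
  assumes "cmod \<mu> \<le> r" "cmod \<nu> \<le> r"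
  shows "cmod (gam \<mu> \<beta>) \<le> 1" "cmod (gam \<mu> \<beta> - gam \<nu> \<beta>) \<le> cmod (\<mu> - \<nu>)"
proof -
  have pi: "4 * pi \<ge> 2"
    using pi_ge_two by linarith
  have "cmod (of_real ((1 - \<beta>)^2) - \<mu>\<^sup>2) \<le> cmod (of_real ((1 - \<beta>)^2)) + cmod (\<mu>\<^sup>2)"
    by (rule norm_triangle_ineq4)
  also have "\<dots> \<le> 1 + 1"
    using \<beta> cmod_square_le[OF assms(1)] r
    by (intro add_mono) (simp_all only: norm_of_real, simp_all add: abs_square_le_1)
  finally show "cmod (gam \<mu> \<beta>) \<le> 1"
    using pi by (simp add: gam_def norm_divide)
  have "gam \<mu> \<beta> - gam \<nu> \<beta> = (\<nu>\<^sup>2 - \<mu>\<^sup>2) / of_real (4 * pi)"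
    by (simp add: gam_def diff_divide_distrib)
  hence "cmod (gam \<mu> \<beta> - gam \<nu> \<beta>) = cmod (\<nu>\<^sup>2 - \<mu>\<^sup>2) / (4 * pi)"
    by (simp add: norm_divide)
  also have "\<dots> \<le> (2 * cmod (\<nu> - \<mu>)) / 2"
    using pi cmod_square_diff_le[OF assms(2,1)] by (intro frac_le) auto
  finally show "cmod (gam \<mu> \<beta> - gam \<nu> \<beta>) \<le> cmod (\<mu> - \<nu>)"
    by (simp add: norm_minus_commute)
qed

text \<open>A summable majorant independent of x. The substitution n -> m - n permutes the integers,
  so every row of the matrix f_{m-n} has the same majorizing sum; hence all later bounds are uniform
  in m.\<close>

lemma fcoef_dominated:
  obtains w :: "int \<Rightarrow> real" where "w summable_on UNIV" "\<And>j. w j > 0" "\<And>j x. cmod (fcoef f j x) \<le> w j"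
    "\<And>m. (\<lambda>n. w (m - n)) summable_on UNIV" "\<And>m. infsum (\<lambda>n. w (m - n)) UNIV = infsum w UNIV"
proof -
  obtain C where C: "C > 0" "\<forall>j x. cmod (fcoef f j x) \<le> C / (1 + (real_of_int j)\<^sup>2)"
    using fcoef_decay by blast
  define w :: "int \<Rightarrow> real" where "w j = C * (1 / (1 + (real_of_int j)\<^sup>2))" for j
  have w: "w summable_on UNIV"
    unfolding w_def [abs_def] by (intro summable_on_cmult_right summable_inverse_square_int)
  have bij: "bij_betw (\<lambda>n. m - n) UNIV (UNIV :: int set)" for m
    by (rule bij_betwI[of _ _ _ "\<lambda>n. m - n"]) auto
  show ?thesis
  proof (rule that[of w])
    show "(\<lambda>n. w (m - n)) summable_on UNIV" for m
      using w summable_on_reindex_bij_betw[OF bij] by blast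
    show "infsum (\<lambda>n. w (m - n)) UNIV = infsum w UNIV" for m
      using infsum_reindex_bij_betw[OF bij] .
    show "w j > 0" for j
      using C by (simp add: w_def add_pos_nonneg)
  qed (use w C in \<open>auto simp: w_def\<close>)
qed

text \<open>The coefficients a n need a bound only for |x| \<le> R because the Fourier coefficients
  vanish outside. This matters: a n will be a convolution value, which is controlled only on the
  support.\<close>

lemma norm_infsum_fcoef_le:
  obtains S where "S > 0"
    "\<And>a B m x. (\<And>n. \<bar>x\<bar> \<le> R \<Longrightarrow> cmod (a n) \<le> B) \<Longrightarrow> 0 \<le> B \<Longrightarrow>
       (\<lambda>n. a n * fcoef f (m - n) x) summable_on UNIV"
    "\<And>a B m x. (\<And>n. \<bar>x\<bar> \<le> R \<Longrightarrow> cmod (a n) \<le> B) \<Longrightarrow> 0 \<le> B \<Longrightarrow>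
       cmod (\<Sum>\<^sub>\<infinity>n. a n * fcoef f (m - n) x) \<le> B * S"
proof -
  obtain w :: "int \<Rightarrow> real" where w: "w summable_on UNIV" "\<And>j. w j > 0" "\<And>j x. cmod (fcoef f j x) \<le> w j"
    "\<And>m. (\<lambda>n. w (m - n)) summable_on UNIV" "\<And>m. infsum (\<lambda>n. w (m - n)) UNIV = infsum w UNIV"
    using fcoef_dominated by blast
  have le: "cmod (a n * fcoef f (m - n) x) \<le> B * w (m - n)"
    if "\<And>n. \<bar>x\<bar> \<le> R \<Longrightarrow> cmod (a n) \<le> B" "0 \<le> B" for a B m n x
  proof (cases "\<bar>x\<bar> \<le> R")
    case True
    thus ?thesis unfolding norm_mult using that w by (intro mult_mono) auto
  next
    case False
    thus ?thesis using that(2) w(2)[of "m - n"] by (simp add: fcoef_supp)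
  qed
  have s: "(\<lambda>n. a n * fcoef f (m - n) x) summable_on UNIV
      \<and> cmod (\<Sum>\<^sub>\<infinity>n. a n * fcoef f (m - n) x) \<le> B * infsum w UNIV"
    if a: "\<And>n. \<bar>x\<bar> \<le> R \<Longrightarrow> cmod (a n) \<le> B" and B: "0 \<le> B" for a B m x
  proof -
    have 1: "(\<lambda>n. B * w (m - n)) summable_on UNIV"
      by (intro summable_on_cmult_right w)
    have "(\<lambda>n. cmod (a n * fcoef f (m - n) x)) summable_on UNIV"
      using le[OF a B] by (intro summable_on_comparison_test[OF 1]) auto
    hence 2: "(\<lambda>n. a n * fcoef f (m - n) x) summable_on UNIV"
      by (rule abs_summable_summable)
    moreover have "cmod (\<Sum>\<^sub>\<infinity>n. a n * fcoef f (m - n) x) \<le> (\<Sum>\<^sub>\<infinity>n. B * w (m - n))"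
      using le[OF a B] by (intro norm_infsum_le[OF has_sum_infsum[OF 2] has_sum_infsum[OF 1]]) auto
    moreover have "(\<Sum>\<^sub>\<infinity>n. B * w (m - n)) = B * infsum w UNIV"
      using w(4)[of m] by (simp add: infsum_cmult_right w)
    ultimately show ?thesis by simp
  qed
  have nn: "infsum w UNIV \<ge> 0"
    using w(2) by (intro infsum_nonneg) (auto intro: less_imp_le)
  show ?thesis
  proof (rule that[of "infsum w UNIV + 1"])
    show "(\<lambda>n. a n * fcoef f (m - n) x) summable_on UNIV"
      if "\<And>n. \<bar>x\<bar> \<le> R \<Longrightarrow> cmod (a n) \<le> B" "0 \<le> B" for a B m x
      using s[of x a B] that by blast
    show "cmod (\<Sum>\<^sub>\<infinity>n. a n * fcoef f (m - n) x) \<le> B * (infsum w UNIV + 1)"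
      if "\<And>n. \<bar>x\<bar> \<le> R \<Longrightarrow> cmod (a n) \<le> B" "0 \<le> B" for a B m x
    proof -
      have "cmod (\<Sum>\<^sub>\<infinity>n. a n * fcoef f (m - n) x) \<le> B * infsum w UNIV"
        using s[of x a B] that by blast
      thus ?thesis using that(2) by (simp add: algebra_simps)
    qed
  qed (use nn in auto)
qed

text \<open>Needed twice: for continuity of the rows of \<open>Top\<close>, and for integrating the
  series termwise in the first-order coefficient.\<close>

lemma uniform_limit_Top:
  assumes \<mu>: "cmod \<mu> \<le> r" and A: "bdd_seq R M A"
  shows "uniform_limit S (\<lambda>X x. \<Sum>n\<in>X. conv (Hker n \<mu> \<beta>) (A n) x * fcoef f (m - n) x)
           (\<lambda>x. \<Sum>\<^sub>\<infinity>n. conv (Hker n \<mu> \<beta>) (A n) x * fcoef f (m - n) x) (finite_subsets_at_top UNIV)"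
proof -
  obtain K where K: "K > 0"
    "\<And>\<mu> M A n x. cmod \<mu> \<le> r \<Longrightarrow> bdd_seq R M A \<Longrightarrow> \<bar>x\<bar> \<le> R \<Longrightarrow> cmod (conv (Hker n \<mu> \<beta>) (A n) x) \<le> K * M"
    using conv_bounds by metis
  obtain w :: "int \<Rightarrow> real" where w: "\<And>j. w j > 0" "\<And>j x. cmod (fcoef f j x) \<le> w j"
    "\<And>m. (\<lambda>n. w (m - n)) summable_on UNIV"
    using fcoef_dominated by metis
  show ?thesis
  proof (rule Weierstrass_m_test_general)
    show "(\<lambda>n. K * M * w (m - n)) summable_on UNIV"
      by (intro summable_on_cmult_right w)
    show "cmod (conv (Hker n \<mu> \<beta>) (A n) x * fcoef f (m - n) x) \<le> K * M * w (m - n)" for n x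
    proof (cases "\<bar>x\<bar> \<le> R")
      case True
      thus ?thesis unfolding norm_mult using w K bdd_seqD(4)[OF A] \<mu> A by (intro mult_mono) auto
    next
      case False
      thus ?thesis using K(1) bdd_seqD(4)[OF A] w(1)[of "m - n"] by (simp add: fcoef_supp)
    qed
  qed
qed

text \<open>The sequence and \<mu> vary together in the difference estimate, so that it can be
  iterated and also covers a source such as \<open>g1\<close> that depends on \<mu>.\<close>

lemma Top_bounds:
  obtains K where "K \<ge> 1"
    "\<And>\<mu> M A. cmod \<mu> \<le> r \<Longrightarrow> bdd_seq R M A \<Longrightarrow> bdd_seq R (K * M) (Top f \<mu> \<beta> A)"
    "\<And>\<mu> \<nu> M A B D m x. cmod \<mu> \<le> r \<Longrightarrow> cmod \<nu> \<le> r \<Longrightarrow> bdd_seq R M A \<Longrightarrow> bdd_seq R M B \<Longrightarrow>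
       (\<And>m x. cmod (A m x - B m x) \<le> D) \<Longrightarrow>
       cmod (Top f \<mu> \<beta> A m x - Top f \<nu> \<beta> B m x) \<le> K * (D + cmod (\<mu> - \<nu>) * M)"
proof -
  obtain K where K: "K > 0"
    "\<And>\<mu> M A n x. cmod \<mu> \<le> r \<Longrightarrow> bdd_seq R M A \<Longrightarrow> \<bar>x\<bar> \<le> R \<Longrightarrow> cmod (conv (Hker n \<mu> \<beta>) (A n) x) \<le> K * M"
    "\<And>\<mu> \<nu> M A B D n x. cmod \<mu> \<le> r \<Longrightarrow> cmod \<nu> \<le> r \<Longrightarrow> bdd_seq R M A \<Longrightarrow> bdd_seq R M B \<Longrightarrow>
       (\<And>m x. cmod (A m x - B m x) \<le> D) \<Longrightarrow> \<bar>x\<bar> \<le> R \<Longrightarrow>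
       cmod (conv (Hker n \<mu> \<beta>) (A n) x - conv (Hker n \<nu> \<beta>) (B n) x) \<le> K * (D + cmod (\<mu> - \<nu>) * M)"
    using conv_bounds by blast
  obtain S where S: "S > 0"
    "\<And>a B m x. (\<And>n. \<bar>x\<bar> \<le> R \<Longrightarrow> cmod (a n) \<le> B) \<Longrightarrow> 0 \<le> B \<Longrightarrow>
       (\<lambda>n. a n * fcoef f (m - n) x) summable_on UNIV"
    "\<And>a B m x. (\<And>n. \<bar>x\<bar> \<le> R \<Longrightarrow> cmod (a n) \<le> B) \<Longrightarrow> 0 \<le> B \<Longrightarrow>
       cmod (\<Sum>\<^sub>\<infinity>n. a n * fcoef f (m - n) x) \<le> B * S"
    using norm_infsum_fcoef_le by blast
  define Sig where "Sig \<mu> A m x = (\<Sum>\<^sub>\<infinity>n. conv (Hker n \<mu> \<beta>) (A n) x * fcoef f (m - n) x)" for \<mu> A m x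
  have Top: "Top f \<mu> \<beta> A m x = 2 * gam \<mu> \<beta> * Sig \<mu> A m x" for \<mu> A m x
    by (simp add: Top_def Sig_def)
  have Sig: "cmod (Sig \<mu> A m x) \<le> K * M * S" if "cmod \<mu> \<le> r" "bdd_seq R M A" for \<mu> A M m x
    unfolding Sig_def using K that bdd_seqD(4)[OF that(2)] by (intro S) auto
  show ?thesis
  \<comment> \<open>One factor 2 is the prefactor in \<open>Top\<close>; the other arises because
    both gamma and the sum depend on \<mu>. The summand 1 ensures that the constant is at least
    1.\<close>
  proof (rule that[of "1 + 4 * K * S"])
    show "1 + 4 * K * S \<ge> 1" using K(1) S(1) by simp
    show "bdd_seq R ((1 + 4 * K * S) * M) (Top f \<mu> \<beta> A)" if \<mu>: "cmod \<mu> \<le> r" and A: "bdd_seq R M A" for \<mu> M A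
    proof (rule bdd_seqI)
      show "continuous_on UNIV (Top f \<mu> \<beta> A m)" for m
      proof -
        have "continuous_on UNIV (Sig \<mu> A m)"
          unfolding Sig_def [abs_def]
          by (rule uniform_limit_theorem[OF _ uniform_limit_Top[OF \<mu> A]])
             (auto intro!: always_eventually continuous_intros continuous_conv[OF A] continuous_fcoef)
        thus ?thesis unfolding Top [abs_def] by (intro continuous_intros)
      qed
      show "cmod (Top f \<mu> \<beta> A m x) \<le> (1 + 4 * K * S) * M" for m x
      proof -
        have "cmod (Top f \<mu> \<beta> A m x) = 2 * (cmod (gam \<mu> \<beta>) * cmod (Sig \<mu> A m x))"
          by (simp add: Top norm_mult)
        also have "\<dots> \<le> 2 * (1 * (K * M * S))"
          using Sig[OF \<mu> A] gam_bounds(1)[OF \<mu> \<mu>] by (intro mult_left_mono mult_mono) auto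
        also have "\<dots> \<le> (1 + 4 * K * S) * M"
          using K(1) S(1) bdd_seqD(4)[OF A] by (simp add: algebra_simps)
        finally show ?thesis .
      qed
      show "Top f \<mu> \<beta> A m x = 0" if "\<bar>x\<bar> > R" for m x
        using that by (simp add: Top_def fcoef_supp)
    qed
    show "cmod (Top f \<mu> \<beta> A m x - Top f \<nu> \<beta> B m x) \<le> (1 + 4 * K * S) * (D + cmod (\<mu> - \<nu>) * M)"
      if \<mu>: "cmod \<mu> \<le> r" and \<nu>: "cmod \<nu> \<le> r" and A: "bdd_seq R M A" and B: "bdd_seq R M B"
        and D: "\<And>m x. cmod (A m x - B m x) \<le> D" for \<mu> \<nu> M A B D m x
    proof -
      have D0: "0 \<le> D" using D[of 0 0] norm_ge_zero order_trans by blast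
      have M0: "0 \<le> M" by (rule bdd_seqD(4)[OF A])
      let ?a = "\<lambda>n. conv (Hker n \<mu> \<beta>) (A n) x" and ?b = "\<lambda>n. conv (Hker n \<nu> \<beta>) (B n) x"
      have sa: "(\<lambda>n. ?a n * fcoef f (m - n) x) summable_on UNIV"
        using K \<mu> A M0 by (intro S(2)[where B = "K * M"]) auto
      have sb: "(\<lambda>n. ?b n * fcoef f (m - n) x) summable_on UNIV"
        using K \<nu> B M0 by (intro S(2)[where B = "K * M"]) auto
      have "Sig \<mu> A m x - Sig \<nu> B m x = (\<Sum>\<^sub>\<infinity>n. (?a n - ?b n) * fcoef f (m - n) x)"
        using infsum_add[OF sa summable_on_uminus[THEN iffD2, OF sb]]
        by (simp add: Sig_def infsum_uminus algebra_simps)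
      also have "cmod \<dots> \<le> K * (D + cmod (\<mu> - \<nu>) * M) * S"
        using K(1) D0 M0 by (intro S(3) K(3) \<mu> \<nu> A B D) auto
      finally have 1: "cmod (Sig \<mu> A m x - Sig \<nu> B m x) \<le> K * (D + cmod (\<mu> - \<nu>) * M) * S" .
      have "Top f \<mu> \<beta> A m x - Top f \<nu> \<beta> B m x
          = 2 * (gam \<mu> \<beta> * (Sig \<mu> A m x - Sig \<nu> B m x) + (gam \<mu> \<beta> - gam \<nu> \<beta>) * Sig \<nu> B m x)"
        by (simp add: Top algebra_simps)
      hence "cmod (Top f \<mu> \<beta> A m x - Top f \<nu> \<beta> B m x)
          = 2 * cmod (gam \<mu> \<beta> * (Sig \<mu> A m x - Sig \<nu> B m x) + (gam \<mu> \<beta> - gam \<nu> \<beta>) * Sig \<nu> B m x)"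
        by (simp only: norm_mult norm_numeral)
      also have "\<dots> \<le> 2 * (1 * (K * (D + cmod (\<mu> - \<nu>) * M) * S) + cmod (\<mu> - \<nu>) * (K * M * S))"
        by (intro mult_left_mono; (rule norm_triangle_mono; unfold norm_mult; intro mult_mono)?)
           (use 1 Sig[OF \<nu> B] gam_bounds[OF \<mu> \<nu>] in auto)
      also have "\<dots> \<le> 2 * (1 * (K * (D + cmod (\<mu> - \<nu>) * M) * S) + (D + cmod (\<mu> - \<nu>) * M) * (K * S))"
      proof -
        have "cmod (\<mu> - \<nu>) * M * (K * S) \<le> (D + cmod (\<mu> - \<nu>) * M) * (K * S)"
          using D0 K(1) S(1) by (intro mult_right_mono) auto
        thus ?thesis by (simp add: algebra_simps)
      qed
      also have "\<dots> = 4 * K * S * (D + cmod (\<mu> - \<nu>) * M)"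
        by (simp add: algebra_simps)
      also have "\<dots> \<le> (1 + 4 * K * S) * (D + cmod (\<mu> - \<nu>) * M)"
        using D0 M0 by (intro mult_right_mono) auto
      finally show ?thesis .
    qed
  qed
qed


text \<open>Telescoping over the k applications: each contributes one change of \<mu>, whence the
  factor \<open>real k\<close>, and the others cost a factor K each.\<close>

lemma Top_funpow_bounds:
  obtains K where "K \<ge> 1"
    "\<And>\<mu> M A k. cmod \<mu> \<le> r \<Longrightarrow> bdd_seq R M A \<Longrightarrow> bdd_seq R (K ^ k * M) ((Top f \<mu> \<beta> ^^ k) A)"
    "\<And>\<mu> \<nu> M A B D k m x. cmod \<mu> \<le> r \<Longrightarrow> cmod \<nu> \<le> r \<Longrightarrow> bdd_seq R M A \<Longrightarrow> bdd_seq R M B \<Longrightarrow>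
       (\<And>m x. cmod (A m x - B m x) \<le> D) \<Longrightarrow>
       cmod ((Top f \<mu> \<beta> ^^ k) A m x - (Top f \<nu> \<beta> ^^ k) B m x) \<le> K ^ k * (D + real k * cmod (\<mu> - \<nu>) * M)"
proof -
  obtain K where K: "K \<ge> 1"
    "\<And>\<mu> M A. cmod \<mu> \<le> r \<Longrightarrow> bdd_seq R M A \<Longrightarrow> bdd_seq R (K * M) (Top f \<mu> \<beta> A)"
    "\<And>\<mu> \<nu> M A B D m x. cmod \<mu> \<le> r \<Longrightarrow> cmod \<nu> \<le> r \<Longrightarrow> bdd_seq R M A \<Longrightarrow> bdd_seq R M B \<Longrightarrow>
       (\<And>m x. cmod (A m x - B m x) \<le> D) \<Longrightarrow>
       cmod (Top f \<mu> \<beta> A m x - Top f \<nu> \<beta> B m x) \<le> K * (D + cmod (\<mu> - \<nu>) * M)"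
    using Top_bounds by blast
  have bdd: "bdd_seq R (K ^ k * M) ((Top f \<mu> \<beta> ^^ k) A)" if "cmod \<mu> \<le> r" "bdd_seq R M A" for \<mu> M A k
  proof (induction k)
    case (Suc k)
    thus ?case using K(2)[OF that(1) Suc] by (simp add: mult.assoc)
  qed (use that in auto)
  show ?thesis
  proof (rule that[OF K(1) bdd])
    fix \<mu> \<nu> M A B D k m x
    assume \<mu>: "cmod \<mu> \<le> r" and \<nu>: "cmod \<nu> \<le> r" and A: "bdd_seq R M A" and B: "bdd_seq R M B"
      and D: "\<And>m x. cmod (A m x - B m x) \<le> D"
    show "cmod ((Top f \<mu> \<beta> ^^ k) A m x - (Top f \<nu> \<beta> ^^ k) B m x) \<le> K ^ k * (D + real k * cmod (\<mu> - \<nu>) * M)"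
    proof (induction k arbitrary: m x)
      case 0
      show ?case using D by simp
    next
      case (Suc k)
      have "cmod ((Top f \<mu> \<beta> ^^ Suc k) A m x - (Top f \<nu> \<beta> ^^ Suc k) B m x)
          \<le> K * (K ^ k * (D + real k * cmod (\<mu> - \<nu>) * M) + cmod (\<mu> - \<nu>) * (K ^ k * M))"
        unfolding funpow.simps o_apply by (rule K(3)[OF \<mu> \<nu> bdd[OF \<mu> A] bdd[OF \<nu> B] Suc])
      also have "\<dots> = K ^ Suc k * (D + real (Suc k) * cmod (\<mu> - \<nu>) * M)"
        by (simp add: algebra_simps)
      finally show ?case .
    qed
  qed
qed

text \<open>The tail estimate is used with N = 0, 1 and 2: as a bound on the resolvent, as its
  zeroth-order and as its first-order approximation. In the last estimate the factor k from the
  powers is absorbed by k \<le> 2^k, which doubles the ratio of the geometric series; the threshold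
  1 / 4 leaves a ratio of at most 1 / 2 and hence the constant 2.\<close>

lemma Res_bounds:
  obtains K where "K \<ge> 1"
    "\<And>\<epsilon> \<mu> M A m S. 0 \<le> \<epsilon> \<Longrightarrow> \<epsilon> * K \<le> 1 / 4 \<Longrightarrow> cmod \<mu> \<le> r \<Longrightarrow> bdd_seq R M A \<Longrightarrow>
       continuous_on S (Res f \<epsilon> \<mu> \<beta> A m)"
    "\<And>\<epsilon> \<mu> M A m x. cmod \<mu> \<le> r \<Longrightarrow> bdd_seq R M A \<Longrightarrow> \<bar>x\<bar> > R \<Longrightarrow> Res f \<epsilon> \<mu> \<beta> A m x = 0"
    "\<And>\<epsilon> \<mu> M A m x N. 0 \<le> \<epsilon> \<Longrightarrow> \<epsilon> * K \<le> 1 / 4 \<Longrightarrow> cmod \<mu> \<le> r \<Longrightarrow> bdd_seq R M A \<Longrightarrow>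
       cmod (Res f \<epsilon> \<mu> \<beta> A m x - (\<Sum>k<N. of_real \<epsilon> ^ k * (Top f \<mu> \<beta> ^^ k) A m x)) \<le> 2 * (\<epsilon> * K) ^ N * M"
    "\<And>\<epsilon> \<mu> \<nu> M A B D m x. 0 \<le> \<epsilon> \<Longrightarrow> \<epsilon> * K \<le> 1 / 4 \<Longrightarrow> cmod \<mu> \<le> r \<Longrightarrow> cmod \<nu> \<le> r \<Longrightarrow>
       bdd_seq R M A \<Longrightarrow> bdd_seq R M B \<Longrightarrow> (\<And>m x. cmod (A m x - B m x) \<le> D) \<Longrightarrow>
       cmod (Res f \<epsilon> \<mu> \<beta> A m x - Res f \<epsilon> \<nu> \<beta> B m x) \<le> 2 * (D + cmod (\<mu> - \<nu>) * M)"
proof -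
  obtain K where K: "K \<ge> 1"
    "\<And>\<mu> M A k. cmod \<mu> \<le> r \<Longrightarrow> bdd_seq R M A \<Longrightarrow> bdd_seq R (K ^ k * M) ((Top f \<mu> \<beta> ^^ k) A)"
    "\<And>\<mu> \<nu> M A B D k m x. cmod \<mu> \<le> r \<Longrightarrow> cmod \<nu> \<le> r \<Longrightarrow> bdd_seq R M A \<Longrightarrow> bdd_seq R M B \<Longrightarrow>
       (\<And>m x. cmod (A m x - B m x) \<le> D) \<Longrightarrow>
       cmod ((Top f \<mu> \<beta> ^^ k) A m x - (Top f \<nu> \<beta> ^^ k) B m x) \<le> K ^ k * (D + real k * cmod (\<mu> - \<nu>) * M)"
    using Top_funpow_bounds by blast
  define t where "t \<epsilon> \<mu> A m x k = complex_of_real \<epsilon> ^ k * (Top f \<mu> \<beta> ^^ k) A m x" for \<epsilon> \<mu> A m x k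
  have Res: "Res f \<epsilon> \<mu> \<beta> A m x = suminf (t \<epsilon> \<mu> A m x)" for \<epsilon> \<mu> A m x
    by (simp add: Res_def t_def [abs_def])
  have t: "cmod (t \<epsilon> \<mu> A m x k) \<le> (\<epsilon> * K) ^ k * M"
    if "0 \<le> \<epsilon>" "cmod \<mu> \<le> r" "bdd_seq R M A" for \<epsilon> \<mu> M A m x k
  proof -
    have "cmod (t \<epsilon> \<mu> A m x k) = \<epsilon> ^ k * cmod ((Top f \<mu> \<beta> ^^ k) A m x)"
      using that by (simp add: t_def norm_mult norm_power)
    also have "\<dots> \<le> \<epsilon> ^ k * (K ^ k * M)"
      using bdd_seqD(2)[OF K(2)[OF that(2,3)]] that by (intro mult_left_mono) auto
    finally show ?thesis by (simp add: power_mult_distrib mult.assoc)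
  qed
  have geo: "summable (\<lambda>k. (\<epsilon> * K) ^ k * M)" if "0 \<le> \<epsilon>" "\<epsilon> * K \<le> 1 / 4" for \<epsilon> M
    using that K(1) by (intro summable_mult2 summable_geometric) (simp add: abs_mult)
  have summ: "summable (t \<epsilon> \<mu> A m x)"
    if "0 \<le> \<epsilon>" "\<epsilon> * K \<le> 1 / 4" "cmod \<mu> \<le> r" "bdd_seq R M A" for \<epsilon> \<mu> M A m x
    using t[OF that(1,3,4)] by (intro summable_comparison_test'[OF geo[OF that(1,2), of M], of 0]) auto
  show ?thesis
  proof (rule that[OF K(1)])
    fix \<epsilon> \<mu> M A m and S :: "real set"
    assume *: "0 \<le> \<epsilon>" "\<epsilon> * K \<le> 1 / 4" "cmod \<mu> \<le> r" "bdd_seq R M A"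
    have "uniform_limit S (\<lambda>n x. \<Sum>k<n. t \<epsilon> \<mu> A m x k) (\<lambda>x. suminf (t \<epsilon> \<mu> A m x)) sequentially"
      by (rule Weierstrass_m_test[OF _ geo[OF *(1,2), of M]]) (rule t[OF *(1,3,4)])
    hence "continuous_on S (\<lambda>x. suminf (t \<epsilon> \<mu> A m x))"
      by (rule uniform_limit_theorem[rotated])
         (auto simp: t_def intro!: always_eventually continuous_intros bdd_seqD(1)[OF K(2)[OF *(3,4)]])
    thus "continuous_on S (Res f \<epsilon> \<mu> \<beta> A m)"
      by (simp add: Res [abs_def])
  next
    fix \<epsilon> \<mu> M A m x
    assume "cmod \<mu> \<le> r" "bdd_seq R M A" "\<bar>x\<bar> > R"
    thus "Res f \<epsilon> \<mu> \<beta> A m x = 0"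
      using bdd_seqD(3)[OF K(2)] by (simp add: Res_def)
  next
    fix \<epsilon> \<mu> M A m x N
    assume *: "0 \<le> \<epsilon>" "\<epsilon> * K \<le> 1 / 4" "cmod \<mu> \<le> r" "bdd_seq R M A"
    have q: "0 \<le> \<epsilon> * K" using * K(1) by simp
    have g: "summable (\<lambda>k. (\<epsilon> * K) ^ k * ((\<epsilon> * K) ^ N * M))"
      by (rule geo[OF *(1,2)])
    have "Res f \<epsilon> \<mu> \<beta> A m x - (\<Sum>k<N. t \<epsilon> \<mu> A m x k) = (\<Sum>k. t \<epsilon> \<mu> A m x (k + N))"
      unfolding Res using suminf_minus_initial_segment[OF summ[OF *]] by simp
    also have "cmod \<dots> \<le> (\<Sum>k. (\<epsilon> * K) ^ k * ((\<epsilon> * K) ^ N * M))"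
    proof (rule norm_suminf_le[OF _ g])
      show "cmod (t \<epsilon> \<mu> A m x (k + N)) \<le> (\<epsilon> * K) ^ k * ((\<epsilon> * K) ^ N * M)" for k
        using t[OF *(1,3,4), of m x "k + N"] by (simp add: power_add mult.assoc)
    qed
    also have "\<dots> = (\<Sum>k. (\<epsilon> * K) ^ k) * ((\<epsilon> * K) ^ N * M)"
      using geo[OF *(1,2), of 1] by (intro suminf_mult2 [symmetric]) simp
    also have "(\<Sum>k. (\<epsilon> * K) ^ k) = 1 / (1 - \<epsilon> * K)"
      using * q by (intro suminf_geometric) auto
    also have "\<dots> * ((\<epsilon> * K) ^ N * M) \<le> 2 * ((\<epsilon> * K) ^ N * M)"
    proof (rule mult_right_mono)
      show "1 / (1 - \<epsilon> * K) \<le> 2"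
        using * q by (simp add: divide_le_eq)
      show "0 \<le> (\<epsilon> * K) ^ N * M"
        using zero_le_power[OF q] bdd_seqD(4)[OF *(4)] by simp
    qed
    finally show "cmod (Res f \<epsilon> \<mu> \<beta> A m x - (\<Sum>k<N. of_real \<epsilon> ^ k * (Top f \<mu> \<beta> ^^ k) A m x))
        \<le> 2 * (\<epsilon> * K) ^ N * M"
      by (simp add: t_def mult.assoc)
  next
    fix \<epsilon> \<mu> \<nu> M A B D m x
    assume *: "0 \<le> \<epsilon>" "\<epsilon> * K \<le> 1 / 4" "cmod \<mu> \<le> r" "cmod \<nu> \<le> r" "bdd_seq R M A" "bdd_seq R M B"
      "\<And>m x. cmod (A m x - B m x) \<le> D"
    have D: "0 \<le> D" using *(7)[of 0 0] norm_ge_zero order_trans by blast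
    have M: "0 \<le> M" by (rule bdd_seqD(4)[OF *(5)])
    have q: "0 \<le> \<epsilon> * K" using * K(1) by simp
    let ?E = "D + cmod (\<mu> - \<nu>) * M"
    have g: "summable (\<lambda>k. (2 * (\<epsilon> * K)) ^ k)"
      using * q by (intro summable_geometric) auto
    have "Res f \<epsilon> \<mu> \<beta> A m x - Res f \<epsilon> \<nu> \<beta> B m x = (\<Sum>k. t \<epsilon> \<mu> A m x k - t \<epsilon> \<nu> B m x k)"
      unfolding Res by (rule suminf_diff[OF summ summ]) (use * in auto)
    also have "cmod \<dots> \<le> (\<Sum>k. (2 * (\<epsilon> * K)) ^ k * ?E)"
    proof (rule norm_suminf_le[OF _ summable_mult2[OF g]])
      fix k
      have "cmod (t \<epsilon> \<mu> A m x k - t \<epsilon> \<nu> B m x k)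
          = \<epsilon> ^ k * cmod ((Top f \<mu> \<beta> ^^ k) A m x - (Top f \<nu> \<beta> ^^ k) B m x)"
        using * by (simp add: t_def norm_mult norm_power flip: right_diff_distrib)
      also have "\<dots> \<le> \<epsilon> ^ k * (K ^ k * (D + real k * cmod (\<mu> - \<nu>) * M))"
        using * by (intro mult_left_mono K(3)) auto
      also have "\<dots> = (\<epsilon> * K) ^ k * (1 * D + real k * (cmod (\<mu> - \<nu>) * M))"
        by (simp add: power_mult_distrib mult.assoc)
      also have "\<dots> \<le> (\<epsilon> * K) ^ k * (2 ^ k * D + 2 ^ k * (cmod (\<mu> - \<nu>) * M))"
      proof (intro mult_left_mono add_mono mult_right_mono)
        show "real k \<le> 2 ^ k"
          using less_exp[of k] by (metis less_imp_le of_nat_le_iff of_nat_numeral of_nat_power)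
      qed (use D M q in auto)
      also have "\<dots> = (2 * (\<epsilon> * K)) ^ k * ?E"
        by (simp add: power_mult_distrib algebra_simps)
      finally show "cmod (t \<epsilon> \<mu> A m x k - t \<epsilon> \<nu> B m x k) \<le> (2 * (\<epsilon> * K)) ^ k * ?E" .
    qed
    also have "\<dots> = (\<Sum>k. (2 * (\<epsilon> * K)) ^ k) * ?E"
      by (rule suminf_mult2 [OF g, symmetric])
    also have "(\<Sum>k. (2 * (\<epsilon> * K)) ^ k) = 1 / (1 - 2 * (\<epsilon> * K))"
      using * q by (intro suminf_geometric) auto
    also have "\<dots> * ?E \<le> 2 * ?E"
      using * q D M by (intro mult_right_mono) (auto simp: divide_le_eq)
    finally show "cmod (Res f \<epsilon> \<mu> \<beta> A m x - Res f \<epsilon> \<nu> \<beta> B m x) \<le> 2 * ?E" .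
  qed
qed

end

subsection \<open>The first-order coefficient\<close>

lemma Im_eq_0_if_cnj_eq: "cnj z = z \<Longrightarrow> Im z = 0"
  by (simp add: complex_eq_iff)

lemma continuous_on_kernel_integral:
  fixes h :: "real \<Rightarrow> complex"
  assumes "continuous_on UNIV h" "continuous_on UNIV a"
  shows "continuous_on S (\<lambda>x. integral {-R..R} (\<lambda>\<xi>. h (x - \<xi>) * a \<xi>))"
proof -
  have "continuous_on UNIV (\<lambda>x. integral (cbox (-R) R) (\<lambda>\<xi>. h (x - \<xi>) * a \<xi>))"
    by (rule integral_continuous_on_param)
       (auto simp: case_prod_unfold intro!: continuous_intros continuous_on_compose2[OF assms(1)]
          continuous_on_compose2[OF assms(2)])
  thus ?thesis
    by (auto intro: continuous_on_subset)
qed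

text \<open>The kernel is Hermitian; this leaves the propagating mode as the only one contributing to the
  imaginary part of the first-order coefficient.\<close>

lemma Im_even_kernel_form:
  fixes h :: "real \<Rightarrow> real" and a :: "real \<Rightarrow> complex"
  assumes h: "continuous_on UNIV h" "\<And>x. h (- x) = h x" and a: "continuous_on UNIV a"
  shows "Im (integral {-R..R} (\<lambda>x. integral {-R..R} (\<lambda>\<xi>. of_real (h (x - \<xi>)) * a \<xi>) * cnj (a x))) = 0"
proof -
  let ?S = "integral {-R..R} (\<lambda>x. integral {-R..R} (\<lambda>\<xi>. of_real (h (x - \<xi>)) * a \<xi>) * cnj (a x))"
  have "cnj ?S = integral (cbox (-R) R) (\<lambda>x. integral (cbox (-R) R) (\<lambda>\<xi>. of_real (h (x - \<xi>)) * cnj (a \<xi>) * a x))"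
    by (simp add: integral_cnj)
  \<comment> \<open>Exchanging the two integrations and using evenness of h identifies the form with
    its own conjugate.\<close>
  also have "\<dots> = integral (cbox (-R) R) (\<lambda>\<xi>. integral (cbox (-R) R) (\<lambda>x. of_real (h (x - \<xi>)) * cnj (a \<xi>) * a x))"
    by (rule integral_swap_continuous)
       (auto simp: case_prod_unfold intro!: continuous_intros continuous_on_compose2[OF h(1)]
          continuous_on_compose2[OF a])
  also have "\<dots> = integral {-R..R} (\<lambda>\<xi>. integral {-R..R} (\<lambda>x. of_real (h (\<xi> - x)) * a x * cnj (a \<xi>)))"
  proof -
    have "of_real (h (x - \<xi>)) * cnj (a \<xi>) * a x = of_real (h (\<xi> - x)) * a x * cnj (a \<xi>)" for x \<xi>
      using h(2)[of "\<xi> - x"] by simp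
    thus ?thesis by (simp only: interval_cbox)
  qed
  also have "\<dots> = ?S"
    by simp
  finally have "cnj ?S = ?S" .
  thus ?thesis
    by (rule Im_eq_0_if_cnj_eq)
qed

lemma integral_lincomb:
  fixes u v w :: "real \<Rightarrow> complex"
  assumes "continuous_on {-R..R} u" "continuous_on {-R..R} v" "continuous_on {-R..R} w"
  shows "integral {-R..R} (\<lambda>x. u x + (c * v x + d * w x))
    = integral {-R..R} u + (c * integral {-R..R} v + d * integral {-R..R} w)"
  by (intro integral_unique has_integral_add has_integral_mult_right integrable_integral
      integrable_continuous_real assms)

context grating
begin

section \<open>Kernels and Fourier integrals at \<mu> = 0\<close>

definition \<kappa> :: real where "\<kappa> = sqrt (1 - 2 * \<beta>)"

lemma \<kappa>: "\<kappa> > 0" and kk0_0: "kk0 0 \<beta> = of_real \<kappa>"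
proof -
  show "\<kappa> > 0" using \<beta> by (simp add: \<kappa>_def)
  show "kk0 0 \<beta> = of_real \<kappa>"
    unfolding \<kappa>_def using \<beta> by (subst of_real_sqrt) (auto simp: kk0_def)
qed

lemma gam_0: "gam 0 \<beta> = of_real ((1 - \<beta>)\<^sup>2 / (4 * pi))"
  by (simp add: gam_def)

lemma fhat_eq: "fhat f j \<xi> = integral {-R..R} (\<lambda>x. exp (- \<i> * of_real \<xi> * of_real x) * fcoef f j x)"
  unfolding fhat_def by (rule integral_UNIV_eq_interval) (simp add: fcoef_supp)

lemma cnj_fhat_eq:
  "cnj (fhat f j \<xi>) = integral {-R..R} (\<lambda>x. exp (\<i> * of_real \<xi> * of_real x) * cnj (fcoef f j x))"
  unfolding fhat_eq integral_cnj by (simp add: exp_cnj)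

lemma Hker_real:
  assumes "n \<noteq> 0"
  shows "Hker n 0 \<beta> x = of_real (Re (Hker n 0 \<beta> x))"
proof (cases "n = -1")
  case False
  have "0 \<le> (\<beta> + of_int n)^2 - (1 - \<beta>)^2"
    using Re_kkm_arg[of 0 n] assms False r c0 by simp
  hence "kkm n 0 \<beta> = of_real (sqrt ((\<beta> + of_int n)^2 - (1 - \<beta>)^2))"
    by (subst of_real_sqrt) (auto simp: kkm_def)
  then obtain k where "kkm n 0 \<beta> = of_real k"
    by blast
  hence "Hker n 0 \<beta> x = of_real (1 / (2 * k) * exp (- k * \<bar>x\<bar>))"
    using assms False by (simp add: Hker_def flip: exp_of_real)
  thus ?thesis by simp
next
  case True
  hence "Hker n 0 \<beta> x = of_real (- \<bar>x\<bar> / 2)"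
    by (simp add: Hker_def)
  thus ?thesis by simp
qed

text \<open>The imaginary part of the outgoing kernel is cos (\<kappa> x) / (2 \<kappa>). Since cos
  is even the absolute value disappears, and as a kernel in x - \<xi> it has rank two; each of its
  two exponentials will produce one of the values d_+ and d_-.\<close>

lemma Hker_0_split:
  "Hker 0 0 \<beta> x = of_real (- sin (\<kappa> * \<bar>x\<bar>) / (2 * \<kappa>))
     + \<i> / (4 * of_real \<kappa>) * (exp (\<i> * of_real \<kappa> * of_real x) + exp (- \<i> * of_real \<kappa> * of_real x))"
proof -
  have c: "exp (\<i> * of_real \<kappa> * of_real x) + exp (- \<i> * of_real \<kappa> * of_real x) = of_real (2 * cos (\<kappa> * \<bar>x\<bar>))"
  proof -
    have "exp (\<i> * of_real \<kappa> * of_real x) = cis (\<kappa> * x)" "exp (- \<i> * of_real \<kappa> * of_real x) = cis (- (\<kappa> * x))"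
      by (simp_all add: cis_conv_exp mult.assoc)
    thus ?thesis
      by (cases "x \<ge> 0") (simp_all add: complex_eq_iff)
  qed
  have "exp (\<i> * of_real \<kappa> * of_real \<bar>x\<bar>) = cis (\<kappa> * \<bar>x\<bar>)"
    by (simp add: cis_conv_exp mult.assoc)
  thus ?thesis
    unfolding c using \<kappa> by (simp add: Hker_def kk0_0 complex_eq_iff)
qed

lemma fcoef_bound: "\<exists>C>0. \<forall>j x. cmod (fcoef f j x) \<le> C"
proof -
  obtain C where C: "C > 0" "\<forall>j x. cmod (fcoef f j x) \<le> C / (1 + (real_of_int j)\<^sup>2)"
    using fcoef_decay by blast
  have "C / (1 + (real_of_int j)\<^sup>2) \<le> C" for j
    using C(1) by (simp add: divide_le_eq add_pos_nonneg mult_le_cancel_left1)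
  thus ?thesis using C by (meson order_trans)
qed

lemma bdd_g2: "\<exists>M. bdd_seq R M (g2 f)"
proof -
  obtain C where "C > 0" "\<forall>j x. cmod (fcoef f j x) \<le> C"
    using fcoef_bound by blast
  hence "bdd_seq R C (g2 f)"
    by (intro bdd_seqI) (auto simp: g2_def [abs_def] continuous_fcoef fcoef_supp)
  thus ?thesis ..
qed

text \<open>The row -1 meets the source f_{n+1} through f_{-1-n}, the conjugate of f_{n+1}. So J is
  the quadratic form of the kernel of index n evaluated at f_{n+1}: real for a real even kernel,
  while for n = 0 the rank-two part adds i (|d_+|^2 + |d_-|^2) / (4 \<kappa>).\<close>

lemma first_order_integral:
  fixes n :: int
  defines "J \<equiv> integral {-R..R} (\<lambda>x. conv (Hker n 0 \<beta>) (g2 f n) x * fcoef f (- 1 - n) x)"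
  shows "n \<noteq> 0 \<Longrightarrow> Im J = 0"
    and "n = 0 \<Longrightarrow> Im J = ((cmod (fhat f 1 \<kappa>))\<^sup>2 + (cmod (fhat f 1 (- \<kappa>)))\<^sup>2) / (4 * \<kappa>)"
proof -
  obtain M where M: "bdd_seq R M (g2 f)"
    using bdd_g2 by blast
  let ?a = "fcoef f (n + 1)"
  have cnj_a: "fcoef f (- 1 - n) x = cnj (?a x)" for x
    using fcoef_uminus[of "n + 1" x] by (simp add: algebra_simps)
  have conv: "conv (Hker n 0 \<beta>) (g2 f n) x = integral {-R..R} (\<lambda>\<xi>. Hker n 0 \<beta> (x - \<xi>) * ?a \<xi>)" for x
    using conv_eq[OF M, of "Hker n 0 \<beta>" n x] by (simp add: g2_def)
  have ca: "continuous_on S ?a" for S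
    by (rule continuous_fcoef)
  {
    assume n: "n \<noteq> 0"
    have "J = integral {-R..R} (\<lambda>x. integral {-R..R} (\<lambda>\<xi>. of_real (Re (Hker n 0 \<beta> (x - \<xi>))) * ?a \<xi>) * cnj (?a x))"
      unfolding J_def conv cnj_a by (simp flip: Hker_real[OF n])
    also have "Im \<dots> = 0"
      by (intro Im_even_kernel_form[where h = "\<lambda>x. Re (Hker n 0 \<beta> x)"] continuous_intros continuous_Hker ca)
         (simp add: Hker_minus)
    finally show "Im J = 0" .
  }
  {
    assume n: "n = 0"
    let ?h = "\<lambda>x. - sin (\<kappa> * \<bar>x\<bar>) / (2 * \<kappa>)"
    let ?e = "\<lambda>\<xi> x::real. exp (\<i> * of_real \<xi> * of_real x)"
    have ch: "continuous_on S ?h" for S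
      using \<kappa> by (intro continuous_intros) auto
    have conv0: "conv (Hker n 0 \<beta>) (g2 f n) x = integral {-R..R} (\<lambda>\<xi>. of_real (?h (x - \<xi>)) * ?a \<xi>)
        + \<i> / (4 * of_real \<kappa>) * (?e \<kappa> x * fhat f 1 \<kappa> + ?e (- \<kappa>) x * fhat f 1 (- \<kappa>))" for x
    proof -
      have e: "?e s (x - \<xi>) = ?e s x * exp (- \<i> * of_real s * of_real \<xi>)" for \<xi> s
        by (simp add: algebra_simps flip: exp_add)
      have "Hker n 0 \<beta> (x - \<xi>) * ?a \<xi> = of_real (?h (x - \<xi>)) * ?a \<xi>
          + (\<i> / (4 * of_real \<kappa>) * ?e \<kappa> x * (exp (- \<i> * of_real \<kappa> * of_real \<xi>) * ?a \<xi>)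
           + \<i> / (4 * of_real \<kappa>) * ?e (- \<kappa>) x * (exp (- \<i> * of_real (- \<kappa>) * of_real \<xi>) * ?a \<xi>))" for \<xi>
        using n e[of \<kappa> \<xi>] e[of "- \<kappa>" \<xi>] unfolding n Hker_0_split by (simp add: algebra_simps)
      hence "conv (Hker n 0 \<beta>) (g2 f n) x = integral {-R..R} (\<lambda>\<xi>. of_real (?h (x - \<xi>)) * ?a \<xi>
          + (\<i> / (4 * of_real \<kappa>) * ?e \<kappa> x * (exp (- \<i> * of_real \<kappa> * of_real \<xi>) * ?a \<xi>)
           + \<i> / (4 * of_real \<kappa>) * ?e (- \<kappa>) x * (exp (- \<i> * of_real (- \<kappa>) * of_real \<xi>) * ?a \<xi>)))"
        unfolding conv by simp
      also have "\<dots> = integral {-R..R} (\<lambda>\<xi>. of_real (?h (x - \<xi>)) * ?a \<xi>)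
          + (\<i> / (4 * of_real \<kappa>) * ?e \<kappa> x * fhat f 1 \<kappa> + \<i> / (4 * of_real \<kappa>) * ?e (- \<kappa>) x * fhat f 1 (- \<kappa>))"
        unfolding fhat_eq n add_0
      proof (rule integral_lincomb)
        show "continuous_on {-R..R} (\<lambda>\<xi>. of_real (?h (x - \<xi>)) * fcoef f 1 \<xi>)"
          using \<kappa> by (intro continuous_intros continuous_fcoef) auto
      qed (intro continuous_intros continuous_fcoef)+
      finally show ?thesis by (simp add: algebra_simps)
    qed
    let ?S = "integral {-R..R} (\<lambda>x. integral {-R..R} (\<lambda>\<xi>. of_real (?h (x - \<xi>)) * ?a \<xi>) * cnj (?a x))"
    have cK: "continuous_on S (\<lambda>x. integral {-R..R} (\<lambda>\<xi>. of_real (?h (x - \<xi>)) * ?a \<xi>))" for S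
      by (intro continuous_on_kernel_integral[where h = "\<lambda>x. of_real (?h x)"] continuous_on_of_real ch ca)
    have "J = integral {-R..R} (\<lambda>x. integral {-R..R} (\<lambda>\<xi>. of_real (?h (x - \<xi>)) * ?a \<xi>) * cnj (?a x)
        + (\<i> / (4 * of_real \<kappa>) * fhat f 1 \<kappa> * (?e \<kappa> x * cnj (?a x))
         + \<i> / (4 * of_real \<kappa>) * fhat f 1 (- \<kappa>) * (?e (- \<kappa>) x * cnj (?a x))))"
      unfolding J_def conv0 cnj_a by (simp add: algebra_simps)
    also have "\<dots> = ?S + (\<i> / (4 * of_real \<kappa>) * fhat f 1 \<kappa> * cnj (fhat f 1 \<kappa>)
         + \<i> / (4 * of_real \<kappa>) * fhat f 1 (- \<kappa>) * cnj (fhat f 1 (- \<kappa>)))"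
      unfolding cnj_fhat_eq n add_0
    proof (rule integral_lincomb)
      show "continuous_on {-R..R} (\<lambda>x. integral {-R..R} (\<lambda>\<xi>. of_real (?h (x - \<xi>)) * fcoef f 1 \<xi>) * cnj (fcoef f 1 x))"
        using cK unfolding n add_0 by (intro continuous_on_mult continuous_on_cnj continuous_fcoef)
    qed (intro continuous_intros continuous_fcoef)+
    also have "\<dots> = ?S + \<i> * of_real (((cmod (fhat f 1 \<kappa>))\<^sup>2 + (cmod (fhat f 1 (- \<kappa>)))\<^sup>2) / (4 * \<kappa>))"
      by (simp add: complex_norm_square add_divide_distrib algebra_simps del: of_real_power)
    finally show "Im J = ((cmod (fhat f 1 \<kappa>))\<^sup>2 + (cmod (fhat f 1 (- \<kappa>)))\<^sup>2) / (4 * \<kappa>)"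
      using Im_even_kernel_form[of ?h ?a R] ch ca by simp
  }
qed

lemma avg_eq:
  assumes "\<And>x. \<bar>x\<bar> > R \<Longrightarrow> h x = 0"
  shows "avg h = integral {-R..R} h"
  unfolding avg_def using assms by (rule integral_UNIV_eq_interval)

lemma Im_avg_Top:
  "Im (avg (Top f 0 \<beta> (g2 f) (-1)))
     = (1 - \<beta>)\<^sup>2 / (4 * pi) * ((cmod (fhat f 1 \<kappa>))\<^sup>2 + (cmod (fhat f 1 (- \<kappa>)))\<^sup>2) / (2 * \<kappa>)"
proof -
  obtain M where M: "bdd_seq R M (g2 f)"
    using bdd_g2 by blast
  let ?t = "\<lambda>n x. conv (Hker n 0 \<beta>) (g2 f n) x * fcoef f (-1 - n) x"
  let ?J = "\<lambda>n. integral {-R..R} (?t n)"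
  have ct: "continuous_on S (?t n)" for S n
    by (intro continuous_intros continuous_conv[OF M] continuous_fcoef)
  have u: "uniform_limit {-R..R} (\<lambda>X x. \<Sum>n\<in>X. ?t n x) (\<lambda>x. \<Sum>\<^sub>\<infinity>n. ?t n x) (finite_subsets_at_top UNIV)"
    using r by (intro uniform_limit_Top[OF _ M]) simp
  obtain I J where I: "\<And>X. ((\<lambda>x. \<Sum>n\<in>X. ?t n x) has_integral I X) {-R..R}"
    and J: "((\<lambda>x. \<Sum>\<^sub>\<infinity>n. ?t n x) has_integral J) {-R..R}" and lim: "(I \<longlongrightarrow> J) (finite_subsets_at_top UNIV)"
    by (rule uniform_limit_integral[OF u]) (auto intro!: continuous_on_sum ct)
  \<comment> \<open>Every finite partial sum that contains the mode 0 has the same imaginary part,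
    so the limit over finite index sets is read off without estimating the remaining terms.\<close>
  have "Im (I X) = Im (?J 0)" if "finite X" "0 \<in> X" for X
  proof -
    have "I X = (\<Sum>n\<in>X. ?J n)"
      using I[of X] that(1) by (subst integral_sum [symmetric])
        (auto intro!: integrable_continuous_real ct simp: integral_unique)
    also have "Im \<dots> = (\<Sum>n\<in>X. if n = 0 then Im (?J 0) else 0)"
      unfolding Im_sum by (intro sum.cong) (auto simp: first_order_integral(1))
    finally show ?thesis using that by simp
  qed
  hence "\<forall>\<^sub>F X in finite_subsets_at_top UNIV. Im (I X) = Im (?J 0)"
    unfolding eventually_finite_subsets_at_top by (intro exI[of _ "{0}"]) auto
  hence "((\<lambda>X. Im (I X)) \<longlongrightarrow> Im (?J 0)) (finite_subsets_at_top UNIV)"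
    by (rule tendsto_eventually)
  hence ImJ: "Im J = Im (?J 0)"
    using tendsto_unique[OF _ tendsto_Im[OF lim]] by simp
  have "avg (Top f 0 \<beta> (g2 f) (-1)) = integral {-R..R} (Top f 0 \<beta> (g2 f) (-1))"
    by (rule avg_eq) (simp add: Top_def fcoef_supp)
  also have "\<dots> = 2 * gam 0 \<beta> * J"
    unfolding Top_def [abs_def] by (rule integral_unique [OF has_integral_mult_right [OF J]])
  also have "Im \<dots> = 2 * ((1 - \<beta>)\<^sup>2 / (4 * pi)) * Im (?J 0)"
    unfolding gam_0 using ImJ by simp
  also have "Im (?J 0) = ((cmod (fhat f 1 \<kappa>))\<^sup>2 + (cmod (fhat f 1 (- \<kappa>)))\<^sup>2) / (4 * \<kappa>)"
    using first_order_integral(2)[of 0] by simp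
  finally show ?thesis
    by (simp add: field_simps)
qed

end

subsection \<open>Limits of the coefficients\<close>

text \<open>Replaces the separate constants and thresholds of finitely many coefficients by a single
  pair.\<close>

lemma common_linear_bound:
  fixes X :: "'i \<Rightarrow> real \<Rightarrow> complex \<Rightarrow> complex"
  assumes "finite I"
    "\<And>i. i \<in> I \<Longrightarrow> \<exists>C e. C > 0 \<and> e > 0 \<and>
        (\<forall>\<epsilon> \<mu>. 0 \<le> \<epsilon> \<and> \<epsilon> \<le> e \<and> cmod \<mu> \<le> r \<longrightarrow> cmod (X i \<epsilon> \<mu>) \<le> C * (\<epsilon> + cmod \<mu>))"
  shows "\<exists>C e. C > 0 \<and> e > 0 \<and>
        (\<forall>i\<in>I. \<forall>\<epsilon> \<mu>. 0 \<le> \<epsilon> \<and> \<epsilon> \<le> e \<and> cmod \<mu> \<le> r \<longrightarrow> cmod (X i \<epsilon> \<mu>) \<le> C * (\<epsilon> + cmod \<mu>))"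
  using assms
proof (induction I rule: finite_induct)
  case empty
  show ?case by (intro exI[of _ 1]) auto
next
  case (insert i I)
  obtain C e where C: "C > 0" "e > 0" "\<forall>\<epsilon> \<mu>. 0 \<le> \<epsilon> \<and> \<epsilon> \<le> e \<and> cmod \<mu> \<le> r \<longrightarrow> cmod (X i \<epsilon> \<mu>) \<le> C * (\<epsilon> + cmod \<mu>)"
    using insert.prems[of i] by blast
  obtain D d where D: "D > 0" "d > 0" "\<forall>i\<in>I. \<forall>\<epsilon> \<mu>. 0 \<le> \<epsilon> \<and> \<epsilon> \<le> d \<and> cmod \<mu> \<le> r \<longrightarrow> cmod (X i \<epsilon> \<mu>) \<le> D * (\<epsilon> + cmod \<mu>)"
    using insert.IH insert.prems by blast
  have "cmod (X j \<epsilon> \<mu>) \<le> max C D * (\<epsilon> + cmod \<mu>)"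
    if "j \<in> insert i I" "0 \<le> \<epsilon>" "\<epsilon> \<le> min e d" "cmod \<mu> \<le> r" for j \<epsilon> \<mu>
  proof -
    have "cmod (X j \<epsilon> \<mu>) \<le> C * (\<epsilon> + cmod \<mu>) \<or> cmod (X j \<epsilon> \<mu>) \<le> D * (\<epsilon> + cmod \<mu>)"
      using that C D by auto
    moreover have "C * (\<epsilon> + cmod \<mu>) \<le> max C D * (\<epsilon> + cmod \<mu>)" "D * (\<epsilon> + cmod \<mu>) \<le> max C D * (\<epsilon> + cmod \<mu>)"
      using that by (auto intro!: mult_right_mono)
    ultimately show ?thesis by linarith
  qed
  thus ?case
    using C(1,2) D(1,2) by (intro exI[of _ "max C D"] exI[of _ "min e d"]) auto
qed

context grating
begin

text \<open>At \<epsilon> = 0 the resolvent is the identity. Leaving the source A and the weight h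
  general treats Q, P and R together; the error splits into three parts, from the resolvent, from
  the source and from the weight.\<close>

lemma avg_Res_limit:
  assumes A: "\<And>\<mu>. cmod \<mu> \<le> r \<Longrightarrow> bdd_seq R M (A \<mu>)"
    and AL: "\<And>\<mu> m x. cmod \<mu> \<le> r \<Longrightarrow> cmod (A \<mu> m x - A 0 m x) \<le> B * cmod \<mu>"
    and hc: "\<And>\<mu>. continuous_on UNIV (h \<mu>)"
    and hb: "\<And>\<mu> x. cmod \<mu> \<le> r \<Longrightarrow> \<bar>x\<bar> \<le> R \<Longrightarrow> cmod (h \<mu> x) \<le> B"
    and hl: "\<And>\<mu> x. cmod \<mu> \<le> r \<Longrightarrow> \<bar>x\<bar> \<le> R \<Longrightarrow> cmod (h \<mu> x - h 0 x) \<le> B * cmod \<mu>"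
  shows "\<exists>C e. C > 0 \<and> e > 0 \<and> (\<forall>\<epsilon> \<mu>. 0 \<le> \<epsilon> \<and> \<epsilon> \<le> e \<and> cmod \<mu> \<le> r \<longrightarrow>
           cmod (avg (\<lambda>x. Res f \<epsilon> \<mu> \<beta> (A \<mu>) m x * h \<mu> x) - integral {-R..R} (\<lambda>x. A 0 m x * h 0 x))
             \<le> C * (\<epsilon> + cmod \<mu>))"
proof -
  obtain K where K: "K \<ge> 1"
    "\<And>\<epsilon> \<mu> M A m S. 0 \<le> \<epsilon> \<Longrightarrow> \<epsilon> * K \<le> 1 / 4 \<Longrightarrow> cmod \<mu> \<le> r \<Longrightarrow> bdd_seq R M A \<Longrightarrow>
       continuous_on S (Res f \<epsilon> \<mu> \<beta> A m)"
    "\<And>\<epsilon> \<mu> M A m x. cmod \<mu> \<le> r \<Longrightarrow> bdd_seq R M A \<Longrightarrow> \<bar>x\<bar> > R \<Longrightarrow> Res f \<epsilon> \<mu> \<beta> A m x = 0"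
    "\<And>\<epsilon> \<mu> M A m x N. 0 \<le> \<epsilon> \<Longrightarrow> \<epsilon> * K \<le> 1 / 4 \<Longrightarrow> cmod \<mu> \<le> r \<Longrightarrow> bdd_seq R M A \<Longrightarrow>
       cmod (Res f \<epsilon> \<mu> \<beta> A m x - (\<Sum>k<N. of_real \<epsilon> ^ k * (Top f \<mu> \<beta> ^^ k) A m x)) \<le> 2 * (\<epsilon> * K) ^ N * M"
    "\<And>\<epsilon> \<mu> \<nu> M A B D m x. 0 \<le> \<epsilon> \<Longrightarrow> \<epsilon> * K \<le> 1 / 4 \<Longrightarrow> cmod \<mu> \<le> r \<Longrightarrow> cmod \<nu> \<le> r \<Longrightarrow>
       bdd_seq R M A \<Longrightarrow> bdd_seq R M B \<Longrightarrow> (\<And>m x. cmod (A m x - B m x) \<le> D) \<Longrightarrow>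
       cmod (Res f \<epsilon> \<mu> \<beta> A m x - Res f \<epsilon> \<nu> \<beta> B m x) \<le> 2 * (D + cmod (\<mu> - \<nu>) * M)"
    using Res_bounds by blast
  have r0: "cmod 0 \<le> r" using r by simp
  have M: "0 \<le> M" using bdd_seqD(4)[OF A[OF r0]] .
  have B: "0 \<le> B" using order_trans[OF norm_ge_zero hb[OF r0, of 0]] R by simp
  define c where "c = 2 * K * M * B + B * B + M * B"
  have c: "0 \<le> c" using K(1) M B by (simp add: c_def)
  show ?thesis
  proof (rule exI[of _ "2 * R * c + 1"], rule exI[of _ "1 / (4 * K)"], intro conjI allI impI)
    show "2 * R * c + 1 > 0" using R c by (simp add: add_nonneg_pos)
    show "1 / (4 * K) > 0" using K(1) by simp
    fix \<epsilon> \<mu> assume "0 \<le> \<epsilon> \<and> \<epsilon> \<le> 1 / (4 * K) \<and> cmod \<mu> \<le> r"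
    hence \<epsilon>: "0 \<le> \<epsilon>" "\<epsilon> \<le> 1 / (4 * K)" and \<mu>: "cmod \<mu> \<le> r"
      by auto
    have \<epsilon>K: "\<epsilon> * K \<le> 1 / 4"
      using \<epsilon> K(1) by (simp add: field_simps)
    note A\<mu> = A[OF \<mu>] and A0 = A[OF r0]
    have "cmod (integral {-R..R} (\<lambda>x. Res f \<epsilon> \<mu> \<beta> (A \<mu>) m x * h \<mu> x) - integral {-R..R} (\<lambda>x. A 0 m x * h 0 x))
        \<le> 2 * R * (c * (\<epsilon> + cmod \<mu>))"
    proof (rule norm_integral_diff_le)
      show "continuous_on {-R..R} (\<lambda>x. Res f \<epsilon> \<mu> \<beta> (A \<mu>) m x * h \<mu> x)"
        by (intro continuous_on_mult K(2)[OF \<epsilon>(1) \<epsilon>K \<mu> A\<mu>] continuous_on_subset[OF hc]) auto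
      show "continuous_on {-R..R} (\<lambda>x. A 0 m x * h 0 x)"
        by (intro continuous_on_mult bdd_seqD(1)[OF A0] continuous_on_subset[OF hc]) auto
      fix x assume x: "\<bar>x\<bar> \<le> R"
      have "Res f \<epsilon> \<mu> \<beta> (A \<mu>) m x * h \<mu> x - A 0 m x * h 0 x
          = (Res f \<epsilon> \<mu> \<beta> (A \<mu>) m x - A \<mu> m x) * h \<mu> x + (A \<mu> m x - A 0 m x) * h \<mu> x + A 0 m x * (h \<mu> x - h 0 x)"
        by (simp add: algebra_simps)
      also have "cmod \<dots> \<le> (2 * (\<epsilon> * K) * M) * B + (B * cmod \<mu>) * B + M * (B * cmod \<mu>)"
      proof (intro norm_triangle_mono; unfold norm_mult; intro mult_mono)
        show "cmod (Res f \<epsilon> \<mu> \<beta> (A \<mu>) m x - A \<mu> m x) \<le> 2 * (\<epsilon> * K) * M"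
          using K(4)[OF \<epsilon>(1) \<epsilon>K \<mu> A\<mu>, of m x 1] by simp
      qed (use hb[OF \<mu> x] hl[OF \<mu> x] AL[OF \<mu>] bdd_seqD(2)[OF A0] M B K(1) \<epsilon> in auto)
      also have "\<dots> \<le> c * (\<epsilon> + cmod \<mu>)"
        using K(1) M B \<epsilon> by (simp add: c_def algebra_simps)
      finally show "cmod (Res f \<epsilon> \<mu> \<beta> (A \<mu>) m x * h \<mu> x - A 0 m x * h 0 x) \<le> c * (\<epsilon> + cmod \<mu>)" .
    qed (use R in auto)
    also have "\<dots> \<le> (2 * R * c + 1) * (\<epsilon> + cmod \<mu>)"
      using \<epsilon> by (simp add: algebra_simps)
    finally show "cmod (avg (\<lambda>x. Res f \<epsilon> \<mu> \<beta> (A \<mu>) m x * h \<mu> x) - integral {-R..R} (\<lambda>x. A 0 m x * h 0 x))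
             \<le> (2 * R * c + 1) * (\<epsilon> + cmod \<mu>)"
      using K(3)[OF \<mu> A\<mu>] by (subst avg_eq) auto
  qed
qed

text \<open>The range |s| \<le> 1 covers the two signs in P and R, the factor in \<open>g1\<close>
  (s = 1) and the constant weight 1 (s = 0). The bound exp (2 R) is due to |k_0| \<le> 2.\<close>

lemma exp_kk0_bounds:
  obtains B where "B > 0"
    "\<And>s \<mu> x. \<bar>s\<bar> \<le> 1 \<Longrightarrow> cmod \<mu> \<le> r \<Longrightarrow> \<bar>x\<bar> \<le> R \<Longrightarrow> cmod (exp (of_real s * \<i> * kk0 \<mu> \<beta> * of_real x)) \<le> B"
    "\<And>s \<mu> x. \<bar>s\<bar> \<le> 1 \<Longrightarrow> cmod \<mu> \<le> r \<Longrightarrow> \<bar>x\<bar> \<le> R \<Longrightarrow>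
       cmod (exp (of_real s * \<i> * kk0 \<mu> \<beta> * of_real x) - exp (of_real s * \<i> * kk0 0 \<beta> * of_real x)) \<le> B * cmod \<mu>"
proof -
  define B where "B = exp (2 * R) * (1 + R / sqrt c0)"
  have cn: "cmod (of_real s * \<i> * k * of_real x) \<le> cmod k * R" if "\<bar>s\<bar> \<le> 1" "\<bar>x\<bar> \<le> R" for s x :: real and k :: complex
  proof -
    have "cmod (of_real s * \<i> * k * of_real x) = \<bar>s\<bar> * (cmod k * \<bar>x\<bar>)"
      by (simp add: norm_mult)
    also have "\<dots> \<le> 1 * (cmod k * R)"
      using that by (intro mult_mono mult_left_mono) auto
    finally show ?thesis by simp
  qed
  have re: "Re (of_real s * \<i> * kk0 \<mu> \<beta> * of_real x) \<le> 2 * R" if "\<bar>s\<bar> \<le> 1" "cmod \<mu> \<le> r" "\<bar>x\<bar> \<le> R" for s x \<mu>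
  proof -
    have "Re (of_real s * \<i> * kk0 \<mu> \<beta> * of_real x) \<le> cmod (of_real s * \<i> * kk0 \<mu> \<beta> * of_real x)"
      by (rule complex_Re_le_cmod)
    also have "\<dots> \<le> cmod (kk0 \<mu> \<beta>) * R"
      by (rule cn[OF that(1,3)])
    also have "\<dots> \<le> 2 * R"
      using kk0_bounds(2)[OF that(2)] R by (intro mult_right_mono) auto
    finally show ?thesis .
  qed
  show ?thesis
  proof (rule that[of B])
    show "B > 0" using R c0 by (auto simp: B_def intro!: mult_pos_pos add_pos_pos)
    fix s x :: real and \<mu> assume *: "\<bar>s\<bar> \<le> 1" "cmod \<mu> \<le> r" "\<bar>x\<bar> \<le> R"
    have "cmod (exp (of_real s * \<i> * kk0 \<mu> \<beta> * of_real x)) \<le> exp (2 * R) * 1"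
      using re[OF *] unfolding norm_exp_eq_Re by simp
    also have "\<dots> \<le> B"
      unfolding B_def using R c0 by (intro mult_left_mono) auto
    finally show "cmod (exp (of_real s * \<i> * kk0 \<mu> \<beta> * of_real x)) \<le> B" .
    have "cmod (exp (of_real s * \<i> * kk0 \<mu> \<beta> * of_real x) - exp (of_real s * \<i> * kk0 0 \<beta> * of_real x))
        \<le> exp (2 * R) * cmod (of_real s * \<i> * kk0 \<mu> \<beta> * of_real x - of_real s * \<i> * kk0 0 \<beta> * of_real x)"
      using r by (intro norm_exp_diff_le re *) auto
    also have "of_real s * \<i> * kk0 \<mu> \<beta> * of_real x - of_real s * \<i> * kk0 0 \<beta> * of_real x
        = of_real s * \<i> * (kk0 \<mu> \<beta> - kk0 0 \<beta>) * of_real x"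
      by (simp add: algebra_simps)
    also have "exp (2 * R) * cmod (of_real s * \<i> * (kk0 \<mu> \<beta> - kk0 0 \<beta>) * of_real x)
        \<le> exp (2 * R) * (cmod (kk0 \<mu> \<beta> - kk0 0 \<beta>) * R)"
      by (intro mult_left_mono cn *) auto
    also have "\<dots> \<le> exp (2 * R) * ((cmod (\<mu> - 0) / sqrt c0) * R)"
      using R r by (intro mult_left_mono mult_right_mono kk0_lipschitz *) auto
    also have "\<dots> = exp (2 * R) * (R / sqrt c0) * cmod \<mu>"
      by simp
    also have "\<dots> \<le> B * cmod \<mu>"
      unfolding B_def by (intro mult_right_mono mult_left_mono) auto
    finally show "cmod (exp (of_real s * \<i> * kk0 \<mu> \<beta> * of_real x) - exp (of_real s * \<i> * kk0 0 \<beta> * of_real x))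
        \<le> B * cmod \<mu>" .
  qed
qed

lemma g1_bounds:
  obtains M where "\<And>\<mu>. cmod \<mu> \<le> r \<Longrightarrow> bdd_seq R M (g1 f \<mu> \<beta>)"
    "\<And>\<mu> m x. cmod \<mu> \<le> r \<Longrightarrow> cmod (g1 f \<mu> \<beta> m x - g1 f 0 \<beta> m x) \<le> M * cmod \<mu>"
proof -
  obtain C where C: "C > 0" "\<forall>j x. cmod (fcoef f j x) \<le> C"
    using fcoef_bound by blast
  obtain B where B: "B > 0"
    "\<And>s \<mu> x. \<bar>s\<bar> \<le> 1 \<Longrightarrow> cmod \<mu> \<le> r \<Longrightarrow> \<bar>x\<bar> \<le> R \<Longrightarrow> cmod (exp (of_real s * \<i> * kk0 \<mu> \<beta> * of_real x)) \<le> B"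
    "\<And>s \<mu> x. \<bar>s\<bar> \<le> 1 \<Longrightarrow> cmod \<mu> \<le> r \<Longrightarrow> \<bar>x\<bar> \<le> R \<Longrightarrow>
       cmod (exp (of_real s * \<i> * kk0 \<mu> \<beta> * of_real x) - exp (of_real s * \<i> * kk0 0 \<beta> * of_real x)) \<le> B * cmod \<mu>"
    using exp_kk0_bounds by blast
  note B1 = B(2)[of 1, simplified] B(3)[of 1, simplified]
  show ?thesis
  proof (rule that[of "B * C"])
    fix \<mu> assume \<mu>: "cmod \<mu> \<le> r"
    show "bdd_seq R (B * C) (g1 f \<mu> \<beta>)"
    proof (rule bdd_seqI)
      show "continuous_on UNIV (g1 f \<mu> \<beta> m)" for m
        unfolding g1_def [abs_def] by (intro continuous_intros continuous_fcoef)
      show "cmod (g1 f \<mu> \<beta> m x) \<le> B * C" for m x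
      proof (cases "\<bar>x\<bar> \<le> R")
        case True
        thus ?thesis unfolding g1_def norm_mult using B1(1)[OF \<mu>] B C by (intro mult_mono) auto
      qed (use B(1) C(1) in \<open>simp add: g1_def fcoef_supp\<close>)
    qed (simp add: g1_def fcoef_supp)
    show "cmod (g1 f \<mu> \<beta> m x - g1 f 0 \<beta> m x) \<le> B * C * cmod \<mu>" for m x
    proof (cases "\<bar>x\<bar> \<le> R")
      case True
      have "cmod (g1 f \<mu> \<beta> m x - g1 f 0 \<beta> m x)
          = cmod (exp (\<i> * kk0 \<mu> \<beta> * of_real x) - exp (\<i> * kk0 0 \<beta> * of_real x)) * cmod (fcoef f m x)"
        by (simp add: g1_def flip: norm_mult left_diff_distrib)
      also have "\<dots> \<le> (B * cmod \<mu>) * C"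
        using B1(2)[OF \<mu> True] B C by (intro mult_mono) auto
      finally show ?thesis by (simp add: mult_ac)
    qed (use B(1) C(1) in \<open>simp add: g1_def fcoef_supp\<close>)
  qed
qed

text \<open>With the resolvent replaced by the identity and \<mu> = 0, the coefficients are Fourier
  integrals of f_{-1}, f_0 and f_1. Reality of f, in the form f_{-1} = conj f_1 and f_0 = conj f_0,
  turns those of Q and P^+ into conjugates.\<close>

lemma coefficient_limits:
  obtains C e where "C > 0" "e > 0"
    "\<And>\<epsilon> \<mu>. 0 \<le> \<epsilon> \<Longrightarrow> \<epsilon> \<le> e \<Longrightarrow> cmod \<mu> \<le> r \<Longrightarrow> cmod (QQ f \<epsilon> \<mu> \<beta> - cnj (fhat f 1 \<kappa>)) \<le> C * (\<epsilon> + cmod \<mu>)"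
    "\<And>\<epsilon> \<mu>. 0 \<le> \<epsilon> \<Longrightarrow> \<epsilon> \<le> e \<Longrightarrow> cmod \<mu> \<le> r \<Longrightarrow> cmod (PP 1 f \<epsilon> \<mu> \<beta> - cnj (fhat f 0 (2 * \<kappa>))) \<le> C * (\<epsilon> + cmod \<mu>)"
    "\<And>\<epsilon> \<mu>. 0 \<le> \<epsilon> \<Longrightarrow> \<epsilon> \<le> e \<Longrightarrow> cmod \<mu> \<le> r \<Longrightarrow> cmod (PP (-1) f \<epsilon> \<mu> \<beta> - fhat f 0 0) \<le> C * (\<epsilon> + cmod \<mu>)"
    "\<And>\<epsilon> \<mu>. 0 \<le> \<epsilon> \<Longrightarrow> \<epsilon> \<le> e \<Longrightarrow> cmod \<mu> \<le> r \<Longrightarrow> cmod (RR 1 f \<epsilon> \<mu> \<beta> - fhat f 1 (- \<kappa>)) \<le> C * (\<epsilon> + cmod \<mu>)"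
    "\<And>\<epsilon> \<mu>. 0 \<le> \<epsilon> \<Longrightarrow> \<epsilon> \<le> e \<Longrightarrow> cmod \<mu> \<le> r \<Longrightarrow> cmod (RR (-1) f \<epsilon> \<mu> \<beta> - fhat f 1 \<kappa>) \<le> C * (\<epsilon> + cmod \<mu>)"
proof -
  obtain B where B: "B > 0"
    "\<And>s \<mu> x. \<bar>s\<bar> \<le> 1 \<Longrightarrow> cmod \<mu> \<le> r \<Longrightarrow> \<bar>x\<bar> \<le> R \<Longrightarrow> cmod (exp (of_real s * \<i> * kk0 \<mu> \<beta> * of_real x)) \<le> B"
    "\<And>s \<mu> x. \<bar>s\<bar> \<le> 1 \<Longrightarrow> cmod \<mu> \<le> r \<Longrightarrow> \<bar>x\<bar> \<le> R \<Longrightarrow>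
       cmod (exp (of_real s * \<i> * kk0 \<mu> \<beta> * of_real x) - exp (of_real s * \<i> * kk0 0 \<beta> * of_real x)) \<le> B * cmod \<mu>"
    using exp_kk0_bounds by blast
  obtain M where M: "\<And>\<mu>. cmod \<mu> \<le> r \<Longrightarrow> bdd_seq R M (g1 f \<mu> \<beta>)"
    "\<And>\<mu> m x. cmod \<mu> \<le> r \<Longrightarrow> cmod (g1 f \<mu> \<beta> m x - g1 f 0 \<beta> m x) \<le> M * cmod \<mu>"
    using g1_bounds by blast
  obtain M2 where M2: "bdd_seq R M2 (g2 f)"
    using bdd_g2 by blast
  let ?h = "\<lambda>s \<mu> x. exp (of_real s * \<i> * kk0 \<mu> \<beta> * of_real x)"
  define B' where "B' = max B M"
  have Bh: "\<bar>s\<bar> \<le> 1 \<Longrightarrow> cmod \<mu> \<le> r \<Longrightarrow> \<bar>x\<bar> \<le> R \<Longrightarrow> cmod (?h s \<mu> x) \<le> B'"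
    "\<bar>s\<bar> \<le> 1 \<Longrightarrow> cmod \<mu> \<le> r \<Longrightarrow> \<bar>x\<bar> \<le> R \<Longrightarrow> cmod (?h s \<mu> x - ?h s 0 x) \<le> B' * cmod \<mu>" for s \<mu> x
    using B(2,3)[of s \<mu> x] mult_right_mono[of B B' "cmod \<mu>"] by (auto simp: B'_def)
  have MB: "cmod \<mu> \<le> r \<Longrightarrow> cmod (g1 f \<mu> \<beta> m x - g1 f 0 \<beta> m x) \<le> B' * cmod \<mu>" for \<mu> m x
    using M(2)[of \<mu> m x] mult_right_mono[of M B' "cmod \<mu>"] by (auto simp: B'_def)
  have c: "continuous_on UNIV (?h s \<mu>)" for s \<mu>
    by (intro continuous_intros)
  have B'0: "0 \<le> B'" using B(1) by (simp add: B'_def)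
  let ?L = "\<lambda>X. \<exists>C e. C > 0 \<and> e > 0 \<and>
        (\<forall>\<epsilon> \<mu>. 0 \<le> \<epsilon> \<and> \<epsilon> \<le> e \<and> cmod \<mu> \<le> r \<longrightarrow> cmod (X \<epsilon> \<mu>) \<le> C * (\<epsilon> + cmod \<mu>))"
  \<comment> \<open>Q carries no exponential weight; s = 0 supplies the weight 1, so the common
    lemma applies.\<close>
  have "?L (\<lambda>\<epsilon> \<mu>. avg (\<lambda>x. Res f \<epsilon> \<mu> \<beta> (g1 f \<mu> \<beta>) (-1) x * ?h 0 \<mu> x) - integral {-R..R} (\<lambda>x. g1 f 0 \<beta> (-1) x * ?h 0 0 x))"
    by (rule avg_Res_limit[OF M(1) MB c Bh]) auto
  moreover have "integral {-R..R} (\<lambda>x. g1 f 0 \<beta> (-1) x * ?h 0 0 x) = cnj (fhat f 1 \<kappa>)"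
    unfolding cnj_fhat_eq using fcoef_uminus[of 1] by (simp add: g1_def kk0_0)
  ultimately have Q: "?L (\<lambda>\<epsilon> \<mu>. QQ f \<epsilon> \<mu> \<beta> - cnj (fhat f 1 \<kappa>))"
    by (simp add: QQ_def eta_contract_eq)
  have P: "?L (\<lambda>\<epsilon> \<mu>. PP s f \<epsilon> \<mu> \<beta> - integral {-R..R} (\<lambda>x. g1 f 0 \<beta> 0 x * ?h s 0 x))" if "\<bar>s\<bar> \<le> 1" for s
    unfolding PP_def by (rule avg_Res_limit[OF M(1) MB c Bh]) (use that in auto)
  have R: "?L (\<lambda>\<epsilon> \<mu>. RR s f \<epsilon> \<mu> \<beta> - integral {-R..R} (\<lambda>x. g2 f 0 x * ?h s 0 x))" if "\<bar>s\<bar> \<le> 1" for s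
    unfolding RR_def by (rule avg_Res_limit[OF M2 _ c Bh]) (use that B'0 in auto)
  have f0: "fcoef f 0 x = cnj (fcoef f 0 x)" for x
    using fcoef_uminus[of 0 x] by simp
  have "integral {-R..R} (\<lambda>x. g1 f 0 \<beta> 0 x * ?h 1 0 x) = cnj (fhat f 0 (2 * \<kappa>))"
    unfolding cnj_fhat_eq f0[symmetric] by (simp add: g1_def kk0_0 algebra_simps flip: exp_add)
  with P[of 1] have P1: "?L (\<lambda>\<epsilon> \<mu>. PP 1 f \<epsilon> \<mu> \<beta> - cnj (fhat f 0 (2 * \<kappa>)))"
    by simp
  have "integral {-R..R} (\<lambda>x. g1 f 0 \<beta> 0 x * ?h (-1) 0 x) = fhat f 0 0"
    unfolding fhat_eq by (simp add: g1_def kk0_0 algebra_simps flip: exp_add)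
  with P[of "-1"] have P2: "?L (\<lambda>\<epsilon> \<mu>. PP (-1) f \<epsilon> \<mu> \<beta> - fhat f 0 0)"
    by simp
  have R': "integral {-R..R} (\<lambda>x. g2 f 0 x * ?h s 0 x) = fhat f 1 (- s * \<kappa>)" for s
    unfolding fhat_eq by (simp add: g2_def kk0_0 mult_ac)
  have R1: "?L (\<lambda>\<epsilon> \<mu>. RR 1 f \<epsilon> \<mu> \<beta> - fhat f 1 (- \<kappa>))" and R2: "?L (\<lambda>\<epsilon> \<mu>. RR (-1) f \<epsilon> \<mu> \<beta> - fhat f 1 \<kappa>)"
    using R[of 1] R[of "-1"] unfolding R' by simp_all
  let ?X = "\<lambda>i::nat. if i = 0 then (\<lambda>\<epsilon> \<mu>. QQ f \<epsilon> \<mu> \<beta> - cnj (fhat f 1 \<kappa>))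
     else if i = 1 then (\<lambda>\<epsilon> \<mu>. PP 1 f \<epsilon> \<mu> \<beta> - cnj (fhat f 0 (2 * \<kappa>)))
     else if i = 2 then (\<lambda>\<epsilon> \<mu>. PP (-1) f \<epsilon> \<mu> \<beta> - fhat f 0 0)
     else if i = 3 then (\<lambda>\<epsilon> \<mu>. RR 1 f \<epsilon> \<mu> \<beta> - fhat f 1 (- \<kappa>))
     else (\<lambda>\<epsilon> \<mu>. RR (-1) f \<epsilon> \<mu> \<beta> - fhat f 1 \<kappa>)"
  have "\<exists>C e. C > 0 \<and> e > 0 \<and>
        (\<forall>i\<in>{..4}. \<forall>\<epsilon> \<mu>. 0 \<le> \<epsilon> \<and> \<epsilon> \<le> e \<and> cmod \<mu> \<le> r \<longrightarrow> cmod (?X i \<epsilon> \<mu>) \<le> C * (\<epsilon> + cmod \<mu>))"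
  proof (rule common_linear_bound)
    show "?L (?X i)" for i
      using Q P1 P2 R1 R2 by simp
  qed simp
  then obtain C e where Ce: "C > 0" "e > 0"
    and ex: "\<forall>i\<in>{..4}. \<forall>\<epsilon> \<mu>. 0 \<le> \<epsilon> \<and> \<epsilon> \<le> e \<and> cmod \<mu> \<le> r \<longrightarrow> cmod (?X i \<epsilon> \<mu>) \<le> C * (\<epsilon> + cmod \<mu>)"
    by blast
  have b: "cmod (?X i \<epsilon> \<mu>) \<le> C * (\<epsilon> + cmod \<mu>)" if "i \<le> 4" "0 \<le> \<epsilon>" "\<epsilon> \<le> e" "cmod \<mu> \<le> r" for i \<epsilon> \<mu>
    by (rule ex[rule_format]) (use that in auto)
  show ?thesis
    by (rule that[OF Ce]) (use b[of 0] b[of 1] b[of 2] b[of 3] b[of 4] in simp_all)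
qed

text \<open>The zeroth-order term of F is the integral of f_0, which is real, so Im F starts at
  first order. In the last estimate \<epsilon>^2 is the tail of the Neumann series after two terms,
  and \<epsilon> |\<mu>| comes from replacing \<mu> by 0 in the first-order term.\<close>

lemma FF_bounds:
  obtains C e where "C \<ge> 1" "e > 0"
    "\<And>\<epsilon> \<mu>. 0 \<le> \<epsilon> \<Longrightarrow> \<epsilon> \<le> e \<Longrightarrow> cmod \<mu> \<le> r \<Longrightarrow> cmod (FF f \<epsilon> \<mu> \<beta>) \<le> C"
    "\<And>\<epsilon> \<mu> \<nu>. 0 \<le> \<epsilon> \<Longrightarrow> \<epsilon> \<le> e \<Longrightarrow> cmod \<mu> \<le> r \<Longrightarrow> cmod \<nu> \<le> r \<Longrightarrow>
       cmod (FF f \<epsilon> \<mu> \<beta> - FF f \<epsilon> \<nu> \<beta>) \<le> C * cmod (\<mu> - \<nu>)"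
    "\<And>\<epsilon> \<mu>. 0 \<le> \<epsilon> \<Longrightarrow> \<epsilon> \<le> e \<Longrightarrow> cmod \<mu> \<le> r \<Longrightarrow>
       \<bar>Im (FF f \<epsilon> \<mu> \<beta>) - \<epsilon> * Im (avg (Top f 0 \<beta> (g2 f) (-1)))\<bar> \<le> C * \<epsilon> * (\<epsilon> + cmod \<mu>)"
proof -
  obtain K where K: "K \<ge> 1"
    "\<And>\<epsilon> \<mu> M A m S. 0 \<le> \<epsilon> \<Longrightarrow> \<epsilon> * K \<le> 1 / 4 \<Longrightarrow> cmod \<mu> \<le> r \<Longrightarrow> bdd_seq R M A \<Longrightarrow>
       continuous_on S (Res f \<epsilon> \<mu> \<beta> A m)"
    "\<And>\<epsilon> \<mu> M A m x. cmod \<mu> \<le> r \<Longrightarrow> bdd_seq R M A \<Longrightarrow> \<bar>x\<bar> > R \<Longrightarrow> Res f \<epsilon> \<mu> \<beta> A m x = 0"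
    "\<And>\<epsilon> \<mu> M A m x N. 0 \<le> \<epsilon> \<Longrightarrow> \<epsilon> * K \<le> 1 / 4 \<Longrightarrow> cmod \<mu> \<le> r \<Longrightarrow> bdd_seq R M A \<Longrightarrow>
       cmod (Res f \<epsilon> \<mu> \<beta> A m x - (\<Sum>k<N. of_real \<epsilon> ^ k * (Top f \<mu> \<beta> ^^ k) A m x)) \<le> 2 * (\<epsilon> * K) ^ N * M"
    "\<And>\<epsilon> \<mu> \<nu> M A B D m x. 0 \<le> \<epsilon> \<Longrightarrow> \<epsilon> * K \<le> 1 / 4 \<Longrightarrow> cmod \<mu> \<le> r \<Longrightarrow> cmod \<nu> \<le> r \<Longrightarrow>
       bdd_seq R M A \<Longrightarrow> bdd_seq R M B \<Longrightarrow> (\<And>m x. cmod (A m x - B m x) \<le> D) \<Longrightarrow>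
       cmod (Res f \<epsilon> \<mu> \<beta> A m x - Res f \<epsilon> \<nu> \<beta> B m x) \<le> 2 * (D + cmod (\<mu> - \<nu>) * M)"
    using Res_bounds by blast
  obtain L where L: "L \<ge> 1"
    "\<And>\<mu> M A. cmod \<mu> \<le> r \<Longrightarrow> bdd_seq R M A \<Longrightarrow> bdd_seq R (L * M) (Top f \<mu> \<beta> A)"
    "\<And>\<mu> \<nu> M A B D m x. cmod \<mu> \<le> r \<Longrightarrow> cmod \<nu> \<le> r \<Longrightarrow> bdd_seq R M A \<Longrightarrow> bdd_seq R M B \<Longrightarrow>
       (\<And>m x. cmod (A m x - B m x) \<le> D) \<Longrightarrow>
       cmod (Top f \<mu> \<beta> A m x - Top f \<nu> \<beta> B m x) \<le> L * (D + cmod (\<mu> - \<nu>) * M)"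
    using Top_bounds by blast
  obtain M where M: "bdd_seq R M (g2 f)"
    using bdd_g2 by blast
  have M0: "0 \<le> M" by (rule bdd_seqD(4)[OF M])
  have r0: "cmod 0 \<le> r" using r by simp
  have FF: "FF f \<epsilon> \<mu> \<beta> = integral {-R..R} (Res f \<epsilon> \<mu> \<beta> (g2 f) (-1))" if "cmod \<mu> \<le> r" for \<epsilon> \<mu>
    unfolding FF_def by (intro avg_eq K(3)[OF that M])
  have small: "\<epsilon> * K \<le> 1 / 4" if "\<epsilon> \<le> 1 / (4 * K)" for \<epsilon>
    using that K(1) by (simp add: field_simps)
  define C where "C = 1 + 2 * R * (2 * M + (2 * K * K * M + L * M))"
  have nn: "0 \<le> 2 * R * (2 * M)" "0 \<le> 2 * R * (2 * K * K * M + L * M)"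
    using R M0 K(1) L(1) by auto
  have C: "1 \<le> C" "2 * R * (2 * M) \<le> C" "2 * R * (2 * K * K * M + L * M) \<le> C"
    using nn by (auto simp: C_def distrib_left)
  show ?thesis
  proof (rule that[of C "1 / (4 * K)"])
    show "C \<ge> 1" by (rule C)
    show "1 / (4 * K) > 0" using K(1) by simp
    show "cmod (FF f \<epsilon> \<mu> \<beta>) \<le> C" if "0 \<le> \<epsilon>" "\<epsilon> \<le> 1 / (4 * K)" and \<mu>: "cmod \<mu> \<le> r" for \<epsilon> \<mu>
    proof -
      have "cmod (integral {-R..R} (Res f \<epsilon> \<mu> \<beta> (g2 f) (-1))) \<le> 2 * R * (2 * M)"
        using K(4)[OF that(1) small[OF that(2)] \<mu> M, of _ _ 0] R
        by (intro norm_integral_le K(2)[OF that(1) small[OF that(2)] \<mu> M]) auto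
      thus ?thesis using FF[OF \<mu>] C by simp
    qed
    show "cmod (FF f \<epsilon> \<mu> \<beta> - FF f \<epsilon> \<nu> \<beta>) \<le> C * cmod (\<mu> - \<nu>)"
      if "0 \<le> \<epsilon>" "\<epsilon> \<le> 1 / (4 * K)" and \<mu>: "cmod \<mu> \<le> r" and \<nu>: "cmod \<nu> \<le> r" for \<epsilon> \<mu> \<nu>
    proof -
      note s = small[OF that(2)]
      have "cmod (integral {-R..R} (Res f \<epsilon> \<mu> \<beta> (g2 f) (-1)) - integral {-R..R} (Res f \<epsilon> \<nu> \<beta> (g2 f) (-1)))
          \<le> 2 * R * (2 * (0 + cmod (\<mu> - \<nu>) * M))"
        using R by (intro norm_integral_diff_le K(2)[OF that(1) s _ M] K(5)[OF that(1) s \<mu> \<nu> M M]) (auto simp: \<mu> \<nu>)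
      also have "\<dots> = 2 * R * (2 * M) * cmod (\<mu> - \<nu>)"
        by simp
      also have "\<dots> \<le> C * cmod (\<mu> - \<nu>)"
        by (intro mult_right_mono C) auto
      finally show ?thesis using FF[OF \<mu>] FF[OF \<nu>] by simp
    qed
    show "\<bar>Im (FF f \<epsilon> \<mu> \<beta>) - \<epsilon> * Im (avg (Top f 0 \<beta> (g2 f) (-1)))\<bar> \<le> C * \<epsilon> * (\<epsilon> + cmod \<mu>)"
      if \<epsilon>: "0 \<le> \<epsilon>" "\<epsilon> \<le> 1 / (4 * K)" and \<mu>: "cmod \<mu> \<le> r" for \<epsilon> \<mu>
    proof -
      note s = small[OF that(2)]
      let ?T = "Top f 0 \<beta> (g2 f) (-1)" and ?g = "fcoef f 0"
      have T: "avg ?T = integral {-R..R} ?T"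
        by (intro avg_eq bdd_seqD(3)[OF L(2)[OF r0 M]])
      have "cnj (integral {-R..R} ?g) = integral {-R..R} ?g"
        unfolding integral_cnj using fcoef_uminus[of 0] by (simp flip: integral_cnj)
      hence real: "Im (integral {-R..R} ?g) = 0"
        by (rule Im_eq_0_if_cnj_eq)
      have cT: "continuous_on {-R..R} ?T"
        by (rule bdd_seqD(1)[OF L(2)[OF r0 M]])
      have int: "integral {-R..R} (\<lambda>x. ?g x + of_real \<epsilon> * ?T x) = integral {-R..R} ?g + of_real \<epsilon> * integral {-R..R} ?T"
        by (intro integral_unique has_integral_add has_integral_mult_right integrable_integral
            integrable_continuous_real cT continuous_fcoef)
      have "cmod (integral {-R..R} (Res f \<epsilon> \<mu> \<beta> (g2 f) (-1)) - integral {-R..R} (\<lambda>x. ?g x + of_real \<epsilon> * ?T x))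
          \<le> 2 * R * ((2 * K * K * M + L * M) * \<epsilon> * (\<epsilon> + cmod \<mu>))"
      proof (rule norm_integral_diff_le)
        fix x assume "\<bar>x\<bar> \<le> R"
        let ?T\<mu> = "Top f \<mu> \<beta> (g2 f) (-1)"
        have "Res f \<epsilon> \<mu> \<beta> (g2 f) (-1) x - (?g x + of_real \<epsilon> * ?T x)
            = (Res f \<epsilon> \<mu> \<beta> (g2 f) (-1) x - (?g x + of_real \<epsilon> * ?T\<mu> x)) + of_real \<epsilon> * (?T\<mu> x - ?T x)"
          by (simp add: algebra_simps)
        also have "cmod \<dots> \<le> 2 * (\<epsilon> * K)\<^sup>2 * M + \<epsilon> * (L * (0 + cmod (\<mu> - 0) * M))"
        proof (rule norm_triangle_mono)
          show "cmod (Res f \<epsilon> \<mu> \<beta> (g2 f) (-1) x - (?g x + of_real \<epsilon> * ?T\<mu> x)) \<le> 2 * (\<epsilon> * K)\<^sup>2 * M"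
            using K(4)[OF \<epsilon>(1) s \<mu> M, of "-1" x 2] by (simp add: numeral_2_eq_2 g2_def)
          have "cmod (?T\<mu> x - ?T x) \<le> L * (0 + cmod (\<mu> - 0) * M)"
            by (intro L(3)[OF \<mu> r0 M M]) auto
          thus "cmod (of_real \<epsilon> * (?T\<mu> x - ?T x)) \<le> \<epsilon> * (L * (0 + cmod (\<mu> - 0) * M))"
            using \<epsilon>(1) by (simp add: norm_mult mult_left_mono)
        qed
        also have "\<dots> \<le> (2 * K * K * M + L * M) * \<epsilon> * (\<epsilon> + cmod \<mu>)"
          using \<epsilon>(1) M0 K(1) L(1) by (simp add: power2_eq_square algebra_simps)
        finally show "cmod (Res f \<epsilon> \<mu> \<beta> (g2 f) (-1) x - (?g x + of_real \<epsilon> * ?T x))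
            \<le> (2 * K * K * M + L * M) * \<epsilon> * (\<epsilon> + cmod \<mu>)" .
      qed (use R K(2)[OF \<epsilon>(1) s \<mu> M] in \<open>auto intro!: continuous_intros cT continuous_fcoef\<close>)
      also have "\<dots> = 2 * R * (2 * K * K * M + L * M) * (\<epsilon> * (\<epsilon> + cmod \<mu>))"
        by (simp add: mult.assoc)
      also have "\<dots> \<le> C * (\<epsilon> * (\<epsilon> + cmod \<mu>))"
        using \<epsilon>(1) by (intro mult_right_mono C) auto
      finally have "cmod (FF f \<epsilon> \<mu> \<beta> - (integral {-R..R} ?g + of_real \<epsilon> * avg ?T)) \<le> C * \<epsilon> * (\<epsilon> + cmod \<mu>)"
        using FF[OF \<mu>] T int by (simp add: mult.assoc)
      moreover have "Im (FF f \<epsilon> \<mu> \<beta> - (integral {-R..R} ?g + of_real \<epsilon> * avg ?T)) = Im (FF f \<epsilon> \<mu> \<beta>) - \<epsilon> * Im (avg ?T)"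
        using real by simp
      ultimately show ?thesis
        using abs_Im_le_cmod order_trans by metis
    qed
  qed
qed

end

subsection \<open>Scattering coefficients near the resonance\<close>

text \<open>Errors of size s survive multiplication as long as s is bounded. The lemma is applied
  with the filter \<open>principal S\<close>, for which membership in O means one constant valid on
  all of S; this is how uniformity in \<delta> is recorded.\<close>

lemma bigo_mult_diff:
  fixes x y s :: "'a \<Rightarrow> complex"
  assumes x: "(\<lambda>p. x p - x0) \<in> O[F](s)" and y: "(\<lambda>p. y p - y0) \<in> O[F](s)" and s: "s \<in> O[F](\<lambda>_. 1)"
  shows "(\<lambda>p. x p * y p - x0 * y0) \<in> O[F](s)"
proof -
  have "(\<lambda>p. (x p - x0) + x0) \<in> O[F](\<lambda>_. 1)"
    by (intro sum_in_bigo landau_o.big_trans[OF x s]) simp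
  hence "x \<in> O[F](\<lambda>_. 1)"
    by simp
  hence "(\<lambda>p. x p * (y p - y0)) \<in> O[F](\<lambda>p. 1 * s p)"
    by (rule landau_o.big.mult[OF _ y])
  moreover have "(\<lambda>p. y0 * (x p - x0)) \<in> O[F](s)"
    using x by (cases "y0 = 0") auto
  ultimately have "(\<lambda>p. x p * (y p - y0) + y0 * (x p - x0)) \<in> O[F](s)"
    by (intro sum_in_bigo) simp_all
  thus ?thesis
    by (simp add: algebra_simps)
qed

text \<open>Both coefficients are, up to explicit terms, \<open>W\<close> times the expression expanded here;
  \<open>u\<close> is the ratio of the model denominator \<open>\<epsilon> w\<close> to the true one.\<close>

lemma scattering_expansion:
  fixes \<gamma> Y P Q X u w :: "real \<times> real \<Rightarrow> complex" and S :: "(real \<times> real) set"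
  defines "s \<equiv> \<lambda>p. complex_of_real (fst p * (1 + \<bar>snd p\<bar>))"
  assumes "\<forall>p\<in>S. 0 < fst p \<and> fst p \<le> 1 \<and> fst p * \<bar>snd p\<bar> \<le> 1"
    and \<gamma>: "(\<lambda>p. \<gamma> p - \<gamma>0) \<in> O[principal S](s)" and Y: "(\<lambda>p. Y p - a) \<in> O[principal S](s)"
    and P: "(\<lambda>p. P p - p0) \<in> O[principal S](s)" and Q: "(\<lambda>p. Q p - q0) \<in> O[principal S](s)"
    and X: "(\<lambda>p. X p - x0) \<in> O[principal S](s)" and u: "(\<lambda>p. u p - 1) \<in> O[principal S](s)"
    and w: "(\<lambda>p. w p - of_real (snd p)) \<in> O[principal S](\<lambda>p. of_real (fst p))"
  shows "\<exists>C. \<forall>(\<epsilon>, \<delta>) \<in> S. cmod (Y (\<epsilon>, \<delta>) * (w (\<epsilon>, \<delta>) * P (\<epsilon>, \<delta>) + \<gamma> (\<epsilon>, \<delta>) * Q (\<epsilon>, \<delta>) * X (\<epsilon>, \<delta>) * u (\<epsilon>, \<delta>))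
           - a * (\<gamma>0 * q0 * x0) - of_real \<delta> * (a * p0)) \<le> C * (\<epsilon> + \<epsilon> * \<delta>\<^sup>2)"
proof -
  note S = bspec[OF assms(2)]
  define t where "t p = complex_of_real (fst p + fst p * (snd p)\<^sup>2)" for p :: "real \<times> real"
  have nt: "cmod (t p) = fst p + fst p * (snd p)\<^sup>2" if "p \<in> S" for p
    using S[OF that] by (simp add: t_def del: of_real_add of_real_mult)
  have le: "1 + \<bar>d\<bar> \<le> 2 * (1 + d\<^sup>2)" "\<bar>d\<bar> + d\<^sup>2 \<le> 2 * (1 + d\<^sup>2)" for d :: real
  proof -
    have aux: "1 + x \<le> 2 * (1 + q)" "x + q \<le> 2 * (1 + q)" if "x \<le> 1 + q" "0 \<le> q" for x q :: real
      using that by auto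
    have "\<bar>d\<bar> \<le> 1 + d\<^sup>2"
      using zero_le_power2[of "\<bar>d\<bar> - 1"] by (simp add: power2_eq_square algebra_simps)
    thus "1 + \<bar>d\<bar> \<le> 2 * (1 + d\<^sup>2)" "\<bar>d\<bar> + d\<^sup>2 \<le> 2 * (1 + d\<^sup>2)"
      by (rule aux; simp)+
  qed
  have s1: "s \<in> O[principal S](\<lambda>_. 1)"
  proof (rule bigoI[of _ 2])
    have "cmod (s p) \<le> 2 * norm (1 :: complex)" if "p \<in> S" for p
    proof -
      have "cmod (s p) = fst p + fst p * \<bar>snd p\<bar>"
        using S[OF that] by (simp add: s_def distrib_left del: of_real_add of_real_mult)
      thus ?thesis using S[OF that] by simp
    qed
    thus "\<forall>\<^sub>F p in principal S. norm (s p) \<le> 2 * norm (1 :: complex)"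
      by (simp add: eventually_principal)
  qed
  have st: "s \<in> O[principal S](t)"
  proof (rule bigoI[of _ 2])
    have "cmod (s p) \<le> 2 * cmod (t p)" if "p \<in> S" for p
    proof -
      have "cmod (s p) = fst p * (1 + \<bar>snd p\<bar>)"
        using S[OF that] by (simp add: s_def del: of_real_add of_real_mult)
      also have "\<dots> \<le> fst p * (2 * (1 + (snd p)\<^sup>2))"
        using S[OF that] le by (intro mult_left_mono) auto
      finally show ?thesis using nt[OF that] by (simp add: algebra_simps)
    qed
    thus "\<forall>\<^sub>F p in principal S. cmod (s p) \<le> 2 * cmod (t p)"
      by (simp add: eventually_principal)
  qed
  \<comment> \<open>The origin of the error \<epsilon> \<delta>^2: the term w P has size |\<delta>|,
    so its relative error \<epsilon> (1 + |\<delta>|) is multiplied by |\<delta>|.\<close>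
  have dst: "(\<lambda>p. of_real (snd p) * s p) \<in> O[principal S](t)"
  proof (rule bigoI[of _ 2])
    have "cmod (of_real (snd p) * s p) \<le> 2 * cmod (t p)" if "p \<in> S" for p
    proof -
      have "cmod (of_real (snd p) * s p) = fst p * (\<bar>snd p\<bar> + (snd p)\<^sup>2)"
        using S[OF that] by (simp add: s_def norm_mult algebra_simps power2_eq_square del: of_real_add of_real_mult)
      also have "\<dots> \<le> fst p * (2 * (1 + (snd p)\<^sup>2))"
        using S[OF that] le by (intro mult_left_mono) auto
      finally show ?thesis using nt[OF that] by (simp add: algebra_simps)
    qed
    thus "\<forall>\<^sub>F p in principal S. cmod (of_real (snd p) * s p) \<le> 2 * cmod (t p)"
      by (simp add: eventually_principal)
  qed
  have et: "(\<lambda>p. complex_of_real (fst p)) \<in> O[principal S](t)"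
  proof (rule bigoI[of _ 1])
    have "cmod (of_real (fst p)) \<le> 1 * cmod (t p)" if "p \<in> S" for p
      using S[OF that] nt[OF that] by simp
    thus "\<forall>\<^sub>F p in principal S. cmod (of_real (fst p)) \<le> 1 * cmod (t p)"
      by (simp add: eventually_principal)
  qed
  have O1: "x \<in> O[principal S](\<lambda>_. 1)" if "(\<lambda>p. x p - c) \<in> O[principal S](s)" for x and c :: complex
  proof -
    have "(\<lambda>p. (x p - c) + c) \<in> O[principal S](\<lambda>_. 1)"
      by (intro sum_in_bigo landau_o.big_trans[OF that s1]) simp
    thus ?thesis by simp
  qed
  have 1: "(\<lambda>p. (w p - of_real (snd p)) * (Y p * P p)) \<in> O[principal S](t)"
  proof -
    have "(\<lambda>p. (w p - of_real (snd p)) * (Y p * P p)) \<in> O[principal S](\<lambda>p. t p * (1 * 1))"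
      by (intro landau_o.big.mult O1[OF Y] O1[OF P] landau_o.big_trans[OF w et])
    thus ?thesis by simp
  qed
  have 2: "(\<lambda>p. of_real (snd p) * (Y p * P p - a * p0)) \<in> O[principal S](t)"
    by (rule landau_o.big_trans[OF landau_o.big.mult[OF landau_o.big_refl bigo_mult_diff[OF Y P s1]] dst])
  have 3: "(\<lambda>p. Y p * (\<gamma> p * Q p * X p * u p) - a * (\<gamma>0 * q0 * x0 * 1)) \<in> O[principal S](t)"
    by (rule landau_o.big_trans[OF _ st]) (intro bigo_mult_diff s1 \<gamma> Y Q X u)
  \<comment> \<open>The product w Y P is split at \<delta>: the part w - \<delta> is O(\<epsilon>)
    and hence pure error, and only \<delta> Y P contributes to the leading terms.\<close>
  have "(\<lambda>p. (w p - of_real (snd p)) * (Y p * P p) + of_real (snd p) * (Y p * P p - a * p0)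
      + (Y p * (\<gamma> p * Q p * X p * u p) - a * (\<gamma>0 * q0 * x0 * 1))) \<in> O[principal S](t)"
    by (intro sum_in_bigo 1 2 3)
  then obtain C where C: "\<forall>p\<in>S. cmod ((w p - of_real (snd p)) * (Y p * P p) + of_real (snd p) * (Y p * P p - a * p0)
      + (Y p * (\<gamma> p * Q p * X p * u p) - a * (\<gamma>0 * q0 * x0 * 1))) \<le> C * cmod (t p)"
    by (elim landau_o.bigE) (auto simp: eventually_principal)
  show ?thesis
  proof (intro exI[of _ C] ballI, clarify)
    fix \<epsilon> \<delta> assume p: "(\<epsilon>, \<delta>) \<in> S"
    show "cmod (Y (\<epsilon>, \<delta>) * (w (\<epsilon>, \<delta>) * P (\<epsilon>, \<delta>) + \<gamma> (\<epsilon>, \<delta>) * Q (\<epsilon>, \<delta>) * X (\<epsilon>, \<delta>) * u (\<epsilon>, \<delta>))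
           - a * (\<gamma>0 * q0 * x0) - of_real \<delta> * (a * p0)) \<le> C * (\<epsilon> + \<epsilon> * \<delta>\<^sup>2)"
      using bspec[OF C p] nt[OF p] by (simp add: algebra_simps)
  qed
qed

text \<open>W equals i \<epsilon> / w, so the prefactor i \<epsilon> of the coefficient becomes W w;
  the true denominator D enters only through the ratio \<epsilon> w / D. The second identity writes
  the incident wave, the 1 in the transmission coefficient, with the same factor W.\<close>

lemma scat_eq_Wfun:
  fixes w D :: complex
  assumes "\<epsilon> > 0" "w = of_real \<delta> - \<i> * of_real (\<epsilon> * \<Gamma> / 2)" "w \<noteq> 0" "D \<noteq> 0"
    and D: "D = \<mu> - of_real \<epsilon> * gam \<mu> \<beta> * FF f \<epsilon> \<mu> \<beta>" and "kk0 \<mu> \<beta> \<noteq> 0"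
  shows "scat s f \<epsilon> \<mu> \<beta> = Wfun \<Gamma> (\<delta> / \<epsilon>) *
     (gam \<mu> \<beta> / kk0 \<mu> \<beta> * (w * PP s f \<epsilon> \<mu> \<beta>
        + gam \<mu> \<beta> * QQ f \<epsilon> \<mu> \<beta> * RR s f \<epsilon> \<mu> \<beta> * (of_real \<epsilon> * w / D)))"
    and "1 = Wfun \<Gamma> (\<delta> / \<epsilon>) * (of_real \<delta> / (\<i> * of_real \<epsilon>) - of_real \<Gamma> / 2)"
proof -
  have "of_real (\<delta> / \<epsilon>) - \<i> * of_real \<Gamma> / 2 = w / of_real \<epsilon>"
    unfolding assms(2) using assms(1) by (simp add: diff_divide_distrib)
  hence W: "Wfun \<Gamma> (\<delta> / \<epsilon>) = \<i> * of_real \<epsilon> / w"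
    by (simp add: Wfun_def)
  show "scat s f \<epsilon> \<mu> \<beta> = Wfun \<Gamma> (\<delta> / \<epsilon>) *
     (gam \<mu> \<beta> / kk0 \<mu> \<beta> * (w * PP s f \<epsilon> \<mu> \<beta>
        + gam \<mu> \<beta> * QQ f \<epsilon> \<mu> \<beta> * RR s f \<epsilon> \<mu> \<beta> * (of_real \<epsilon> * w / D)))"
    unfolding scat_def D [symmetric] W using assms(3,4,6) by (simp add: field_simps)
  have "of_real \<delta> / (\<i> * of_real \<epsilon>) - of_real \<Gamma> / 2 = w / (\<i> * of_real \<epsilon>)"
    unfolding assms(2) using assms(1) by (simp add: diff_divide_distrib)
  thus "1 = Wfun \<Gamma> (\<delta> / \<epsilon>) * (of_real \<delta> / (\<i> * of_real \<epsilon>) - of_real \<Gamma> / 2)"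
    unfolding W using assms(1,3) by simp
qed

context grating
begin

section \<open>Location of the pole and size of the denominator\<close>

definition g0 :: real where "g0 = (1 - \<beta>)\<^sup>2 / (4 * pi)"

lemma g0: "0 < g0" "g0 \<le> 1"
proof -
  show "0 < g0" using \<beta> by (simp add: g0_def)
  have "(1 - \<beta>)\<^sup>2 \<le> 1" using \<beta> by (simp add: abs_square_le_1)
  thus "g0 \<le> 1" using pi_ge_two by (simp add: g0_def divide_le_eq)
qed

definition \<Gamma> :: real where
  "\<Gamma> = g0\<^sup>2 / \<kappa> * ((cmod (fhat f 1 \<kappa>))\<^sup>2 + (cmod (fhat f 1 (- \<kappa>)))\<^sup>2)"

lemma \<Gamma>_nonneg: "0 \<le> \<Gamma>"
  unfolding \<Gamma>_def using \<kappa> by simp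

text \<open>From \<nu> = gamma F and |gamma| \<le> 1 the root is bounded, so \<mu> = O(\<epsilon>)
  and gamma differs from its real value \<open>g0\<close> by O(\<epsilon>^2). Hence Im \<nu> is
  \<open>g0\<close> times Im F up to O(\<epsilon>^2), and the first-order term of Im F gives
  \<epsilon> \<Gamma> / 2. The summand C^3 accounts for the variation of gamma, C (1 + C) for the
  remainder of Im F with |\<mu>| \<le> C \<epsilon>.\<close>

lemma pole_location:
  assumes "C \<ge> 1" "0 < \<epsilon>" "cmod (of_real \<epsilon> * \<nu>) \<le> r"
    and root: "\<nu> - gam (of_real \<epsilon> * \<nu>) \<beta> * FF f \<epsilon> (of_real \<epsilon> * \<nu>) \<beta> = 0"
    and F: "cmod (FF f \<epsilon> (of_real \<epsilon> * \<nu>) \<beta>) \<le> C"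
      "\<bar>Im (FF f \<epsilon> (of_real \<epsilon> * \<nu>) \<beta>) - \<epsilon> * Im (avg (Top f 0 \<beta> (g2 f) (-1)))\<bar> \<le> C * \<epsilon> * (\<epsilon> + cmod (of_real \<epsilon> * \<nu>))"
  shows "cmod \<nu> \<le> C" "\<bar>Im \<nu> - \<epsilon> * \<Gamma> / 2\<bar> \<le> (C ^ 3 + C * (1 + C)) * \<epsilon>\<^sup>2"
proof -
  define \<mu> where "\<mu> = of_real \<epsilon> * \<nu>"
  define \<eta> where "\<eta> = gam \<mu> \<beta> - of_real g0"
  have r\<mu>: "cmod \<mu> \<le> r" using assms by (simp add: \<mu>_def)
  have \<nu>: "\<nu> = gam \<mu> \<beta> * FF f \<epsilon> \<mu> \<beta>"
    using root by (simp add: \<mu>_def)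
  have "cmod \<nu> \<le> 1 * C"
    unfolding \<nu> norm_mult using gam_bounds(1)[OF r\<mu> r\<mu>] F(1) by (intro mult_mono) (auto simp: \<mu>_def)
  thus C: "cmod \<nu> \<le> C" by simp
  have \<mu>C: "cmod \<mu> \<le> \<epsilon> * C"
    using C assms(2) by (simp add: \<mu>_def norm_mult)
  have "\<eta> = - \<mu>\<^sup>2 / of_real (4 * pi)"
    by (simp add: \<eta>_def gam_def g0_def diff_divide_distrib)
  hence "cmod \<eta> = (cmod \<mu>)\<^sup>2 / (4 * pi)"
    by (simp add: norm_divide norm_power norm_mult)
  also have "\<dots> \<le> (cmod \<mu>)\<^sup>2 / 1"
    using pi_ge_two by (intro divide_left_mono) auto
  also have "\<dots> \<le> (\<epsilon> * C)\<^sup>2"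
    using \<mu>C by (simp add: power_mono)
  finally have \<eta>: "cmod \<eta> \<le> (\<epsilon> * C)\<^sup>2" .
  have "\<nu> = of_real g0 * FF f \<epsilon> \<mu> \<beta> + \<eta> * FF f \<epsilon> \<mu> \<beta>"
    by (subst \<nu>) (simp add: \<eta>_def algebra_simps)
  hence "Im \<nu> = g0 * Im (FF f \<epsilon> \<mu> \<beta>) + Im (\<eta> * FF f \<epsilon> \<mu> \<beta>)"
    by simp
  moreover have "\<epsilon> * \<Gamma> / 2 = g0 * (\<epsilon> * Im (avg (Top f 0 \<beta> (g2 f) (-1))))"
    unfolding Im_avg_Top \<Gamma>_def g0_def by (simp add: power2_eq_square)
  ultimately have "Im \<nu> - \<epsilon> * \<Gamma> / 2
      = g0 * (Im (FF f \<epsilon> \<mu> \<beta>) - \<epsilon> * Im (avg (Top f 0 \<beta> (g2 f) (-1)))) + Im (\<eta> * FF f \<epsilon> \<mu> \<beta>)"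
    unfolding right_diff_distrib by linarith
  hence "\<bar>Im \<nu> - \<epsilon> * \<Gamma> / 2\<bar>
      \<le> \<bar>g0 * (Im (FF f \<epsilon> \<mu> \<beta>) - \<epsilon> * Im (avg (Top f 0 \<beta> (g2 f) (-1))))\<bar> + \<bar>Im (\<eta> * FF f \<epsilon> \<mu> \<beta>)\<bar>"
    by (simp only: abs_triangle_ineq)
  also have "\<dots> \<le> g0 * \<bar>Im (FF f \<epsilon> \<mu> \<beta>) - \<epsilon> * Im (avg (Top f 0 \<beta> (g2 f) (-1)))\<bar> + cmod (\<eta> * FF f \<epsilon> \<mu> \<beta>)"
    using g0 by (intro add_mono abs_Im_le_cmod) (simp add: abs_mult)
  also have "\<dots> \<le> 1 * (C * \<epsilon> * (\<epsilon> + \<epsilon> * C)) + (\<epsilon> * C)\<^sup>2 * C"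
  proof (rule add_mono)
    have "C * \<epsilon> * (\<epsilon> + cmod \<mu>) \<le> C * \<epsilon> * (\<epsilon> + \<epsilon> * C)"
      using assms(1,2) \<mu>C by (intro mult_left_mono) auto
    thus "g0 * \<bar>Im (FF f \<epsilon> \<mu> \<beta>) - \<epsilon> * Im (avg (Top f 0 \<beta> (g2 f) (-1)))\<bar> \<le> 1 * (C * \<epsilon> * (\<epsilon> + \<epsilon> * C))"
      using F(2) g0 unfolding \<mu>_def[symmetric] by (intro mult_mono) auto
    show "cmod (\<eta> * FF f \<epsilon> \<mu> \<beta>) \<le> (\<epsilon> * C)\<^sup>2 * C"
      unfolding norm_mult using \<eta> F(1) by (intro mult_mono) (auto simp: \<mu>_def)
  qed
  also have "\<dots> = (C ^ 3 + C * (1 + C)) * \<epsilon>\<^sup>2"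
    by (simp add: algebra_simps power2_eq_square power3_eq_cube)
  finally show "\<bar>Im \<nu> - \<epsilon> * \<Gamma> / 2\<bar> \<le> (C ^ 3 + C * (1 + C)) * \<epsilon>\<^sup>2" .
qed

text \<open>A collects two relative errors: 2 B / \<Gamma> from replacing \<nu> - \<nu>0 by w, and 2
  C (1 + 2 B / \<Gamma>) from the variation of gamma F between \<mu> and the root. The condition A
  \<epsilon> \<le> 1 / 2 yields |D| \<ge> \<epsilon> |w| / 2, which costs the factor 2 in the last
  bound.\<close>

lemma denominator_asymptotics:
  assumes "\<Gamma> > 0" "C \<ge> 1" "B \<ge> 0" "0 < \<epsilon>" "\<epsilon> \<le> 1"
    and \<mu>0: "cmod (of_real \<epsilon> * \<nu>0) \<le> r" and \<mu>r: "cmod \<mu> \<le> r"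
    and \<mu>: "\<mu> = of_real (\<epsilon> * (Re \<nu>0 + \<delta>))"
    and root: "\<nu>0 - gam (of_real \<epsilon> * \<nu>0) \<beta> * FF f \<epsilon> (of_real \<epsilon> * \<nu>0) \<beta> = 0"
    and Im: "\<bar>Im \<nu>0 - \<epsilon> * \<Gamma> / 2\<bar> \<le> B * \<epsilon>\<^sup>2"
    and F: "\<And>\<mu>. cmod \<mu> \<le> r \<Longrightarrow> cmod (FF f \<epsilon> \<mu> \<beta>) \<le> C"
      "\<And>\<mu> \<nu>. cmod \<mu> \<le> r \<Longrightarrow> cmod \<nu> \<le> r \<Longrightarrow> cmod (FF f \<epsilon> \<mu> \<beta> - FF f \<epsilon> \<nu> \<beta>) \<le> C * cmod (\<mu> - \<nu>)"
  defines "A \<equiv> 2 * B / \<Gamma> + 2 * C * (1 + 2 * B / \<Gamma>)"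
    and "w \<equiv> complex_of_real \<delta> - \<i> * of_real (\<epsilon> * \<Gamma> / 2)"
    and "D \<equiv> \<mu> - of_real \<epsilon> * gam \<mu> \<beta> * FF f \<epsilon> \<mu> \<beta>"
  assumes small: "A * \<epsilon> \<le> 1 / 2"
  shows "w \<noteq> 0" "D \<noteq> 0" "cmod (of_real \<epsilon> * w / D - 1) \<le> 2 * A * \<epsilon>"
proof -
  have "\<bar>Im w\<bar> \<le> cmod w"
    by (rule abs_Im_le_cmod)
  \<comment> \<open>The only lower bound for w that is uniform in \<delta>; it converts absolute
    errors of order \<epsilon>^2 into relative errors of order \<epsilon>.\<close>
  hence w: "\<epsilon> * \<Gamma> / 2 \<le> cmod w"
    using assms(1,4) by (simp add: w_def)
  have w0: "cmod w > 0"
    using w assms(1,4) by (meson half_gt_zero less_le_trans mult_pos_pos)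
  thus "w \<noteq> 0" by simp
  define \<nu>d where "\<nu>d = of_real (Re \<nu>0 + \<delta>) - \<nu>0"
  have "\<nu>d - w = - \<i> * of_real (Im \<nu>0 - \<epsilon> * \<Gamma> / 2)"
    by (simp add: \<nu>d_def w_def complex_eq_iff)
  hence "cmod (\<nu>d - w) = \<bar>Im \<nu>0 - \<epsilon> * \<Gamma> / 2\<bar>"
    by (simp only: norm_mult norm_minus_cancel norm_ii norm_of_real mult_1_left)
  also have "\<dots> \<le> (2 * B / \<Gamma>) * \<epsilon> * (\<epsilon> * \<Gamma> / 2)"
    using Im assms(1) by (simp add: power2_eq_square)
  also have "\<dots> \<le> (2 * B / \<Gamma>) * \<epsilon> * cmod w"
    using w assms(1,3,4) by (intro mult_left_mono) auto
  finally have \<nu>d: "cmod (\<nu>d - w) \<le> (2 * B / \<Gamma>) * \<epsilon> * cmod w" .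
  have \<nu>d': "cmod \<nu>d \<le> (1 + 2 * B / \<Gamma>) * cmod w"
  proof -
    have "cmod \<nu>d \<le> cmod w + cmod (\<nu>d - w)"
      by (metis add.commute norm_triangle_sub)
    also have "\<dots> \<le> cmod w + (2 * B / \<Gamma>) * 1 * cmod w"
      using \<nu>d assms(1,3,5) by (intro add_left_mono order_trans[OF \<nu>d] mult_right_mono mult_left_mono) auto
    finally show ?thesis by (simp add: algebra_simps)
  qed
  define \<Phi> where "\<Phi> \<mu> = gam \<mu> \<beta> * FF f \<epsilon> \<mu> \<beta>" for \<mu>
  \<comment> \<open>One C is the Lipschitz constant of F, with |gamma| \<le> 1; the other is the
    bound on F, with gamma Lipschitz of constant 1.\<close>
  have \<Phi>: "cmod (\<Phi> \<mu> - \<Phi> (of_real \<epsilon> * \<nu>0)) \<le> 2 * C * (\<epsilon> * cmod \<nu>d)"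
  proof -
    let ?\<nu> = "of_real \<epsilon> * \<nu>0"
    have "\<Phi> \<mu> - \<Phi> ?\<nu> = gam \<mu> \<beta> * (FF f \<epsilon> \<mu> \<beta> - FF f \<epsilon> ?\<nu> \<beta>) + (gam \<mu> \<beta> - gam ?\<nu> \<beta>) * FF f \<epsilon> ?\<nu> \<beta>"
      by (simp add: \<Phi>_def algebra_simps)
    also have "cmod \<dots> \<le> 1 * (C * cmod (\<mu> - ?\<nu>)) + cmod (\<mu> - ?\<nu>) * C"
      by (rule norm_triangle_mono; unfold norm_mult; intro mult_mono)
         (use gam_bounds[OF \<mu>r \<mu>0] F(1)[OF \<mu>0] F(2)[OF \<mu>r \<mu>0] in auto)
    also have "\<mu> - ?\<nu> = of_real \<epsilon> * \<nu>d"
      by (simp add: \<mu> \<nu>d_def algebra_simps)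
    finally show ?thesis using assms(4) by (simp add: norm_mult)
  qed
  have "\<nu>0 = \<Phi> (of_real \<epsilon> * \<nu>0)"
    using root by (simp add: \<Phi>_def)
  \<comment> \<open>The root equation is subtracted here: both remaining differences are small
    compared with w, no matter how small \<delta> is.\<close>
  hence D: "D - of_real \<epsilon> * w = of_real \<epsilon> * ((\<nu>d - w) - (\<Phi> \<mu> - \<Phi> (of_real \<epsilon> * \<nu>0)))"
    by (simp add: D_def \<mu> \<nu>d_def \<Phi>_def algebra_simps)
  have "cmod (D - of_real \<epsilon> * w) = \<epsilon> * cmod ((\<nu>d - w) - (\<Phi> \<mu> - \<Phi> (of_real \<epsilon> * \<nu>0)))"
    unfolding D norm_mult using assms(4) by simp
  also have "\<dots> \<le> \<epsilon> * (cmod (\<nu>d - w) + cmod (\<Phi> \<mu> - \<Phi> (of_real \<epsilon> * \<nu>0)))"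
    using assms(4) by (intro mult_left_mono norm_triangle_ineq4) auto
  also have "\<dots> \<le> \<epsilon> * ((2 * B / \<Gamma>) * \<epsilon> * cmod w + 2 * C * (\<epsilon> * ((1 + 2 * B / \<Gamma>) * cmod w)))"
    using assms(2,4) \<nu>d' by (intro mult_left_mono add_mono \<nu>d order_trans[OF \<Phi>]) auto
  also have "\<dots> = A * \<epsilon> * (\<epsilon> * cmod w)"
    by (simp add: A_def algebra_simps)
  finally have DA: "cmod (D - of_real \<epsilon> * w) \<le> A * \<epsilon> * (\<epsilon> * cmod w)" .
  have A: "0 \<le> A" using assms(1-3) by (simp add: A_def)
  have "cmod (of_real \<epsilon> * w) \<le> cmod D + cmod (D - of_real \<epsilon> * w)"
    by (metis norm_minus_commute norm_triangle_sub)
  also have "\<dots> \<le> cmod D + 1 / 2 * (\<epsilon> * cmod w)"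
    using small assms(4) by (intro add_left_mono order_trans[OF DA] mult_right_mono) auto
  finally have D2: "\<epsilon> * cmod w \<le> 2 * cmod D"
    using assms(4) by (simp add: norm_mult)
  have "0 < cmod D"
    using D2 mult_pos_pos[OF assms(4) w0] by linarith
  thus D0: "D \<noteq> 0" by simp
  have "of_real \<epsilon> * w / D - 1 = - ((D - of_real \<epsilon> * w) / D)"
    using D0 by (simp add: field_simps)
  hence "cmod (of_real \<epsilon> * w / D - 1) = cmod (D - of_real \<epsilon> * w) / cmod D"
    by (simp only: norm_minus_cancel norm_divide)
  also have "\<dots> \<le> A * \<epsilon> * (2 * cmod D) / cmod D"
  proof (rule divide_right_mono)
    show "cmod (D - of_real \<epsilon> * w) \<le> A * \<epsilon> * (2 * cmod D)"
      using D2 A assms(4) by (intro order_trans[OF DA] mult_left_mono) auto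
  qed simp
  also have "\<dots> = 2 * A * \<epsilon>"
    using D0 by simp
  finally show "cmod (of_real \<epsilon> * w / D - 1) \<le> 2 * A * \<epsilon>" .
qed

text \<open>The constant - \<Gamma> / 2 from the incident wave and the resonant term with |d_+|^2
  are still separate here; they are merged only in the final statement.\<close>

theorem scattering_asymptotics:
  fixes \<delta>0 :: "real \<Rightarrow> real" and \<nu>0 :: "real \<Rightarrow> complex"
  assumes \<Gamma>: "\<Gamma> > 0"
    and \<delta>0_lim: "((\<lambda>\<epsilon>. \<epsilon> * (\<delta>0 \<epsilon>)^2) \<longlongrightarrow> 0) (at_right 0)"
    and \<nu>0_root: "\<forall>\<^sub>F \<epsilon> in at_right 0.
                  \<nu>0 \<epsilon> - gam (of_real \<epsilon> * \<nu>0 \<epsilon>) \<beta> * FF f \<epsilon> (of_real \<epsilon> * \<nu>0 \<epsilon>) \<beta> = 0"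
    and \<nu>0_small: "((\<lambda>\<epsilon>. of_real \<epsilon> * \<nu>0 \<epsilon>) \<longlongrightarrow> 0) (at_right 0)"
  defines "dp \<equiv> fhat f 1 \<kappa>" and "dm \<equiv> fhat f 1 (- \<kappa>)" and "\<mu> \<equiv> \<lambda>\<epsilon> \<delta>. complex_of_real (\<epsilon> * (Re (\<nu>0 \<epsilon>) + \<delta>))"
  shows "\<exists>C \<epsilon>1. \<epsilon>1 > 0 \<and> (\<forall>\<epsilon> \<delta>. 0 < \<epsilon> \<and> \<epsilon> < \<epsilon>1 \<and> \<bar>\<delta>\<bar> < \<delta>0 \<epsilon> \<longrightarrow>
      (\<exists>E. Refl f \<epsilon> (\<mu> \<epsilon> \<delta>) \<beta> = Wfun \<Gamma> (\<delta> / \<epsilon>) *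
             (of_real g0 / of_real \<kappa> * (of_real g0 * cnj dp * dm)
              + of_real \<delta> * (of_real g0 / of_real \<kappa> * cnj (fhat f 0 (2 * \<kappa>))) + E)
         \<and> cmod E \<le> C * (\<epsilon> + \<epsilon> * \<delta>\<^sup>2)) \<and>
      (\<exists>E. Trans f \<epsilon> (\<mu> \<epsilon> \<delta>) \<beta> = Wfun \<Gamma> (\<delta> / \<epsilon>) *
             (of_real \<delta> / (\<i> * of_real \<epsilon>) - of_real \<Gamma> / 2 + of_real g0 / of_real \<kappa> * (of_real g0 * cnj dp * dp)
              + of_real \<delta> * (of_real g0 / of_real \<kappa> * fhat f 0 0) + E)
         \<and> cmod E \<le> C * (\<epsilon> + \<epsilon> * \<delta>\<^sup>2)))"
proof -
  obtain C1 e1 where C1: "C1 > 0" "e1 > 0"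
    and lim: "\<And>\<epsilon> \<mu>. 0 \<le> \<epsilon> \<Longrightarrow> \<epsilon> \<le> e1 \<Longrightarrow> cmod \<mu> \<le> r \<Longrightarrow> cmod (QQ f \<epsilon> \<mu> \<beta> - cnj dp) \<le> C1 * (\<epsilon> + cmod \<mu>)"
    "\<And>\<epsilon> \<mu>. 0 \<le> \<epsilon> \<Longrightarrow> \<epsilon> \<le> e1 \<Longrightarrow> cmod \<mu> \<le> r \<Longrightarrow> cmod (PP 1 f \<epsilon> \<mu> \<beta> - cnj (fhat f 0 (2 * \<kappa>))) \<le> C1 * (\<epsilon> + cmod \<mu>)"
    "\<And>\<epsilon> \<mu>. 0 \<le> \<epsilon> \<Longrightarrow> \<epsilon> \<le> e1 \<Longrightarrow> cmod \<mu> \<le> r \<Longrightarrow> cmod (PP (-1) f \<epsilon> \<mu> \<beta> - fhat f 0 0) \<le> C1 * (\<epsilon> + cmod \<mu>)"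
    "\<And>\<epsilon> \<mu>. 0 \<le> \<epsilon> \<Longrightarrow> \<epsilon> \<le> e1 \<Longrightarrow> cmod \<mu> \<le> r \<Longrightarrow> cmod (RR 1 f \<epsilon> \<mu> \<beta> - dm) \<le> C1 * (\<epsilon> + cmod \<mu>)"
    "\<And>\<epsilon> \<mu>. 0 \<le> \<epsilon> \<Longrightarrow> \<epsilon> \<le> e1 \<Longrightarrow> cmod \<mu> \<le> r \<Longrightarrow> cmod (RR (-1) f \<epsilon> \<mu> \<beta> - dp) \<le> C1 * (\<epsilon> + cmod \<mu>)"
    unfolding dp_def dm_def using coefficient_limits by blast
  obtain C e where C: "C \<ge> 1" "e > 0"
    and F: "\<And>\<epsilon> \<mu>. 0 \<le> \<epsilon> \<Longrightarrow> \<epsilon> \<le> e \<Longrightarrow> cmod \<mu> \<le> r \<Longrightarrow> cmod (FF f \<epsilon> \<mu> \<beta>) \<le> C"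
    "\<And>\<epsilon> \<mu> \<nu>. 0 \<le> \<epsilon> \<Longrightarrow> \<epsilon> \<le> e \<Longrightarrow> cmod \<mu> \<le> r \<Longrightarrow> cmod \<nu> \<le> r \<Longrightarrow>
       cmod (FF f \<epsilon> \<mu> \<beta> - FF f \<epsilon> \<nu> \<beta>) \<le> C * cmod (\<mu> - \<nu>)"
    "\<And>\<epsilon> \<mu>. 0 \<le> \<epsilon> \<Longrightarrow> \<epsilon> \<le> e \<Longrightarrow> cmod \<mu> \<le> r \<Longrightarrow>
       \<bar>Im (FF f \<epsilon> \<mu> \<beta>) - \<epsilon> * Im (avg (Top f 0 \<beta> (g2 f) (-1)))\<bar> \<le> C * \<epsilon> * (\<epsilon> + cmod \<mu>)"
    using FF_bounds by blast
  define B where "B = C ^ 3 + C * (1 + C)"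
  define A where "A = 2 * B / \<Gamma> + 2 * C * (1 + 2 * B / \<Gamma>)"
  have B: "B \<ge> 0" using C by (simp add: B_def)
  have A: "A > 0"
  proof -
    have b: "0 \<le> 2 * B / \<Gamma>" using B \<Gamma> by simp
    hence "0 < 2 * C * (1 + 2 * B / \<Gamma>)" using C by (intro mult_pos_pos) auto
    thus ?thesis unfolding A_def using b by linarith
  qed
  have "\<forall>\<^sub>F \<epsilon> in at_right 0. cmod (of_real \<epsilon> * \<nu>0 \<epsilon>) < r"
    using tendstoD[OF \<nu>0_small r(1)] by (simp add: dist_norm)
  moreover have "\<forall>\<^sub>F \<epsilon> in at_right 0. \<epsilon> * (\<delta>0 \<epsilon>)\<^sup>2 < 1"
    using order_tendstoD(2)[OF \<delta>0_lim, of 1] by simp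
  ultimately have "\<forall>\<^sub>F \<epsilon> in at_right 0. cmod (of_real \<epsilon> * \<nu>0 \<epsilon>) < r \<and> \<epsilon> * (\<delta>0 \<epsilon>)\<^sup>2 < 1
      \<and> \<nu>0 \<epsilon> - gam (of_real \<epsilon> * \<nu>0 \<epsilon>) \<beta> * FF f \<epsilon> (of_real \<epsilon> * \<nu>0 \<epsilon>) \<beta> = 0"
    using \<nu>0_root by eventually_elim blast
  then obtain e2 where e2: "e2 > 0" "\<And>\<epsilon>. 0 < \<epsilon> \<Longrightarrow> \<epsilon> < e2 \<Longrightarrow> cmod (of_real \<epsilon> * \<nu>0 \<epsilon>) < r"
      "\<And>\<epsilon>. 0 < \<epsilon> \<Longrightarrow> \<epsilon> < e2 \<Longrightarrow> \<epsilon> * (\<delta>0 \<epsilon>)\<^sup>2 < 1"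
      "\<And>\<epsilon>. 0 < \<epsilon> \<Longrightarrow> \<epsilon> < e2 \<Longrightarrow> \<nu>0 \<epsilon> - gam (of_real \<epsilon> * \<nu>0 \<epsilon>) \<beta> * FF f \<epsilon> (of_real \<epsilon> * \<nu>0 \<epsilon>) \<beta> = 0"
    unfolding eventually_at_right_field by blast
  \<comment> \<open>1 / (2 A) is the smallness needed for the denominator. The square (r / (C +
    1))^2 makes both \<epsilon> and \<epsilon> |\<delta>| at most r / (C + 1), the latter after
    taking a root, and then |\<mu>| \<le> C \<epsilon> + \<epsilon> |\<delta>| \<le> r.\<close>
  define \<epsilon>1 where "\<epsilon>1 = Min {e1, e, e2, 1, 1 / (2 * A), (r / (C + 1))\<^sup>2}"
  have \<epsilon>1: "\<epsilon>1 > 0"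
    unfolding \<epsilon>1_def using C1 C e2 A r by auto
  have \<epsilon>1_le: "\<epsilon> < e1" "\<epsilon> < e" "\<epsilon> < e2" "\<epsilon> < 1" "\<epsilon> < 1 / (2 * A)" "\<epsilon> < (r / (C + 1))\<^sup>2" if "\<epsilon> < \<epsilon>1" for \<epsilon>
    using that by (auto simp: \<epsilon>1_def)
  define S where "S = {p. 0 < fst p \<and> fst p < \<epsilon>1 \<and> \<bar>snd p\<bar> < \<delta>0 (fst p)}"
  let ?m = "\<lambda>p. \<mu> (fst p) (snd p)"
  have S: "0 < fst p" "fst p \<le> e1" "fst p \<le> e" "fst p < e2" "fst p \<le> 1" "A * fst p \<le> 1 / 2"
      "fst p * \<bar>snd p\<bar> \<le> 1" "cmod (?m p) \<le> r" "cmod (?m p) \<le> C * (fst p * (1 + \<bar>snd p\<bar>))"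
      "cmod (\<nu>0 (fst p)) \<le> C" "\<bar>Im (\<nu>0 (fst p)) - fst p * \<Gamma> / 2\<bar> \<le> B * (fst p)\<^sup>2" if p: "p \<in> S" for p
  proof -
    define \<epsilon> \<delta> where "\<epsilon> = fst p" and "\<delta> = snd p"
    have \<epsilon>: "0 < \<epsilon>" "\<epsilon> < \<epsilon>1" and \<delta>: "\<bar>\<delta>\<bar> < \<delta>0 \<epsilon>"
      using p by (auto simp: S_def \<epsilon>_def \<delta>_def)
    note le = \<epsilon>1_le[OF \<epsilon>(2)]
    have \<mu>0: "cmod (of_real \<epsilon> * \<nu>0 \<epsilon>) \<le> r"
      using e2(2)[of \<epsilon>] \<epsilon> le by simp
    have "0 \<le> \<epsilon>" "\<epsilon> \<le> e"
      using \<epsilon> le by simp_all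
    note pole = pole_location[OF C(1) \<epsilon>(1) \<mu>0 e2(4)[OF \<epsilon>(1) le(3)] F(1)[OF this \<mu>0] F(3)[OF this \<mu>0], folded B_def]
    \<comment> \<open>The growth condition on \<delta>0 enters here: \<epsilon> \<delta>0^2 < 1
      leaves one spare factor \<epsilon> in (\<epsilon> \<delta>)^2.\<close>
    have "(\<epsilon> * \<bar>\<delta>\<bar>)\<^sup>2 \<le> \<epsilon> * (\<epsilon> * (\<delta>0 \<epsilon>)\<^sup>2)"
      using \<epsilon>(1) power_mono[of "\<bar>\<delta>\<bar>" "\<delta>0 \<epsilon>" 2] \<delta> by (simp add: power_mult_distrib power2_eq_square mult.assoc)
    also have "\<dots> \<le> \<epsilon> * 1"
      using e2(3)[of \<epsilon>] \<epsilon> le by (intro mult_left_mono) auto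
    also have "\<dots> \<le> (r / (C + 1))\<^sup>2"
      using le by simp
    finally have \<epsilon>\<delta>: "\<epsilon> * \<bar>\<delta>\<bar> \<le> r / (C + 1)"
      by (rule power2_le_imp_le) (use r C in simp)
    have rC: "r / (C + 1) \<le> 1"
      using r C by (simp add: divide_le_eq)
    have "\<epsilon> \<le> r / (C + 1)"
    proof -
      have "(r / (C + 1))\<^sup>2 \<le> r / (C + 1)"
        unfolding power2_eq_square by (rule mult_left_le[OF rC]) (use r C in simp)
      thus ?thesis using le by simp
    qed
    have "cmod (\<mu> \<epsilon> \<delta>) = \<epsilon> * \<bar>Re (\<nu>0 \<epsilon>) + \<delta>\<bar>"
      unfolding \<mu>_def norm_of_real using \<epsilon>(1) by (simp add: abs_mult)
    also have "\<dots> \<le> \<epsilon> * (C + \<bar>\<delta>\<bar>)"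
      using \<epsilon>(1) abs_Re_le_cmod[of "\<nu>0 \<epsilon>"] pole(1) by (intro mult_left_mono) auto
    finally have \<mu>1: "cmod (\<mu> \<epsilon> \<delta>) \<le> C * \<epsilon> + \<epsilon> * \<bar>\<delta>\<bar>"
      by (simp add: algebra_simps)
    also have "\<dots> \<le> C * (r / (C + 1)) + r / (C + 1)"
      using C \<open>\<epsilon> \<le> r / (C + 1)\<close> \<epsilon>\<delta> by (intro add_mono mult_left_mono) auto
    also have "\<dots> = (C + 1) * (r / (C + 1))"
      by (simp only: distrib_right mult_1_left)
    also have "\<dots> = r"
      using C by simp
    finally have \<mu>2: "cmod (\<mu> \<epsilon> \<delta>) \<le> r" .
    have "C * \<epsilon> + 1 * (\<epsilon> * \<bar>\<delta>\<bar>) \<le> C * \<epsilon> + C * (\<epsilon> * \<bar>\<delta>\<bar>)"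
      using C \<epsilon>(1) by (intro add_left_mono mult_right_mono) auto
    hence \<mu>3: "cmod (\<mu> \<epsilon> \<delta>) \<le> C * (\<epsilon> * (1 + \<bar>\<delta>\<bar>))"
      using \<mu>1 by (simp add: algebra_simps)
    have "A * \<epsilon> \<le> 1 / 2"
      using le(5) A by (simp add: field_simps)
    thus "0 < fst p" "fst p \<le> e1" "fst p \<le> e" "fst p < e2" "fst p \<le> 1" "A * fst p \<le> 1 / 2"
      "fst p * \<bar>snd p\<bar> \<le> 1" "cmod (?m p) \<le> r" "cmod (?m p) \<le> C * (fst p * (1 + \<bar>snd p\<bar>))"
      "cmod (\<nu>0 (fst p)) \<le> C" "\<bar>Im (\<nu>0 (fst p)) - fst p * \<Gamma> / 2\<bar> \<le> B * (fst p)\<^sup>2"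
      using \<epsilon> le pole \<epsilon>\<delta> rC \<mu>2 \<mu>3 by (simp_all add: \<epsilon>_def \<delta>_def)
  qed
  let ?s = "\<lambda>p. complex_of_real (fst p * (1 + \<bar>snd p\<bar>))"
  have ns: "norm (?s p) = fst p * (1 + \<bar>snd p\<bar>)" if "p \<in> S" for p
    unfolding norm_of_real using S(1)[OF that] by simp
  \<comment> \<open>On S, |\<mu>| is at most C \<epsilon> (1 + |\<delta>|), so a bound linear in
    \<epsilon> + |\<mu>| becomes O(\<epsilon> (1 + |\<delta>|)).\<close>
  have Os: "g \<in> O[principal S](?s)" if g: "\<And>p. p \<in> S \<Longrightarrow> cmod (g p) \<le> K * (fst p + cmod (?m p))" "0 \<le> K" for g K
  proof (rule bigoI[of _ "K * (1 + C)"])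
    have "cmod (g p) \<le> K * (1 + C) * norm (?s p)" if p: "p \<in> S" for p
    proof -
      have "fst p + cmod (?m p) \<le> 1 * (fst p * (1 + \<bar>snd p\<bar>)) + C * (fst p * (1 + \<bar>snd p\<bar>))"
        using S(1,9)[OF p] by (intro add_mono) (auto simp: algebra_simps)
      hence "K * (fst p + cmod (?m p)) \<le> K * ((1 + C) * (fst p * (1 + \<bar>snd p\<bar>)))"
        using \<open>0 \<le> K\<close> by (intro mult_left_mono) (auto simp: algebra_simps)
      thus ?thesis using g(1)[OF p] ns[OF p] by (simp add: mult.assoc)
    qed
    thus "\<forall>\<^sub>F p in principal S. cmod (g p) \<le> K * (1 + C) * norm (?s p)"
      by (simp add: eventually_principal)
  qed
  define D where "D p = ?m p - of_real (fst p) * gam (?m p) \<beta> * FF f (fst p) (?m p) \<beta>" for p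
  define w where "w p = complex_of_real (snd p) - \<i> * of_real (fst p * \<Gamma> / 2)" for p :: "real \<times> real"
  have den: "w p \<noteq> 0" "D p \<noteq> 0" "cmod (of_real (fst p) * w p / D p - 1) \<le> 2 * A * fst p" if p: "p \<in> S" for p
  proof -
    have \<mu>0: "cmod (of_real (fst p) * \<nu>0 (fst p)) \<le> r"
      using e2(2)[of "fst p"] S[OF p] by simp
    have eq: "?m p = of_real (fst p * (Re (\<nu>0 (fst p)) + snd p))"
      by (simp add: \<mu>_def)
    have small: "(2 * B / \<Gamma> + 2 * C * (1 + 2 * B / \<Gamma>)) * fst p \<le> 1 / 2"
      using S(6)[OF p] by (simp only: A_def)
    note * = denominator_asymptotics[OF \<Gamma> C(1) B S(1)[OF p] S(5)[OF p] \<mu>0 S(8)[OF p] eq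
        e2(4)[OF S(1)[OF p] S(4)[OF p]] S(11)[OF p] F(1)[OF less_imp_le[OF S(1)[OF p]] S(3)[OF p]]
        F(2)[OF less_imp_le[OF S(1)[OF p]] S(3)[OF p]] small]
    show "w p \<noteq> 0"
      unfolding w_def by (rule *(1))
    show "D p \<noteq> 0"
      unfolding D_def by (rule *(2))
    show "cmod (of_real (fst p) * w p / D p - 1) \<le> 2 * A * fst p"
      unfolding w_def D_def A_def by (rule *(3))
  qed
  have O\<gamma>: "(\<lambda>p. gam (?m p) \<beta> - of_real g0) \<in> O[principal S](?s)"
  proof (rule Os[of _ 1])
    show "cmod (gam (?m p) \<beta> - of_real g0) \<le> 1 * (fst p + cmod (?m p))" if "p \<in> S" for p
      using gam_bounds(2)[OF S(8)[OF that], of 0] r S(1)[OF that] by (simp add: gam_0 g0_def)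
  qed simp
  \<comment> \<open>The reciprocal is treated by itself, so that gamma / k_0 is covered by the
    product rule for errors.\<close>
  have Ok: "(\<lambda>p. 1 / kk0 (?m p) \<beta> - 1 / of_real \<kappa>) \<in> O[principal S](?s)"
  proof (rule Os[of _ "1 / (sqrt c0 * sqrt c0 * sqrt c0)"])
    fix p assume p: "p \<in> S"
    have k: "sqrt c0 \<le> cmod (kk0 (?m p) \<beta>)" "sqrt c0 \<le> cmod (of_real \<kappa>)" "sqrt c0 > 0"
      using kk0_bounds(1)[OF S(8)[OF p]] kk0_bounds(1)[of 0] r c0 by (simp_all add: kk0_0)
    have "kk0 (?m p) \<beta> \<noteq> 0" "complex_of_real \<kappa> \<noteq> 0" using k by auto
    hence "1 / kk0 (?m p) \<beta> - 1 / of_real \<kappa> = (of_real \<kappa> - kk0 (?m p) \<beta>) / (kk0 (?m p) \<beta> * of_real \<kappa>)"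
      by (simp add: field_simps)
    hence "cmod (1 / kk0 (?m p) \<beta> - 1 / of_real \<kappa>) = cmod (kk0 (?m p) \<beta> - kk0 0 \<beta>) / (cmod (kk0 (?m p) \<beta>) * cmod (of_real \<kappa>))"
      by (simp only: norm_divide norm_mult norm_minus_commute kk0_0)
    also have "\<dots> \<le> (cmod (?m p - 0) / sqrt c0) / (sqrt c0 * sqrt c0)"
      using k r by (intro frac_le mult_mono kk0_lipschitz S(8)[OF p]) auto
    also have "\<dots> = 1 / (sqrt c0 * sqrt c0 * sqrt c0) * cmod (?m p)"
      by simp
    also have "\<dots> \<le> 1 / (sqrt c0 * sqrt c0 * sqrt c0) * (fst p + cmod (?m p))"
      using k S(1)[OF p] by (intro mult_left_mono) auto
    finally show "cmod (1 / kk0 (?m p) \<beta> - 1 / of_real \<kappa>) \<le> 1 / (sqrt c0 * sqrt c0 * sqrt c0) * (fst p + cmod (?m p))" .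
  qed (use c0 in auto)
  have s1: "?s \<in> O[principal S](\<lambda>_. 1)"
  proof (rule bigoI[of _ 2])
    have "norm (?s p) \<le> 2 * norm (1 :: complex)" if "p \<in> S" for p
      using ns[OF that] S(5,7)[OF that] by (simp add: algebra_simps)
    thus "\<forall>\<^sub>F p in principal S. norm (?s p) \<le> 2 * norm (1 :: complex)"
      by (simp add: eventually_principal)
  qed
  have OY: "(\<lambda>p. gam (?m p) \<beta> / kk0 (?m p) \<beta> - of_real g0 / of_real \<kappa>) \<in> O[principal S](?s)"
    using bigo_mult_diff[OF O\<gamma> Ok s1] by simp
  have Ou: "(\<lambda>p. of_real (fst p) * w p / D p - 1) \<in> O[principal S](?s)"
  proof (rule Os[of _ "2 * A"])
    show "cmod (of_real (fst p) * w p / D p - 1) \<le> 2 * A * (fst p + cmod (?m p))" if "p \<in> S" for p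
      using A by (intro order_trans[OF den(3)[OF that]] mult_left_mono) auto
  qed (use A in simp)
  have Ow: "(\<lambda>p. w p - of_real (snd p)) \<in> O[principal S](\<lambda>p. of_real (fst p))"
    by (rule bigoI[of _ "\<Gamma> / 2"]) (use \<Gamma> in \<open>auto simp: w_def eventually_principal norm_mult norm_divide\<close>)
  have OL: "(\<lambda>p. QQ f (fst p) (?m p) \<beta> - cnj dp) \<in> O[principal S](?s)"
    "(\<lambda>p. PP 1 f (fst p) (?m p) \<beta> - cnj (fhat f 0 (2 * \<kappa>))) \<in> O[principal S](?s)"
    "(\<lambda>p. PP (-1) f (fst p) (?m p) \<beta> - fhat f 0 0) \<in> O[principal S](?s)"
    "(\<lambda>p. RR 1 f (fst p) (?m p) \<beta> - dm) \<in> O[principal S](?s)"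
    "(\<lambda>p. RR (-1) f (fst p) (?m p) \<beta> - dp) \<in> O[principal S](?s)"
    by (rule Os[OF lim(1)] Os[OF lim(2)] Os[OF lim(3)] Os[OF lim(4)] Os[OF lim(5)];
        use S C1 in \<open>auto intro: less_imp_le\<close>)+
  have Sb: "\<forall>p\<in>S. 0 < fst p \<and> fst p \<le> 1 \<and> fst p * \<bar>snd p\<bar> \<le> 1"
    using S by simp
  obtain CR where CR: "\<forall>(\<epsilon>, \<delta>) \<in> S. cmod (gam (\<mu> \<epsilon> \<delta>) \<beta> / kk0 (\<mu> \<epsilon> \<delta>) \<beta> * (w (\<epsilon>, \<delta>) * PP 1 f \<epsilon> (\<mu> \<epsilon> \<delta>) \<beta>
        + gam (\<mu> \<epsilon> \<delta>) \<beta> * QQ f \<epsilon> (\<mu> \<epsilon> \<delta>) \<beta> * RR 1 f \<epsilon> (\<mu> \<epsilon> \<delta>) \<beta> * (of_real \<epsilon> * w (\<epsilon>, \<delta>) / D (\<epsilon>, \<delta>)))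
        - of_real g0 / of_real \<kappa> * (of_real g0 * cnj dp * dm)
        - of_real \<delta> * (of_real g0 / of_real \<kappa> * cnj (fhat f 0 (2 * \<kappa>)))) \<le> CR * (\<epsilon> + \<epsilon> * \<delta>\<^sup>2)"
    by (rule exE[OF scattering_expansion[OF Sb O\<gamma> OY OL(2) OL(1) OL(4) Ou Ow, unfolded fst_conv snd_conv]])
       (rule that)
  obtain CT where CT: "\<forall>(\<epsilon>, \<delta>) \<in> S. cmod (gam (\<mu> \<epsilon> \<delta>) \<beta> / kk0 (\<mu> \<epsilon> \<delta>) \<beta> * (w (\<epsilon>, \<delta>) * PP (-1) f \<epsilon> (\<mu> \<epsilon> \<delta>) \<beta>
        + gam (\<mu> \<epsilon> \<delta>) \<beta> * QQ f \<epsilon> (\<mu> \<epsilon> \<delta>) \<beta> * RR (-1) f \<epsilon> (\<mu> \<epsilon> \<delta>) \<beta> * (of_real \<epsilon> * w (\<epsilon>, \<delta>) / D (\<epsilon>, \<delta>)))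
        - of_real g0 / of_real \<kappa> * (of_real g0 * cnj dp * dp)
        - of_real \<delta> * (of_real g0 / of_real \<kappa> * fhat f 0 0)) \<le> CT * (\<epsilon> + \<epsilon> * \<delta>\<^sup>2)"
    by (rule exE[OF scattering_expansion[OF Sb O\<gamma> OY OL(3) OL(1) OL(5) Ou Ow, unfolded fst_conv snd_conv]])
       (rule that)
  show ?thesis
  proof (rule exI[of _ "max CR CT"], rule exI[of _ \<epsilon>1], intro conjI allI impI \<epsilon>1; elim conjE)
    fix \<epsilon> \<delta> assume *: "0 < \<epsilon>" "\<epsilon> < \<epsilon>1" "\<bar>\<delta>\<bar> < \<delta>0 \<epsilon>"
    hence p: "(\<epsilon>, \<delta>) \<in> S" by (simp add: S_def)
    have k: "kk0 (\<mu> \<epsilon> \<delta>) \<beta> \<noteq> 0"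
      using kk0_bounds(1)[of "\<mu> \<epsilon> \<delta>"] S(8)[OF p] c0 by auto
    have "w (\<epsilon>, \<delta>) = of_real \<delta> - \<i> * of_real (\<epsilon> * \<Gamma> / 2)"
      by (simp add: w_def)
    moreover have "D (\<epsilon>, \<delta>) = \<mu> \<epsilon> \<delta> - of_real \<epsilon> * gam (\<mu> \<epsilon> \<delta>) \<beta> * FF f \<epsilon> (\<mu> \<epsilon> \<delta>) \<beta>"
      by (simp add: D_def)
    ultimately have W: "scat s f \<epsilon> (\<mu> \<epsilon> \<delta>) \<beta> = Wfun \<Gamma> (\<delta> / \<epsilon>) *
         (gam (\<mu> \<epsilon> \<delta>) \<beta> / kk0 (\<mu> \<epsilon> \<delta>) \<beta> * (w (\<epsilon>, \<delta>) * PP s f \<epsilon> (\<mu> \<epsilon> \<delta>) \<beta>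
            + gam (\<mu> \<epsilon> \<delta>) \<beta> * QQ f \<epsilon> (\<mu> \<epsilon> \<delta>) \<beta> * RR s f \<epsilon> (\<mu> \<epsilon> \<delta>) \<beta> * (of_real \<epsilon> * w (\<epsilon>, \<delta>) / D (\<epsilon>, \<delta>))))"
      and W1: "1 = Wfun \<Gamma> (\<delta> / \<epsilon>) * (of_real \<delta> / (\<i> * of_real \<epsilon>) - of_real \<Gamma> / 2)" for s
      by (rule scat_eq_Wfun[OF *(1) _ den(1,2)[OF p] _ k])+
    \<comment> \<open>The witness E is whatever is left after subtracting the leading terms, so the
      identities are exact and all analysis sits in the bound on E.\<close>
    have split: "V * x = V * (z + d + (x - z - d))" "V * y + V * x = V * (y + z + d + (x - z - d))" for V x y z d :: complex
      by (simp_all add: algebra_simps)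
    have mono: "c \<le> max CR CT \<Longrightarrow> c * (\<epsilon> + \<epsilon> * \<delta>\<^sup>2) \<le> max CR CT * (\<epsilon> + \<epsilon> * \<delta>\<^sup>2)" for c
      using *(1) by (intro mult_right_mono) auto
    show "\<exists>E. Refl f \<epsilon> (\<mu> \<epsilon> \<delta>) \<beta> = Wfun \<Gamma> (\<delta> / \<epsilon>) *
             (of_real g0 / of_real \<kappa> * (of_real g0 * cnj dp * dm)
              + of_real \<delta> * (of_real g0 / of_real \<kappa> * cnj (fhat f 0 (2 * \<kappa>))) + E)
         \<and> cmod E \<le> max CR CT * (\<epsilon> + \<epsilon> * \<delta>\<^sup>2)"
      by (rule exI, rule conjI[OF _ order_trans[OF bspec[OF CR p, unfolded prod.case] mono]])
         (unfold Refl_def W, rule split(1), simp)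
    show "\<exists>E. Trans f \<epsilon> (\<mu> \<epsilon> \<delta>) \<beta> = Wfun \<Gamma> (\<delta> / \<epsilon>) *
             (of_real \<delta> / (\<i> * of_real \<epsilon>) - of_real \<Gamma> / 2 + of_real g0 / of_real \<kappa> * (of_real g0 * cnj dp * dp)
              + of_real \<delta> * (of_real g0 / of_real \<kappa> * fhat f 0 0) + E)
         \<and> cmod E \<le> max CR CT * (\<epsilon> + \<epsilon> * \<delta>\<^sup>2)"
    proof (rule exI, rule conjI[OF _ order_trans[OF bspec[OF CT p, unfolded prod.case] mono]])
      show "Trans f \<epsilon> (\<mu> \<epsilon> \<delta>) \<beta> = Wfun \<Gamma> (\<delta> / \<epsilon>) *
             (of_real \<delta> / (\<i> * of_real \<epsilon>) - of_real \<Gamma> / 2 + of_real g0 / of_real \<kappa> * (of_real g0 * cnj dp * dp)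
              + of_real \<delta> * (of_real g0 / of_real \<kappa> * fhat f 0 0)
              + (gam (\<mu> \<epsilon> \<delta>) \<beta> / kk0 (\<mu> \<epsilon> \<delta>) \<beta> * (w (\<epsilon>, \<delta>) * PP (-1) f \<epsilon> (\<mu> \<epsilon> \<delta>) \<beta>
        + gam (\<mu> \<epsilon> \<delta>) \<beta> * QQ f \<epsilon> (\<mu> \<epsilon> \<delta>) \<beta> * RR (-1) f \<epsilon> (\<mu> \<epsilon> \<delta>) \<beta> * (of_real \<epsilon> * w (\<epsilon>, \<delta>) / D (\<epsilon>, \<delta>)))
        - of_real g0 / of_real \<kappa> * (of_real g0 * cnj dp * dp)
        - of_real \<delta> * (of_real g0 / of_real \<kappa> * fhat f 0 0)))"
        unfolding Trans_def W split(2) [symmetric] using W1 by (rule arg_cong2[where f = "(+)", OF _ refl])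
    qed simp
  qed
qed

end

section \<open>Passage to the stated form of the expansions\<close>

theorem theorem5p1:
  fixes f :: "real \<times> real \<Rightarrow> real" and Rs \<beta> :: real
    and \<delta>0 :: "real \<Rightarrow> real" and \<nu>0 :: "real \<Rightarrow> complex"
  assumes f_smooth: "smooth f"
    and f_per: "\<And>x y. f (x, y + 2*pi) = f (x, y)"
    and f_supp: "\<And>x y. \<bar>x\<bar> > Rs \<Longrightarrow> f (x, y) = 0"
    and \<beta>: "0 < \<beta>" "\<beta> < 1/2"
    and \<Gamma>_nz: "(gam 0 \<beta>)^2 / of_real (sqrt (1 - 2*\<beta>))
                  * of_real ((cmod (fhat f 1 (sqrt (1 - 2*\<beta>))))^2
                             + (cmod (fhat f 1 (- sqrt (1 - 2*\<beta>))))^2) \<noteq> 0"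
    and \<delta>0_pos: "\<And>\<epsilon>. \<epsilon> > 0 \<Longrightarrow> \<delta>0 \<epsilon> > 0"
    and \<delta>0_lim: "((\<lambda>\<epsilon>. \<epsilon> * (\<delta>0 \<epsilon>)^2) \<longlongrightarrow> 0) (at_right 0)"
    and \<nu>0_root: "\<forall>\<^sub>F \<epsilon> in at_right 0.
                  \<nu>0 \<epsilon> - gam (of_real \<epsilon> * \<nu>0 \<epsilon>) \<beta> * FF f \<epsilon> (of_real \<epsilon> * \<nu>0 \<epsilon>) \<beta> = 0"
    and \<nu>0_small: "((\<lambda>\<epsilon>. of_real \<epsilon> * \<nu>0 \<epsilon>) \<longlongrightarrow> 0) (at_right 0)"
  shows "\<exists>C \<epsilon>1. \<epsilon>1 > 0 \<and> (\<forall>\<epsilon> \<delta>. 0 < \<epsilon> \<and> \<epsilon> < \<epsilon>1 \<and> \<bar>\<delta>\<bar> < \<delta>0 \<epsilon>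
           \<and> Re (\<nu>0 \<epsilon>) + \<delta> > 0 \<longrightarrow>
           (let \<kappa> = sqrt (1 - 2*\<beta>);
                dp = fhat f 1 \<kappa>; dm = fhat f 1 (- \<kappa>);
                \<gamma>0 = gam 0 \<beta>;
                \<Gamma> = Re (\<gamma>0^2 / of_real \<kappa> * of_real ((cmod dp)^2 + (cmod dm)^2));
                \<mu> = of_real (\<epsilon> * (Re (\<nu>0 \<epsilon>) + \<delta>));
                W = Wfun \<Gamma> (\<delta> / \<epsilon>)
            in (\<exists>E. Refl f \<epsilon> \<mu> \<beta> =
                      W * (\<gamma>0^2 / of_real \<kappa> * cnj dp * dm
                           + of_real \<delta> * cnj (fhat f 0 (2*\<kappa>)) * \<gamma>0 / of_real \<kappa> + E)
                    \<and> cmod E \<le> C * (\<epsilon> + \<epsilon> * \<delta>^2))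
             \<and> (\<exists>E. Trans f \<epsilon> \<mu> \<beta> =
                      W * (of_real \<delta> / (\<i> * of_real \<epsilon>)
                           + \<gamma>0^2 / (2 * of_real \<kappa>) * of_real ((cmod dp)^2 - (cmod dm)^2)
                           + of_real \<delta> * fhat f 0 0 * \<gamma>0 / of_real \<kappa> + E)
                    \<and> cmod E \<le> C * (\<epsilon> + \<epsilon> * \<delta>^2))))"
proof -
  interpret grating f "\<bar>Rs\<bar> + 1" \<beta>
    by unfold_locales (use f_smooth f_per f_supp \<beta> in auto)
  let ?dp = "fhat f 1 \<kappa>" and ?dm = "fhat f 1 (- \<kappa>)"
  have gam0: "gam 0 \<beta> = of_real g0"
    by (simp add: gam_0 g0_def)
  have \<Gamma>_eq: "gam 0 \<beta> ^ 2 / of_real \<kappa> * of_real ((cmod ?dp)\<^sup>2 + (cmod ?dm)\<^sup>2) = of_real \<Gamma>"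
    by (simp add: gam0 \<Gamma>_def)
  have "\<Gamma> \<noteq> 0"
    using \<Gamma>_nz \<Gamma>_eq unfolding \<kappa>_def by auto
  hence "\<Gamma> > 0"
    using \<Gamma>_nonneg by simp
  obtain C \<epsilon>1 where "\<epsilon>1 > 0" and
    main: "\<forall>\<epsilon> \<delta>. 0 < \<epsilon> \<and> \<epsilon> < \<epsilon>1 \<and> \<bar>\<delta>\<bar> < \<delta>0 \<epsilon> \<longrightarrow>
      (\<exists>E. Refl f \<epsilon> (of_real (\<epsilon> * (Re (\<nu>0 \<epsilon>) + \<delta>))) \<beta> = Wfun \<Gamma> (\<delta> / \<epsilon>) *
             (of_real g0 / of_real \<kappa> * (of_real g0 * cnj ?dp * ?dm)
              + of_real \<delta> * (of_real g0 / of_real \<kappa> * cnj (fhat f 0 (2 * \<kappa>))) + E)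
         \<and> cmod E \<le> C * (\<epsilon> + \<epsilon> * \<delta>\<^sup>2)) \<and>
      (\<exists>E. Trans f \<epsilon> (of_real (\<epsilon> * (Re (\<nu>0 \<epsilon>) + \<delta>))) \<beta> = Wfun \<Gamma> (\<delta> / \<epsilon>) *
             (of_real \<delta> / (\<i> * of_real \<epsilon>) - of_real \<Gamma> / 2 + of_real g0 / of_real \<kappa> * (of_real g0 * cnj ?dp * ?dp)
              + of_real \<delta> * (of_real g0 / of_real \<kappa> * fhat f 0 0) + E)
         \<and> cmod E \<le> C * (\<epsilon> + \<epsilon> * \<delta>\<^sup>2))"
    by (rule exE[OF scattering_asymptotics[OF \<open>\<Gamma> > 0\<close> \<delta>0_lim \<nu>0_root \<nu>0_small]], elim exE conjE) (rule that)
  have R: "of_real g0 / of_real \<kappa> * (of_real g0 * cnj ?dp * ?dm)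
              + of_real \<delta> * (of_real g0 / of_real \<kappa> * cnj (fhat f 0 (2 * \<kappa>)))
      = gam 0 \<beta> ^ 2 / of_real \<kappa> * cnj ?dp * ?dm + of_real \<delta> * cnj (fhat f 0 (2 * \<kappa>)) * gam 0 \<beta> / of_real \<kappa>" for \<delta>
    by (simp add: gam0 power2_eq_square mult_ac)
  \<comment> \<open>The cancellation behind the transmission formula: |d_+|^2 - (|d_+|^2 + |d_-|^2)
    / 2 is half the difference of the squares.\<close>
  have T: "of_real \<delta> / (\<i> * of_real \<epsilon>) - of_real \<Gamma> / 2 + of_real g0 / of_real \<kappa> * (of_real g0 * cnj ?dp * ?dp)
              + of_real \<delta> * (of_real g0 / of_real \<kappa> * fhat f 0 0)
      = of_real \<delta> / (\<i> * of_real \<epsilon>) + gam 0 \<beta> ^ 2 / (2 * of_real \<kappa>) * of_real ((cmod ?dp)\<^sup>2 - (cmod ?dm)\<^sup>2)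
              + of_real \<delta> * fhat f 0 0 * gam 0 \<beta> / of_real \<kappa>" for \<epsilon> \<delta>
  proof -
    have "cnj ?dp * ?dp = of_real ((cmod ?dp)\<^sup>2)"
      by (simp only: complex_norm_square mult.commute)
    hence "of_real g0 / of_real \<kappa> * (of_real g0 * cnj ?dp * ?dp) - of_real \<Gamma> / 2
        = of_real (g0\<^sup>2 / \<kappa> * (cmod ?dp)\<^sup>2 - \<Gamma> / 2)"
      by (simp add: power2_eq_square mult.assoc)
    also have "g0\<^sup>2 / \<kappa> * (cmod ?dp)\<^sup>2 - \<Gamma> / 2 = g0\<^sup>2 / (2 * \<kappa>) * ((cmod ?dp)\<^sup>2 - (cmod ?dm)\<^sup>2)"
      unfolding \<Gamma>_def using \<kappa> by (simp add: field_simps)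
    also have "complex_of_real \<dots> = gam 0 \<beta> ^ 2 / (2 * of_real \<kappa>) * of_real ((cmod ?dp)\<^sup>2 - (cmod ?dm)\<^sup>2)"
      by (simp add: gam0)
    finally have "gam 0 \<beta> ^ 2 / (2 * of_real \<kappa>) * of_real ((cmod ?dp)\<^sup>2 - (cmod ?dm)\<^sup>2)
        = of_real g0 / of_real \<kappa> * (of_real g0 * cnj ?dp * ?dp) - of_real \<Gamma> / 2" ..
    thus ?thesis
      by (simp only: gam0) (simp add: mult_ac)
  qed
  show ?thesis
    unfolding Let_def \<kappa>_def [symmetric] \<Gamma>_eq Re_complex_of_real
  proof (rule exI[of _ C], rule exI[of _ \<epsilon>1], intro conjI[OF \<open>\<epsilon>1 > 0\<close>] allI impI, goal_cases)
    case (1 \<epsilon> \<delta>)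
    hence "0 < \<epsilon> \<and> \<epsilon> < \<epsilon>1 \<and> \<bar>\<delta>\<bar> < \<delta>0 \<epsilon>"
      by simp
    thus ?case
      by (rule main[unfolded R T, rule_format])
  qed
qed

end
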